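(* In the network model described in the context (with the loads of the other hotspots given by their Gaussian approximations), the rate coverage probability of the typical user for a target data-rate $\rho>0$ is $$\mathtt{P_r}=\mathtt{P_r}_{\rm m}+\mathtt{P_r}_{\rm s},$$ where $\mathtt{P_r}_{\rm m}$ (resp. $\mathtt{P_r}_{\rm s}$) is the probability that the typical user is served by the anchored base station, ABS (resp. by the small cell base station, SBS) and receives data-rate exceeding $\rho$. The ABS-rate coverage is $$\mathtt{P_r}_{\rm m}=\sum_{k=1}^{\bar m}\binom{\bar m-1}{k-1}\int_{-\infty}^{\infty}\int_0^{R-R_{\rm s}}\mathtt{P_c}_{\rm m}\!\left(2^{\frac{\rho(t+k)}{W_{\rm a}}}-1\,\Big|\,x\right){\cal A}_{\rm m}(x)^{k-1}{\cal A}_{\rm s}(x)^{\bar m-k}f_X(x)\,{\rm d}x\,\frac{1}{\sigma_{\rm m}\sqrt{2\pi}}e^{-\frac{(t-\upsilon_{\rm m})^2}{2\sigma_{\rm m}^2}}\,{\rm d}t.$$ The SBS-rate coverage depends on the backhaul bandwidth partition strategy. For equal partition, $$\mathtt{P_r}_{\rm s}=\sum_{k=1}^{\bar m}\binom{\bar m-1}{k-1}\int_0^{R-R_{\rm s}}\mathtt{P_c}_{\rm s}\!\left(2^{\frac{\rho nk}{W_{\rm b}}}-1,\,2^{\frac{\rho k}{W_{\rm a}}}-1\,\Big|\,x\right){\cal A}_{\rm s}(x)^{k-1}{\cal A}_{\rm m}(x)^{\bar m-k}f_X(x)\,{\rm d}x,$$ and for load-based partition, $$\mathtt{P_r}_{\rm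 s}=\sum_{k=1}^{\bar m}\binom{\bar m-1}{k-1}\int_{-\infty}^{\infty}\int_0^{R-R_{\rm s}}\mathtt{P_c}_{\rm s}\!\left(2^{\frac{\rho(k+t)}{W_{\rm b}}}-1,\,2^{\frac{\rho k}{W_{\rm a}}}-1\,\Big|\,x\right){\cal A}_{\rm s}(x)^{k-1}{\cal A}_{\rm m}(x)^{\bar m-k}f_X(x)\,{\rm d}x\,\frac{1}{\sigma_{\rm s}\sqrt{2\pi}}e^{-\frac{(t-\upsilon_{\rm s})^2}{2\sigma_{\rm s}^2}}\,{\rm d}t.$$
   Context: Parameters: integers $n\ge2$, $\bar m\ge1$; $R>R_{\rm s}>0$; $P_{\rm m}>P_{\rm s}>0$ (transmit powers of the ABS and of the SBSs); $G,\beta,{\tt N}_0,W,\mu,\alpha,\alpha_L,\alpha_{NL},m_L,m_{NL}>0$ in linear scale; $\eta\in[0,1)$. The total bandwidth $W$ is split into backhaul bandwidth $W_{\rm b}=\eta W$ and access bandwidth $W_{\rm a}=(1-\eta)W$. (If $\eta=0$, use $c/0=+\infty$ for $c>0$ and $c/0=-\infty$ for $c<0$.) Locations: the ABS is at the origin of $\mathbb{R}^2$. There are $n$ hotspots with centers ${\bf x}_1,\dots,{\bf x}_n$ i.i.d. uniform in the disc of radius $R-R_{\rm s}$ centered at the origin, so each $\|{\bf x}_i\|$ has density $f_X(x)=2x/(R-R_{\rm s})^2$ on $(0,R-R_{\rm s}]$; $X$ denotes a random variable with density $f_X$. One SBS is at each ${\bf x}_i$. Each hotspot contains $\bar m$ users,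 located at the hotspot center plus i.i.d. vectors that are uniform in the disc of radius $R_{\rm s}$ centered at the origin (independent of the centers); the norm of such a vector has density $f_U(u)=2u/R_{\rm s}^2$ on $(0,R_{\rm s}]$. The typical user is one user of the representative hotspot ${\bf x}={\bf x}_n$, at ${\bf x}+{\bf u}$; $x=\|{\bf x}\|$. Association: a user at ${\bf y}+{\bf v}$ of the hotspot centered at ${\bf y}$ is associated to (served by) the SBS at ${\bf y}$ if $P_{\rm s}\|{\bf v}\|^{-\alpha}>P_{\rm m}\|{\bf y}+{\bf v}\|^{-\alpha}$, and to the ABS otherwise. ${\cal E}=1$ or $0$ according to whether the typical user is associated to the SBS or the ABS. ${\cal A}_{\rm s}(x)$ is the conditional probability that a given user of a hotspot whose center is at distance $x$ from the origin is associated to its SBS, and ${\cal A}_{\rm m}(x)=1-{\cal A}_{\rm s}(x)$. $N_{\bf x}^{\rm SBS}$ and $N_{\bf x}^{\rm ABS}$ are the numbers of users of the representative hotspot (typical user included) associated to the SBS at ${\bf x}$ and to the ABS. Propagation: for the typical user there are three links: backhaul ABS–SBS (length $\|{\bf x}\|$), access SBS–user (length $\|{\bf u}\|$), access ABS–user (length $\|{\bf x}+{\bf u}\|$). Given the locations, a link of length $r$ is line-of-sight (LOS) with probability $p(r)=\exp(-r/\mu)$, otherwise NLOS; its path loss is $\beta r^{\alpha_L}$ if LOS and $\beta r^{\alpha_{NL}}$ if NLOS; its fading gain $h$ is Gamma distributed with shape $m$ and scale $1/m$, with $m=m_L$ if LOS and $m=m_{NL}$ if NLOS. Given the locations of all hotspots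 and users, the pairs (LOS state, fading gain) of different links are independent, and their law depends only on the respective link lengths. With $h_\cdot,L_\cdot$ the fading gain and path loss of the respective link, $$\mathtt{SNR}_{\rm b}=\frac{P_{\rm m}G^2h_{\rm b}}{{\tt N}_0W L_{\rm b}},\quad \mathtt{SNR}_{\rm a}^{\rm SBS}=\frac{P_{\rm s}Gh_{\rm s}}{{\tt N}_0W L_{\rm s}},\quad \mathtt{SNR}_{\rm a}^{\rm ABS}=\frac{P_{\rm m}Gh_{\rm m}}{{\tt N}_0W L_{\rm m}}.$$ Loads of other hotspots: $N_{\rm o}^{\rm ABS}$ and $N_{\rm o}^{\rm SBS}$ denote the total numbers of users of the other $n-1$ hotspots associated to the ABS and to their SBSs. They are replaced by their central-limit approximations: $N_{\rm o}^{\rm ABS}$ is taken Gaussian with mean $\upsilon_{\rm m}=(n-1)\bar m\mathbb{E}[{\cal A}_{\rm m}(X)]$ and variance $\sigma_{\rm m}^2=(n-1)\big[\bar m\mathbb{E}[{\cal A}_{\rm m}(X){\cal A}_{\rm s}(X)]+\bar m^2{\rm Var}[{\cal A}_{\rm m}(X)]\big]$, and $N_{\rm o}^{\rm SBS}$ is taken Gaussian with mean $\upsilon_{\rm s}=(n-1)\bar m\mathbb{E}[{\cal A}_{\rm s}(X)]$ and variance $\sigma_{\rm s}^2=\sigma_{\rm m}^2$, each independent of everything related to the representative hotspot (its center, users and links). Rates: the backhaul bandwidth of the SBS at ${\bf x}$ is $W_{\rm s}=W_{\rm b}/n$ under equal partition and $W_{\rm s}=\frac{N_{\bf x}^{\rm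 SBS}}{N_{\bf x}^{\rm SBS}+N_{\rm o}^{\rm SBS}}W_{\rm b}$ under load-based partition. The data-rate is $${\cal R}_{\rm a}^{\rm SBS}=\min\Big(\tfrac{W_{\rm a}}{N_{\bf x}^{\rm SBS}}\log_2(1+\mathtt{SNR}_{\rm a}^{\rm SBS}),\tfrac{W_{\rm s}}{N_{\bf x}^{\rm SBS}}\log_2(1+\mathtt{SNR}_{\rm b})\Big)$$ if ${\cal E}=1$, and ${\cal R}_{\rm a}^{\rm ABS}=\frac{W_{\rm a}}{N_{\bf x}^{\rm ABS}+N_{\rm o}^{\rm ABS}}\log_2(1+\mathtt{SNR}_{\rm a}^{\rm ABS})$ if ${\cal E}=0$. The comparison "rate $>\rho$" is understood with denominators cleared. Thus: - $\mathtt{P_r}_{\rm m}=\mathbb{P}\big({\cal E}=0,\;W_{\rm a}\log_2(1+\mathtt{SNR}_{\rm a}^{\rm ABS})>\rho(N_{\bf x}^{\rm ABS}+N_{\rm o}^{\rm ABS})\big)$. - $\mathtt{P_r}_{\rm s}=\mathbb{P}\big({\cal E}=1,\;W_{\rm a}\log_2(1+\mathtt{SNR}_{\rm a}^{\rm SBS})>\rho N_{\bf x}^{\rm SBS},\;W_{\rm b}\log_2(1+\mathtt{SNR}_{\rm b})>\rho D\big)$, with $D=nN_{\bf x}^{\rm SBS}$ for equal partition and $D=N_{\bf x}^{\rm SBS}+N_{\rm o}^{\rm SBS}$ for load-based partition. Functions in the formulas: $F_h(y,m)=\mathbb{P}(h>y)$ is the complementary CDF of the Gamma distribution with shape $m$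 and scale $1/m$ (equal to $1$ for $y\le0$ and $0$ for $y=+\infty$). With $k_p=(P_{\rm s}/P_{\rm m})^{1/\alpha}$, $u_{\max}(x,\xi)=\min\Big(R_{\rm s},xk_p\frac{\sqrt{1-k_p^2\sin^2\xi}+k_p\cos\xi}{1-k_p^2}\Big)$ and $\kappa=(x^2+u^2+2xu\cos\xi)^{1/2}$, $$\mathtt{P_c}_{\rm s}(\theta_1,\theta_2|x)=\int_0^{2\pi}\!\!\int_0^{u_{\max}(x,\xi)}\Big[p(x)F_h\big(\tfrac{x^{\alpha_L}\beta{\tt N}_0W\theta_1}{P_{\rm m}G^2},m_L\big)+(1-p(x))F_h\big(\tfrac{x^{\alpha_{NL}}\beta{\tt N}_0W\theta_1}{P_{\rm m}G^2},m_{NL}\big)\Big]\Big[p(u)F_h\big(\tfrac{u^{\alpha_L}\beta{\tt N}_0W\theta_2}{P_{\rm s}G},m_L\big)+(1-p(u))F_h\big(\tfrac{u^{\alpha_{NL}}\beta{\tt N}_0W\theta_2}{P_{\rm s}G},m_{NL}\big)\Big]\tfrac{f_U(u)}{2\pi}{\rm d}u\,{\rm d}\xi,$$ $$\mathtt{P_c}_{\rm m}(\theta_3|x)=\int_0^{2\pi}\!\!\int_{u_{\max}(x,\xi)}^{R_{\rm s}}\Big[p(\kappa)F_h\big(\tfrac{\kappa^{\alpha_L}\beta{\tt N}_0W\theta_3}{P_{\rm m}G},m_L\big)+(1-p(\kappa))F_h\big(\tfrac{\kappa^{\alpha_{NL}}\beta{\tt N}_0W\theta_3}{P_{\rm m}G},m_{NL}\big)\Big]\tfrac{f_U(u)}{2\pi}{\rm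 d}u\,{\rm d}\xi.$$ The convention $0^0=1$ is used. *)

theory Defs
  imports "HOL-Probability.Probability"
begin

record net_params =
  n_hot :: nat          (* n: number of hotspots *)
  n_usr :: nat          (* users per hotspot *)
  rad :: real           (* R: radius of the region *)
  rad_s :: real         (* R_s: radius of a hotspot *)
  pow_m :: real         (* P_m: transmit power of the ABS *)
  pow_s :: real         (* P_s: transmit power of an SBS *)
  gain :: real          (* G *)
  pl_const :: real      (* beta *)
  noise :: real         (* N_0 *)
  bw :: real            (* W *)
  los_range :: real     (* mu *)
  pl_exp :: real        (* alpha: exponent used for association *)
  pl_los :: real        (* alpha_L *)
  pl_nlos :: real       (* alpha_NL *)
  fad_los :: real       (* m_L *)
  fad_nlos :: real      (* m_NL *)
  bh_frac :: real       (* eta *)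

definition valid_params :: "net_params \<Rightarrow> bool" where
  "valid_params P \<longleftrightarrow>
     n_hot P \<ge> 2 \<and> n_usr P \<ge> 1 \<and>
     rad P > rad_s P \<and> rad_s P > 0 \<and>
     pow_m P > pow_s P \<and> pow_s P > 0 \<and>
     gain P > 0 \<and> pl_const P > 0 \<and> noise P > 0 \<and> bw P > 0 \<and> los_range P > 0 \<and>
     pl_exp P > 0 \<and> pl_los P > 0 \<and> pl_nlos P > 0 \<and> fad_los P > 0 \<and> fad_nlos P > 0 \<and>
     0 \<le> bh_frac P \<and> bh_frac P < 1"

definition W_b :: "net_params \<Rightarrow> real" where
  "W_b P = bh_frac P * bw P"

definition W_a :: "net_params \<Rightarrow> real" where
  "W_a P = (1 - bh_frac P) * bw P"

definition uniform_disc :: "real \<Rightarrow> (real^2) measure" where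
  "uniform_disc r = uniform_measure lborel (cball 0 r)"

definition f_X :: "net_params \<Rightarrow> real \<Rightarrow> real" where
  "f_X P x = (if 0 < x \<and> x \<le> rad P - rad_s P then 2 * x / (rad P - rad_s P)\<^sup>2 else 0)"

definition f_U :: "net_params \<Rightarrow> real \<Rightarrow> real" where
  "f_U P u = (if 0 < u \<and> u \<le> rad_s P then 2 * u / (rad_s P)\<^sup>2 else 0)"

text \<open>A user at \<open>y + v\<close> of the hotspot centred at \<open>y\<close> is served by the SBS at \<open>y\<close>.  Since
  \<open>0 powr a = 0\<close>, the convention differs from \<open>1/0 = \<infinity>\<close> when \<open>v = 0\<close> or \<open>y + v = 0\<close>; these are
  null events.\<close>
definition assoc_sbs :: "net_params \<Rightarrow> real^2 \<Rightarrow> real^2 \<Rightarrow> bool" where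
  "assoc_sbs P y v \<longleftrightarrow>
     pow_s P * norm v powr (- pl_exp P) > pow_m P * norm (y + v) powr (- pl_exp P)"

text \<open>Conditional probability that a user is associated to its SBS given that its hotspot is
  centred at distance \<open>x\<close> from the origin.  The centre is placed on the first axis; by
  \<open>A_s_norm\<close> below the direction is irrelevant.\<close>
definition A_s :: "net_params \<Rightarrow> real \<Rightarrow> real" where
  "A_s P x = measure (uniform_disc (rad_s P)) {v. assoc_sbs P (x *\<^sub>R axis 1 1) v}"

definition A_m :: "net_params \<Rightarrow> real \<Rightarrow> real" where
  "A_m P x = 1 - A_s P x"

lemma assoc_sbs_borel [measurable]: "{v. assoc_sbs P y v} \<in> sets borel"
  unfolding assoc_sbs_def by measurable

lemma A_s_norm:
  "A_s P (norm y) = measure (uniform_disc (rad_s P)) {v. assoc_sbs P y v}"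
proof -
  let ?c = "cball (0::real^2) (rad_s P)"
  let ?e = "norm y *\<^sub>R axis 1 (1::real) :: real^2"
  have "norm y = norm ?e"
    by (simp add: norm_axis_1)
  then obtain f :: "real^2 \<Rightarrow> real^2" where f: "orthogonal_transformation f" "f y = ?e"
    using orthogonal_transformation_exists by metis
  have lin: "linear f" and nrm: "norm (f v) = norm v" for v
    using f(1) orthogonal_transformation_norm orthogonal_transformation_linear by auto
  have iff: "assoc_sbs P ?e (f v) \<longleftrightarrow> assoc_sbs P y v" for v
    unfolding assoc_sbs_def f(2)[symmetric] linear_add[OF lin, symmetric] nrm by simp
  have img: "f ` (?c \<inter> {v. assoc_sbs P y v}) = ?c \<inter> {v. assoc_sbs P ?e v}"
  proof
    show "f ` (?c \<inter> {v. assoc_sbs P y v}) \<subseteq> ?c \<inter> {v. assoc_sbs P ?e v}"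
      by (auto simp: iff nrm)
    show "?c \<inter> {v. assoc_sbs P ?e v} \<subseteq> f ` (?c \<inter> {v. assoc_sbs P y v})"
    proof
      fix w assume w: "w \<in> ?c \<inter> {v. assoc_sbs P ?e v}"
      obtain v where "w = f v"
        using orthogonal_transformation_surj[OF f(1)] by (metis surjD)
      with w show "w \<in> f ` (?c \<inter> {v. assoc_sbs P y v})"
        by (auto simp: iff nrm)
    qed
  qed
  have b: "?c \<inter> {v. assoc_sbs P z v} \<in> sets borel" for z
    by measurable
  have bd: "bounded (?c \<inter> {v. assoc_sbs P z v})" for z
    by (meson bounded_cball bounded_subset inf_le1)
  have "measure lebesgue (?c \<inter> {v. assoc_sbs P ?e v})
      = measure lebesgue (?c \<inter> {v. assoc_sbs P y v})"
    using measure_orthogonal_image[OF f(1), of "?c \<inter> {v. assoc_sbs P y v}"] img b bd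
    by (simp add: bounded_set_imp_lmeasurable)
  then have "measure lborel (?c \<inter> {v. assoc_sbs P ?e v})
      = measure lborel (?c \<inter> {v. assoc_sbs P y v})"
    using b by (simp add: measure_completion)
  moreover have "emeasure lborel (?c \<inter> {v. assoc_sbs P z v})
      = ennreal (measure lborel (?c \<inter> {v. assoc_sbs P z v}))" for z
    by (rule emeasure_eq_ennreal_measure) (use emeasure_bounded_finite[OF bd, of z] in auto)
  ultimately have "emeasure lborel (?c \<inter> {v. assoc_sbs P ?e v})
      = emeasure lborel (?c \<inter> {v. assoc_sbs P y v})"
    by simp
  then show ?thesis
    by (simp add: A_s_def uniform_disc_def measure_def)
qed

definition gamma_density :: "real \<Rightarrow> real \<Rightarrow> real \<Rightarrow> real" where
  "gamma_density k \<theta> y =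
     (if y > 0 then y powr (k - 1) * exp (- y / \<theta>) / (Gamma k * \<theta> powr k) else 0)"

definition fading_law :: "real \<Rightarrow> real measure" where
  "fading_law m = density lborel (\<lambda>y. ennreal (gamma_density m (1 / m) y))"

definition F_h :: "ereal \<Rightarrow> real \<Rightarrow> real" where
  "F_h y m = measure (fading_law m) {h. ereal h > y}"

definition p_los :: "net_params \<Rightarrow> real \<Rightarrow> real" where
  "p_los P r = exp (- r / los_range P)"

definition path_loss :: "net_params \<Rightarrow> bool \<Rightarrow> real \<Rightarrow> real" where
  "path_loss P los r = pl_const P * r powr (if los then pl_los P else pl_nlos P)"

text \<open>Probability that a link of length \<open>r\<close> has LOS state \<open>los\<close> and fading gain in \<open>B\<close>.\<close>
definition link_prob :: "net_params \<Rightarrow> real \<Rightarrow> bool \<Rightarrow> real set \<Rightarrow> real" where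
  "link_prob P r los B =
     (if los then p_los P r * measure (fading_law (fad_los P)) B
      else (1 - p_los P r) * measure (fading_law (fad_nlos P)) B)"

datatype link = Backhaul | Access_SBS | Access_ABS

definition E_X :: "net_params \<Rightarrow> (real \<Rightarrow> real) \<Rightarrow> real" where
  "E_X P g = (LINT x|density lborel (\<lambda>x. ennreal (f_X P x)). g x)"

definition Var_X :: "net_params \<Rightarrow> (real \<Rightarrow> real) \<Rightarrow> real" where
  "Var_X P g = E_X P (\<lambda>x. (g x - E_X P g)\<^sup>2)"

definition upsilon_m :: "net_params \<Rightarrow> real" where
  "upsilon_m P = real (n_hot P - 1) * real (n_usr P) * E_X P (A_m P)"

definition upsilon_s :: "net_params \<Rightarrow> real" where
  "upsilon_s P = real (n_hot P - 1) * real (n_usr P) * E_X P (A_s P)"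

definition sigma_m :: "net_params \<Rightarrow> real" where
  "sigma_m P = sqrt (real (n_hot P - 1) *
     (real (n_usr P) * E_X P (\<lambda>x. A_m P x * A_s P x) + (real (n_usr P))\<^sup>2 * Var_X P (A_m P)))"

definition sigma_s :: "net_params \<Rightarrow> real" where
  "sigma_s P = sigma_m P"

text \<open>Hotspots are numbered \<open>1, \<dots>, n\<close>, the representative one being the \<open>n\<close>-th; the users of
  a hotspot are numbered \<open>1, \<dots>, n_usr P\<close>, the typical user being number \<open>typ_usr\<close> of the
  representative hotspot.  \<open>usr N i j\<close> is the position of user \<open>j\<close> of hotspot \<open>i\<close> relative to the
  centre \<open>ctr N i\<close>; the links are those of the typical user.\<close>
record 'a network =
  prb :: "'a measure"
  ctr :: "nat \<Rightarrow> 'a \<Rightarrow> real^2"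
  usr :: "nat \<Rightarrow> nat \<Rightarrow> 'a \<Rightarrow> real^2"
  typ_usr :: nat
  los :: "link \<Rightarrow> 'a \<Rightarrow> bool"
  fad :: "link \<Rightarrow> 'a \<Rightarrow> real"
  load_m :: "'a \<Rightarrow> real"   (* load put on the ABS by the other hotspots *)
  load_s :: "'a \<Rightarrow> real"   (* total load on the other SBSs *)

definition rep_ctr :: "net_params \<Rightarrow> 'a network \<Rightarrow> 'a \<Rightarrow> real^2" where
  "rep_ctr P N = ctr N (n_hot P)"

definition typ_off :: "net_params \<Rightarrow> 'a network \<Rightarrow> 'a \<Rightarrow> real^2" where
  "typ_off P N = usr N (n_hot P) (typ_usr N)"

fun link_length :: "net_params \<Rightarrow> 'a network \<Rightarrow> link \<Rightarrow> 'a \<Rightarrow> real" where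
  "link_length P N Backhaul \<omega> = norm (rep_ctr P N \<omega>)"
| "link_length P N Access_SBS \<omega> = norm (typ_off P N \<omega>)"
| "link_length P N Access_ABS \<omega> = norm (rep_ctr P N \<omega> + typ_off P N \<omega>)"

text \<open>All centres (\<open>Inl i\<close>) and all user offsets (\<open>Inr (i, j)\<close>) as a single family.\<close>
definition loc_index :: "net_params \<Rightarrow> (nat + nat \<times> nat) set" where
  "loc_index P = {1..n_hot P} <+> ({1..n_hot P} \<times> {1..n_usr P})"

definition loc :: "'a network \<Rightarrow> nat + nat \<times> nat \<Rightarrow> 'a \<Rightarrow> real^2" where
  "loc N = case_sum (ctr N) (\<lambda>(i, j). usr N i j)"

text \<open>The sigma-algebra generated by the locations of all hotspots and users.\<close>
definition loc_sigma :: "net_params \<Rightarrow> 'a network \<Rightarrow> 'a measure" where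
  "loc_sigma P N = vimage_algebra (space (prb N)) (\<lambda>\<omega>. \<lambda>k\<in>loc_index P. loc N k \<omega>)
     (PiM (loc_index P) (\<lambda>_. borel))"

text \<open>Everything related to the representative hotspot: its centre, its users and the links.\<close>
definition rep_space ::
    "net_params \<Rightarrow> ((real^2) \<times> (nat \<Rightarrow> real^2) \<times> (link \<Rightarrow> bool \<times> real)) measure" where
  "rep_space P = borel \<Otimes>\<^sub>M PiM {1..n_usr P} (\<lambda>_. borel)
     \<Otimes>\<^sub>M PiM UNIV (\<lambda>_. count_space UNIV \<Otimes>\<^sub>M borel)"

definition rep_data ::
    "net_params \<Rightarrow> 'a network \<Rightarrow> 'a \<Rightarrow> (real^2) \<times> (nat \<Rightarrow> real^2) \<times> (link \<Rightarrow> bool \<times> real)" where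
  "rep_data P N \<omega> =
     (rep_ctr P N \<omega>, \<lambda>j\<in>{1..n_usr P}. usr N (n_hot P) j \<omega>, \<lambda>l. (los N l \<omega>, fad N l \<omega>))"

locale cellular_network = prob_space "prb N" for N :: "'a network" +
  fixes P :: net_params
  assumes params: "valid_params P"
    and typ_usr_range: "typ_usr N \<in> {1..n_usr P}"
    and ctr_law: "\<And>i. i \<in> {1..n_hot P} \<Longrightarrow>
          distr (prb N) borel (ctr N i) = uniform_disc (rad P - rad_s P)"
    and usr_law: "\<And>i j. i \<in> {1..n_hot P} \<Longrightarrow> j \<in> {1..n_usr P} \<Longrightarrow>
          distr (prb N) borel (usr N i j) = uniform_disc (rad_s P)"
    and loc_indep: "indep_vars (\<lambda>_. borel) (loc N) (loc_index P)"
    and los_measurable: "\<And>l. los N l \<in> measurable (prb N) (count_space UNIV)"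
    and fad_measurable: "\<And>l. fad N l \<in> borel_measurable (prb N)"
    and link_law:
      "\<And>s B. (\<And>l. B l \<in> sets borel) \<Longrightarrow>
         AE \<omega> in prb N.
           real_cond_exp (prb N) (loc_sigma P N)
             (indicator {\<omega> \<in> space (prb N). \<forall>l. los N l \<omega> = s l \<and> fad N l \<omega> \<in> B l}) \<omega>
           = (\<Prod>l\<in>{Backhaul, Access_SBS, Access_ABS}.
                link_prob P (link_length P N l \<omega>) (s l) (B l))"
    and load_m_law: "distributed (prb N) lborel (load_m N) (normal_density (upsilon_m P) (sigma_m P))"
    and load_m_indep: "indep_set (sets (vimage_algebra (space (prb N)) (load_m N) borel))
          (sets (vimage_algebra (space (prb N)) (rep_data P N) (rep_space P)))"
    and load_s_law: "distributed (prb N) lborel (load_s N) (normal_density (upsilon_s P) (sigma_s P))"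
    and load_s_indep: "indep_set (sets (vimage_algebra (space (prb N)) (load_s N) borel))
          (sets (vimage_algebra (space (prb N)) (rep_data P N) (rep_space P)))"

definition served_sbs :: "net_params \<Rightarrow> 'a network \<Rightarrow> 'a \<Rightarrow> bool" where
  "served_sbs P N \<omega> \<longleftrightarrow> assoc_sbs P (rep_ctr P N \<omega>) (typ_off P N \<omega>)"

definition N_sbs :: "net_params \<Rightarrow> 'a network \<Rightarrow> 'a \<Rightarrow> nat" where
  "N_sbs P N \<omega> = card {j \<in> {1..n_usr P}. assoc_sbs P (rep_ctr P N \<omega>) (usr N (n_hot P) j \<omega>)}"

definition N_abs :: "net_params \<Rightarrow> 'a network \<Rightarrow> 'a \<Rightarrow> nat" where
  "N_abs P N \<omega> = card {j \<in> {1..n_usr P}. \<not> assoc_sbs P (rep_ctr P N \<omega>) (usr N (n_hot P) j \<omega>)}"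

definition link_loss :: "net_params \<Rightarrow> 'a network \<Rightarrow> link \<Rightarrow> 'a \<Rightarrow> real" where
  "link_loss P N l \<omega> = path_loss P (los N l \<omega>) (link_length P N l \<omega>)"

definition SNR_b :: "net_params \<Rightarrow> 'a network \<Rightarrow> 'a \<Rightarrow> real" where
  "SNR_b P N \<omega> = pow_m P * (gain P)\<^sup>2 * fad N Backhaul \<omega>
     / (noise P * bw P * link_loss P N Backhaul \<omega>)"

definition SNR_a_sbs :: "net_params \<Rightarrow> 'a network \<Rightarrow> 'a \<Rightarrow> real" where
  "SNR_a_sbs P N \<omega> = pow_s P * gain P * fad N Access_SBS \<omega>
     / (noise P * bw P * link_loss P N Access_SBS \<omega>)"

definition SNR_a_abs :: "net_params \<Rightarrow> 'a network \<Rightarrow> 'a \<Rightarrow> real" where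
  "SNR_a_abs P N \<omega> = pow_m P * gain P * fad N Access_ABS \<omega>
     / (noise P * bw P * link_loss P N Access_ABS \<omega>)"

datatype partition = Equal | Load_Based

text \<open>The quantity \<open>D\<close> with \<open>W\<^sub>s / N_sbs = W\<^sub>b / D\<close>, where \<open>W\<^sub>s\<close> is the backhaul bandwidth of the
  representative SBS.\<close>
fun backhaul_load :: "partition \<Rightarrow> net_params \<Rightarrow> 'a network \<Rightarrow> 'a \<Rightarrow> real" where
  "backhaul_load Equal P N \<omega> = real (n_hot P) * real (N_sbs P N \<omega>)"
| "backhaul_load Load_Based P N \<omega> = real (N_sbs P N \<omega>) + load_s N \<omega>"

text \<open>``Data rate exceeds \<open>\<rho>\<close>'' for a user served by the ABS, respectively by the SBS, with the
  denominators cleared (the Gaussian loads may be negative).\<close>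
definition abs_rate_exceeds :: "net_params \<Rightarrow> 'a network \<Rightarrow> real \<Rightarrow> 'a \<Rightarrow> bool" where
  "abs_rate_exceeds P N \<rho> \<omega> \<longleftrightarrow>
     W_a P * log 2 (1 + SNR_a_abs P N \<omega>) > \<rho> * (real (N_abs P N \<omega>) + load_m N \<omega>)"

definition sbs_rate_exceeds :: "partition \<Rightarrow> net_params \<Rightarrow> 'a network \<Rightarrow> real \<Rightarrow> 'a \<Rightarrow> bool" where
  "sbs_rate_exceeds s P N \<rho> \<omega> \<longleftrightarrow>
     W_a P * log 2 (1 + SNR_a_sbs P N \<omega>) > \<rho> * real (N_sbs P N \<omega>) \<and>
     W_b P * log 2 (1 + SNR_b P N \<omega>) > \<rho> * backhaul_load s P N \<omega>"

definition Pr_m :: "net_params \<Rightarrow> 'a network \<Rightarrow> real \<Rightarrow> real" where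
  "Pr_m P N \<rho> = measure (prb N)
     {\<omega> \<in> space (prb N). \<not> served_sbs P N \<omega> \<and> abs_rate_exceeds P N \<rho> \<omega>}"

definition Pr_s :: "partition \<Rightarrow> net_params \<Rightarrow> 'a network \<Rightarrow> real \<Rightarrow> real" where
  "Pr_s s P N \<rho> = measure (prb N)
     {\<omega> \<in> space (prb N). served_sbs P N \<omega> \<and> sbs_rate_exceeds s P N \<rho> \<omega>}"

definition Pr_rate :: "partition \<Rightarrow> net_params \<Rightarrow> 'a network \<Rightarrow> real \<Rightarrow> real" where
  "Pr_rate s P N \<rho> = measure (prb N)
     {\<omega> \<in> space (prb N).
        if served_sbs P N \<omega> then sbs_rate_exceeds s P N \<rho> \<omega> else abs_rate_exceeds P N \<rho> \<omega>}"

text \<open>Thresholds are extended reals because \<open>W_b P\<close> may be \<open>0\<close>; division on \<open>ereal\<close> satisfies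
  \<open>c / 0 = \<infinity>\<close> for \<open>c > 0\<close> and \<open>c / 0 = -\<infinity>\<close> for \<open>c < 0\<close>.\<close>
definition exp2 :: "ereal \<Rightarrow> ereal" where
  "exp2 y = (if y = \<infinity> then \<infinity> else if y = -\<infinity> then 0 else ereal (2 powr real_of_ereal y))"

lemma ereal_div_zero:
  "0 < c \<Longrightarrow> ereal c / ereal 0 = \<infinity>"  "c < 0 \<Longrightarrow> ereal c / ereal 0 = -\<infinity>"
  by (auto simp: divide_ereal_def zero_ereal_def[symmetric])

text \<open>Mixture over the LOS state of \<open>F_h (r\<^bsup>a\<^esup> \<beta> N\<^sub>0 W \<theta> / c, m)\<close>.\<close>
definition link_ccdf :: "net_params \<Rightarrow> real \<Rightarrow> real \<Rightarrow> ereal \<Rightarrow> real" where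
  "link_ccdf P c r \<theta> =
     p_los P r * F_h (ereal (r powr pl_los P * pl_const P * noise P * bw P) * \<theta> / ereal c) (fad_los P)
   + (1 - p_los P r)
       * F_h (ereal (r powr pl_nlos P * pl_const P * noise P * bw P) * \<theta> / ereal c) (fad_nlos P)"

definition k_p :: "net_params \<Rightarrow> real" where
  "k_p P = (pow_s P / pow_m P) powr (1 / pl_exp P)"

definition u_max :: "net_params \<Rightarrow> real \<Rightarrow> real \<Rightarrow> real" where
  "u_max P x \<xi> = min (rad_s P)
     (x * k_p P * ((sqrt (1 - (k_p P)\<^sup>2 * (sin \<xi>)\<^sup>2) + k_p P * cos \<xi>) / (1 - (k_p P)\<^sup>2)))"

definition kappa :: "real \<Rightarrow> real \<Rightarrow> real \<Rightarrow> real" where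
  "kappa x u \<xi> = sqrt (x\<^sup>2 + u\<^sup>2 + 2 * x * u * cos \<xi>)"

definition Pc_s :: "net_params \<Rightarrow> ereal \<Rightarrow> ereal \<Rightarrow> real \<Rightarrow> real" where
  "Pc_s P \<theta>\<^sub>1 \<theta>\<^sub>2 x =
     (LBINT \<xi>:{0..2 * pi}. LBINT u:{0..u_max P x \<xi>}.
        link_ccdf P (pow_m P * (gain P)\<^sup>2) x \<theta>\<^sub>1 * link_ccdf P (pow_s P * gain P) u \<theta>\<^sub>2
          * (f_U P u / (2 * pi)))"

definition Pc_m :: "net_params \<Rightarrow> ereal \<Rightarrow> real \<Rightarrow> real" where
  "Pc_m P \<theta>\<^sub>3 x =
     (LBINT \<xi>:{0..2 * pi}. LBINT u:{u_max P x \<xi>..rad_s P}.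
        link_ccdf P (pow_m P * gain P) (kappa x u \<xi>) \<theta>\<^sub>3 * (f_U P u / (2 * pi)))"

end

theory Submission
  imports Defs
begin

text \<open>
  Given the locations, a rate condition is a threshold condition on the fading gains, and the three
  links are independent, so its conditional probability is a product of mixtures of Gamma tails.
  Both the association rule and this product are invariant under rotations about the origin; hence
  they may be averaged with the centre at distance \<open>x\<close> on the first axis, and polar
  coordinates around the centre turn the association region into \<open>u < u_max\<close>, up to null
  sets.  Given the centre, the other users of the hotspot associate independently, which yields the
  binomial weights, and the Gaussian load, being independent of the hotspot, is integrated out by
  Fubini.
\<close>

section \<open>Polar coordinates\<close>

text \<open>The hypothesis on the links gives conditional probabilities for fixed sets of fading
  gains only, whereas a rate condition compares a gain with a threshold that varies with the
  locations. The bridge is \<open>link_joint_eq\<close>: on the event that the LOS states equal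
  \<open>s\<close>, the joint measure of locations and gains is the location law weighted by the
  state probabilities, times a product of Gamma laws. Fubini then admits location-dependent
  thresholds, and summing over the eight state vectors restores the mixtures.

  Two degenerate values need care. If \<open>W_b P = 0\<close>, the backhaul condition reads
  \<open>\<rho> * D < 0\<close>, and the infinite thresholds reproduce it except for the target
  value 0, where \<open>0 / 0 = 0\<close> yields a threshold of 0. Under load-based partition this
  happens at the single load \<open>- k\<close>, which has measure zero. Moreover, the formulas
  divide by \<open>sigma_m P\<close>; its positivity is extracted from the assumed Gaussian law,
  since \<open>normal_density\<close> with deviation 0 vanishes identically.\<close>

definition vec2 :: "real \<Rightarrow> real \<Rightarrow> real^2" where
  "vec2 a b = a *\<^sub>R axis 1 1 + b *\<^sub>R axis 2 1"

lemma vec2_nth [simp]: "vec2 a b $ 1 = a" "vec2 a b $ 2 = b"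
  by (auto simp: vec2_def axis_def)

lemma vec2_eq_iff [simp]: "vec2 a b = v \<longleftrightarrow> a = v $ 1 \<and> b = v $ 2"
  by (auto simp: vec_eq_iff forall_2)

lemma norm_real2: "norm (v :: real^2) = sqrt ((v $ 1)\<^sup>2 + (v $ 2)\<^sup>2)"
  by (simp add: norm_vec_def L2_set_def UNIV_2)

lemma borel_measurable_vec2 [measurable]:
  assumes [measurable]: "f \<in> borel_measurable M" "g \<in> borel_measurable M"
  shows "(\<lambda>x. vec2 (f x) (g x)) \<in> borel_measurable M"
  unfolding vec2_def by measurable

text \<open>Lebesgue measure is determined by its values on boxes, and a box in the plane pulls back
  to a product of intervals. This connects the change of variables on \<open>real^2\<close> with
  iterated integrals over two real variables.\<close>

lemma distr_lborel_vec2: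
  "distr (lborel \<Otimes>\<^sub>M lborel) borel (\<lambda>(a, b). vec2 a b) = lborel"
proof (rule lborel_eqI[symmetric])
  fix l u :: "real^2" assume le: "\<And>b. b \<in> Basis \<Longrightarrow> l \<bullet> b \<le> u \<bullet> b"
  have B: "(Basis :: (real^2) set) = {axis 1 1, axis 2 1}"
    by (auto simp: Basis_vec_def UNIV_2)
  have ne: "axis 1 (1::real) \<noteq> (axis 2 1 :: real^2)"
    by (auto simp: axis_eq_axis)
  have le': "l $ 1 \<le> u $ 1" "l $ 2 \<le> u $ 2"
    using le[of "axis 1 1"] le[of "axis 2 1"] by (auto simp: B inner_axis)
  have eq: "(\<lambda>(a, b). vec2 a b) -` box l u = box (l $ 1) (u $ 1) \<times> box (l $ 2) (u $ 2)"
    by (auto simp: mem_box B inner_axis)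
  have "emeasure (distr (lborel \<Otimes>\<^sub>M lborel) borel (\<lambda>(a, b). vec2 a b)) (box l u)
    = emeasure (lborel \<Otimes>\<^sub>M lborel) (box (l $ 1) (u $ 1) \<times> box (l $ 2) (u $ 2))"
    by (subst emeasure_distr) (auto simp: space_pair_measure eq)
  also have "\<dots> = ennreal ((u $ 1 - l $ 1) * (u $ 2 - l $ 2))"
    using le' by (subst lborel.emeasure_pair_measure_Times) (auto simp: ennreal_mult')
  finally show "emeasure (distr (lborel \<Otimes>\<^sub>M lborel) borel (\<lambda>(a, b). vec2 a b)) (box l u)
    = (\<Prod>b\<in>Basis. (u - l) \<bullet> b)"
    by (simp add: B ne inner_axis)
qed simp

section \<open>Change of variables to polar coordinates\<close>

definition polar :: "real \<Rightarrow> real \<Rightarrow> real^2" where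
  "polar u \<xi> = vec2 (u * cos \<xi>) (u * sin \<xi>)"

lemma borel_measurable_polar [measurable]:
  assumes [measurable]: "f \<in> borel_measurable M" "g \<in> borel_measurable M"
  shows "(\<lambda>x. polar (f x) (g x)) \<in> borel_measurable M"
  unfolding polar_def by measurable

lemma norm_polar [simp]: "norm (polar u \<xi>) = \<bar>u\<bar>"
proof -
  have "(u * cos \<xi>)\<^sup>2 + (u * sin \<xi>)\<^sup>2 = u\<^sup>2 * ((cos \<xi>)\<^sup>2 + (sin \<xi>)\<^sup>2)"
    unfolding power_mult_distrib by (rule distrib_left[symmetric])
  also have "\<dots> = u\<^sup>2"
    by simp
  finally show ?thesis
    by (simp add: polar_def norm_real2)
qed

text \<open>Points of the parameter plane carry the angle in coordinate 1 and the radius in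
  coordinate 2. The half-open range of angles and the exclusion of radius 0 make the map a bijection
  onto the punctured disc; the missing origin is a null set.\<close>

lemma polar_image:
  "(\<lambda>p::real^2. polar (p $ 2) (p $ 1)) ` {p. 0 \<le> p $ 1 \<and> p $ 1 < 2 * pi \<and> 0 < p $ 2 \<and> p $ 2 \<le> r}
   = cball 0 r - {0}" (is "?g ` ?S = _")
proof (intro equalityI subsetI)
  fix v assume "v \<in> ?g ` ?S"
  then show "v \<in> cball 0 r - {0}"
    by (auto simp flip: norm_le_zero_iff)
next
  fix v :: "real^2" assume v: "v \<in> cball 0 r - {0}"
  let ?u = "norm v"
  have u: "?u > 0" "?u \<le> r" using v by auto
  have sq: "(v $ 1)\<^sup>2 + (v $ 2)\<^sup>2 = ?u\<^sup>2"
    by (simp add: norm_real2)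
  have "(v $ 1 / ?u)\<^sup>2 + (v $ 2 / ?u)\<^sup>2 = ((v $ 1)\<^sup>2 + (v $ 2)\<^sup>2) / ?u\<^sup>2"
    by (simp add: power_divide add_divide_distrib)
  also have "\<dots> = 1"
    using u(1) by (simp add: sq)
  finally obtain t where t: "0 \<le> t" "t < 2 * pi" "v $ 1 / ?u = cos t" "v $ 2 / ?u = sin t"
    using sincos_total_2pi by metis
  have "v = ?g (vec2 t ?u)"
    using u(1) unfolding polar_def vec2_nth t(3,4)[symmetric]
    by (subst eq_commute) simp
  moreover have "vec2 t ?u \<in> ?S" using t u by simp
  ultimately show "v \<in> ?g ` ?S" by blast
qed

text \<open>The norm recovers the radius. Equal sines and cosines leave the angles equal up to a
  multiple of 2 pi, and two angles in the half-open range differ by less than 2 pi.\<close>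

lemma polar_inj:
  "inj_on (\<lambda>p::real^2. polar (p $ 2) (p $ 1)) {p. 0 \<le> p $ 1 \<and> p $ 1 < 2 * pi \<and> 0 < p $ 2 \<and> p $ 2 \<le> r}"
proof (rule inj_onI)
  fix p q :: "real^2"
  assume p: "p \<in> {p. 0 \<le> p $ 1 \<and> p $ 1 < 2 * pi \<and> 0 < p $ 2 \<and> p $ 2 \<le> r}"
    and q: "q \<in> {p. 0 \<le> p $ 1 \<and> p $ 1 < 2 * pi \<and> 0 < p $ 2 \<and> p $ 2 \<le> r}"
    and eq: "polar (p $ 2) (p $ 1) = polar (q $ 2) (q $ 1)"
  have 2: "p $ 2 = q $ 2"
    using arg_cong[OF eq, of norm] p q by simp
  then have "cos (p $ 1) = cos (q $ 1)" "sin (p $ 1) = sin (q $ 1)"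
    using eq p q by (auto simp: polar_def)
  then obtain n :: int where n: "p $ 1 = q $ 1 + 2 * pi * n"
    using sin_cos_eq_iff by metis
  have pos: "0 < 2 * pi" by simp
  have "2 * pi * n < 2 * pi * 1" "2 * pi * (-1) < 2 * pi * n"
    using n p q by (simp_all only: mem_Collect_eq) linarith+
  then have "real_of_int n < 1" "-1 < real_of_int n"
    by (simp_all only: mult_less_cancel_left_pos[OF pos])
  then have "n = 0" by linarith
  with n 2 show "p = q" by (simp add: vec_eq_iff forall_2)
qed

text \<open>Common form of \<open>f_X\<close> and \<open>f_U\<close>: the density of the distance to
  the origin of a uniform point in the disc of radius \<open>r\<close>.\<close>

definition radial_density :: "real \<Rightarrow> real \<Rightarrow> real" where
  "radial_density r u = (if 0 < u \<and> u \<le> r then 2 * u / r\<^sup>2 else 0)"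

lemma radial_density_borel [measurable]: "radial_density r \<in> borel_measurable borel"
  unfolding radial_density_def by measurable

lemma radial_density_nonneg [simp]: "0 \<le> radial_density r u"
  by (simp add: radial_density_def)

lemma polar_has_derivative:
  fixes p :: "real^2"
  shows "((\<lambda>p::real^2. polar (p $ 2) (p $ 1)) has_derivative
    (\<lambda>h. vec2 (h $ 2 * cos (p $ 1) - p $ 2 * sin (p $ 1) * h $ 1)
              (h $ 2 * sin (p $ 1) + p $ 2 * cos (p $ 1) * h $ 1))) (at p within S)"
proof -
  have c: "((\<lambda>p::real^2. p $ i) has_derivative (\<lambda>h. h $ i)) (at p within S)" for i
    by (rule bounded_linear.has_derivative[OF bounded_linear_vec_nth has_derivative_ident])
  have "((\<lambda>p. p $ 2 * cos (p $ 1)) has_derivative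
      (\<lambda>h. h $ 2 * cos (p $ 1) - p $ 2 * sin (p $ 1) * h $ 1)) (at p within S)"
    by (rule has_derivative_eq_rhs[OF has_derivative_mult[OF c has_derivative_cos[OF c]]])
       (simp add: fun_eq_iff algebra_simps)
  moreover have "((\<lambda>p. p $ 2 * sin (p $ 1)) has_derivative
      (\<lambda>h. h $ 2 * sin (p $ 1) + p $ 2 * cos (p $ 1) * h $ 1)) (at p within S)"
    by (rule has_derivative_eq_rhs[OF has_derivative_mult[OF c has_derivative_sin[OF c]]])
       (simp add: fun_eq_iff algebra_simps)
  ultimately show ?thesis
    unfolding polar_def vec2_def
    by (intro has_derivative_add has_derivative_scaleR_left)
qed

text \<open>Because the angle is the first coordinate, the determinant itself is \<open>- u\<close>;
  the change of variables only uses its absolute value.\<close>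

lemma polar_det:
  "\<bar>det (matrix (\<lambda>h::real^2. vec2 (h $ 2 * cos a - u * sin a * h $ 1)
              (h $ 2 * sin a + u * cos a * h $ 1)))\<bar> = \<bar>u\<bar>"
proof -
  have "det (matrix (\<lambda>h::real^2. vec2 (h $ 2 * cos a - u * sin a * h $ 1)
              (h $ 2 * sin a + u * cos a * h $ 1))) = - (u * ((sin a)\<^sup>2 + (cos a)\<^sup>2))"
    by (simp only: det_2 matrix_def vec_lambda_beta vec2_nth axis_def power2_eq_square)
       (simp add: algebra_simps del: sin_cos_squared_add3)
  then show ?thesis
    by simp
qed

text \<open>The substitution rule for injective differentiable maps yields a gauge integral over the
  preimage of the punctured set. It is converted to a Lebesgue integral, and the origin is added
  back as a null set.\<close>

lemma emeasure_polar:
  assumes A[measurable]: "A \<in> sets borel"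
  shows "emeasure lborel (A \<inter> cball 0 r) =
    (\<integral>\<^sup>+ p. ennreal (indicator {p::real^2. 0 \<le> p $ 1 \<and> p $ 1 < 2 * pi \<and> 0 < p $ 2 \<and> p $ 2 \<le> r \<and>
       polar (p $ 2) (p $ 1) \<in> A} p * \<bar>p $ 2\<bar>) \<partial>lborel)"
proof -
  let ?S = "{p::real^2. 0 \<le> p $ 1 \<and> p $ 1 < 2 * pi \<and> 0 < p $ 2 \<and> p $ 2 \<le> r}"
  let ?g = "\<lambda>p::real^2. polar (p $ 2) (p $ 1)"
  let ?B = "A \<inter> cball 0 r - {0} :: (real^2) set"
  let ?T = "{p::real^2. 0 \<le> p $ 1 \<and> p $ 1 < 2 * pi \<and> 0 < p $ 2 \<and> p $ 2 \<le> r \<and> ?g p \<in> A}"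
  have T: "?T \<in> sets borel" by measurable
  have img: "?g ` ?T = ?B"
  proof -
    have "?g ` ?T = ?g ` ?S \<inter> A" by auto
    then show ?thesis unfolding polar_image by auto
  qed
  have Bm: "?B \<in> lmeasurable"
    by (intro bounded_set_imp_lmeasurable bounded_subset[OF bounded_cball[of 0 r]]) auto
  have "((\<lambda>p. \<bar>p $ 2\<bar>) has_integral measure lebesgue ?B) ?T"
    using has_measure_differentiable_image[of ?T ?g, OF _ polar_has_derivative inj_on_subset[OF polar_inj[of r]],
        of "measure lebesgue ?B"] T Bm
    unfolding img polar_det by auto
  then have "(\<integral>\<^sup>+ p. ennreal (indicator ?T p * \<bar>p $ 2\<bar>) \<partial>lborel) = ennreal (measure lebesgue ?B)"
    by (intro nn_integral_has_integral_lebesgue) auto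
  also have "\<dots> = emeasure lborel ?B"
    using emeasure_eq_measure2[OF Bm] by (simp add: emeasure_completion)
  also have "\<dots> = emeasure lborel (A \<inter> cball 0 r)"
    by (rule emeasure_Diff_null_set) auto
  finally show ?thesis
    by simp
qed

section \<open>The uniform law on a disc\<close>

definition radial_law :: "real \<Rightarrow> real measure" where
  "radial_law r = density lborel (\<lambda>u. ennreal (radial_density r u))"

definition angle_law :: "real measure" where
  "angle_law = density lborel (\<lambda>\<xi>. ennreal (indicator {0..2 * pi} \<xi> / (2 * pi)))"

lemma sets_radial_law [simp, measurable_cong]: "sets (radial_law r) = sets borel"
  by (simp add: radial_law_def)

lemma sets_angle_law [simp, measurable_cong]: "sets angle_law = sets borel"
  by (simp add: angle_law_def)

lemma prob_space_radial_law:
  assumes "0 < r" shows "prob_space (radial_law r)"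
proof
  have "((\<lambda>u. 2 * u / r\<^sup>2) has_integral r\<^sup>2 / r\<^sup>2 - 0\<^sup>2 / r\<^sup>2) {0..r}"
    using assms by (intro fundamental_theorem_of_calculus)
      (auto intro!: derivative_eq_intros simp: has_real_derivative_iff_has_vector_derivative[symmetric]
          power2_eq_square divide_simps)
  then have "(\<integral>\<^sup>+ u. ennreal (indicator {0..r} u * (2 * u / r\<^sup>2)) \<partial>lborel) = ennreal (r\<^sup>2 / r\<^sup>2 - 0\<^sup>2 / r\<^sup>2)"
    by (intro nn_integral_has_integral_lebesgue) auto
  moreover have "(\<integral>\<^sup>+ u. ennreal (radial_density r u) \<partial>lborel) = (\<integral>\<^sup>+ u. ennreal (indicator {0..r} u * (2 * u / r\<^sup>2)) \<partial>lborel)"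
    by (intro nn_integral_cong) (auto simp: radial_density_def indicator_def)
  ultimately show "emeasure (radial_law r) (space (radial_law r)) = 1"
    using assms by (simp add: radial_law_def emeasure_density)
qed

lemma prob_space_angle_law: "prob_space angle_law"
proof
  have "(\<integral>\<^sup>+ \<xi>. ennreal (indicator {0..2 * pi} \<xi> / (2 * pi)) \<partial>lborel)
      = (\<integral>\<^sup>+ \<xi>. ennreal (1 / (2 * pi)) * indicator {0..2 * pi} \<xi> \<partial>lborel)"
    by (intro nn_integral_cong) (auto simp: indicator_def)
  also have "\<dots> = 1"
    by (subst nn_integral_cmult_indicator) (auto simp: ennreal_mult[symmetric])
  finally show "emeasure angle_law (space angle_law) = 1"
    by (simp add: angle_law_def emeasure_density)
qed

text \<open>The product density \<open>1 / (2 * pi) * (2 * u / r\<^sup>2)\<close> is the Jacobian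
  \<open>u\<close> times the constant \<open>1 / (pi * r\<^sup>2)\<close>. So the image of the
  product law is that constant times Lebesgue measure on the disc, and two probability measures
  proportional on the disc coincide.\<close>

lemma uniform_disc_polar:
  assumes r: "0 < r"
  shows "uniform_disc r = distr (angle_law \<Otimes>\<^sub>M radial_law r) borel (\<lambda>(\<xi>, u). polar u \<xi>)"
    (is "_ = ?D")
proof -
  interpret R: prob_space "radial_law r" by (rule prob_space_radial_law[OF r])
  interpret A: prob_space angle_law by (rule prob_space_angle_law)
  interpret AR: pair_prob_space angle_law "radial_law r" ..
  have scaled: "emeasure ?D A = ennreal (1 / (pi * r\<^sup>2)) * emeasure lborel (A \<inter> cball 0 r)"
    if [measurable]: "A \<in> sets borel" for A
  proof -
    let ?S = "{p::real^2. 0 \<le> p $ 1 \<and> p $ 1 < 2 * pi \<and> 0 < p $ 2 \<and> p $ 2 \<le> r}"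
    let ?T = "{p::real^2. 0 \<le> p $ 1 \<and> p $ 1 < 2 * pi \<and> 0 < p $ 2 \<and> p $ 2 \<le> r \<and> polar (p $ 2) (p $ 1) \<in> A}"
    have [measurable]: "?T \<in> sets borel" by measurable
    have "emeasure ?D A = (\<integral>\<^sup>+ v. indicator A v \<partial>?D)"
      by simp
    also have "\<dots> = (\<integral>\<^sup>+ p. indicator A (case p of (\<xi>, u) \<Rightarrow> polar u \<xi>) \<partial>(angle_law \<Otimes>\<^sub>M radial_law r))"
      by (rule nn_integral_distr) auto
    also have "\<dots> = (\<integral>\<^sup>+ \<xi>. \<integral>\<^sup>+ u. indicator A (polar u \<xi>) \<partial>radial_law r \<partial>angle_law)"
      by (subst R.nn_integral_fst[symmetric]) auto
    also have "\<dots> = (\<integral>\<^sup>+ \<xi>. ennreal (indicator {0..2 * pi} \<xi> / (2 * pi)) * (\<integral>\<^sup>+ u. ennreal (radial_density r u)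
         * indicator A (polar u \<xi>) \<partial>lborel) \<partial>lborel)"
    proof -
      have "(\<integral>\<^sup>+ u. indicator A (polar u \<xi>) \<partial>radial_law r)
          = (\<integral>\<^sup>+ u. ennreal (radial_density r u) * indicator A (polar u \<xi>) \<partial>lborel)" for \<xi>
        unfolding radial_law_def by (subst nn_integral_density) auto
      then show ?thesis
        unfolding angle_law_def by (simp, subst nn_integral_density) auto
    qed
    also have "\<dots> = (\<integral>\<^sup>+ \<xi>. \<integral>\<^sup>+ u. ennreal (1 / (pi * r\<^sup>2)) * ennreal (indicator ?T (vec2 \<xi> u) * \<bar>u\<bar>)
         \<partial>lborel \<partial>lborel)"
    proof (rule nn_integral_cong_AE)
      \<comment> \<open>The angle law lives on the closed interval, the polar bijection on the
        half-open one; they differ in one angle.\<close>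
      have "AE \<xi> in lborel. \<xi> \<noteq> 2 * pi" by (rule AE_lborel_singleton)
      then show "AE \<xi> in lborel. ennreal (indicator {0..2 * pi} \<xi> / (2 * pi)) * (\<integral>\<^sup>+ u. ennreal (radial_density r u)
         * indicator A (polar u \<xi>) \<partial>lborel) = (\<integral>\<^sup>+ u. ennreal (1 / (pi * r\<^sup>2)) * ennreal (indicator ?T (vec2 \<xi> u) * \<bar>u\<bar>)
         \<partial>lborel)"
      proof eventually_elim
        case (elim \<xi>)
        have "ennreal (indicator {0..2 * pi} \<xi> / (2 * pi)) * (ennreal (radial_density r u) * indicator A (polar u \<xi>))
           = ennreal (1 / (pi * r\<^sup>2)) * ennreal (indicator ?T (vec2 \<xi> u) * \<bar>u\<bar>)" for u
          using elim by (auto simp: indicator_def radial_density_def ennreal_mult[symmetric])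
        then show ?case
          by (subst nn_integral_cmult[symmetric]) auto
      qed
    qed
    also have "\<dots> = ennreal (1 / (pi * r\<^sup>2)) * (\<integral>\<^sup>+ \<xi>. \<integral>\<^sup>+ u. ennreal (indicator ?T (vec2 \<xi> u) * \<bar>u\<bar>) \<partial>lborel \<partial>lborel)"
      by (simp add: nn_integral_cmult)
    also have "(\<integral>\<^sup>+ \<xi>. \<integral>\<^sup>+ u. ennreal (indicator ?T (vec2 \<xi> u) * \<bar>u\<bar>) \<partial>lborel \<partial>lborel)
        = (\<integral>\<^sup>+ p. ennreal (indicator ?T (case p of (\<xi>, u) \<Rightarrow> vec2 \<xi> u) * \<bar>snd p\<bar>) \<partial>(lborel \<Otimes>\<^sub>M lborel))"
      by (subst lborel.nn_integral_fst[symmetric]) auto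
    also have "\<dots> = (\<integral>\<^sup>+ p. ennreal (indicator ?T p * \<bar>p $ 2\<bar>) \<partial>distr (lborel \<Otimes>\<^sub>M lborel) borel (\<lambda>(a, b). vec2 a b))"
      by (subst nn_integral_distr) (auto intro!: nn_integral_cong)
    also have "\<dots> = emeasure lborel (A \<inter> cball 0 r)"
      by (subst emeasure_polar) (auto simp: distr_lborel_vec2)
    finally show ?thesis .
  qed
  \<comment> \<open>Comparing total masses evaluates the area of the disc in passing, so the
    normalising constant of \<open>uniform_disc\<close> requires no separate computation.\<close>
  have "emeasure ?D UNIV = 1"
    using prob_space.emeasure_space_1[OF AR.prob_space_distr, of "\<lambda>(\<xi>, u). polar u \<xi>" borel] by simp
  then have *: "ennreal (1 / (pi * r\<^sup>2)) * emeasure lborel (cball (0::real^2) r) = 1"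
    using scaled[of UNIV] by simp
  show ?thesis
  proof (rule measure_eqI)
    fix A assume "A \<in> sets (uniform_disc r)"
    then have A[measurable]: "A \<in> sets borel"
      by (simp add: uniform_disc_def)
    have "emeasure (uniform_disc r) A = emeasure lborel (A \<inter> cball 0 r) / emeasure lborel (cball (0::real^2) r)"
      by (simp add: uniform_disc_def Int_commute)
    also have "\<dots> = ennreal (1 / (pi * r\<^sup>2)) * emeasure lborel (cball (0::real^2) r)
         * (emeasure lborel (A \<inter> cball 0 r) / emeasure lborel (cball (0::real^2) r))"
      using * by simp
    also have "\<dots> = ennreal (1 / (pi * r\<^sup>2)) * emeasure lborel (A \<inter> cball 0 r)"
    proof -
      have "emeasure lborel (cball (0::real^2) r) \<noteq> 0"
        using * by auto
      then have "emeasure lborel (cball (0::real^2) r)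
          * (emeasure lborel (A \<inter> cball 0 r) / emeasure lborel (cball (0::real^2) r)) = emeasure lborel (A \<inter> cball 0 r)"
        using emeasure_lborel_cball_finite[of "0::real^2" r]
        by (simp add: ennreal_times_divide mult.commute[of "emeasure lborel (cball (0::real^2) r)"]
          mult_divide_eq_ennreal less_top)
      then show ?thesis
        by (simp only: mult.assoc)
    qed
    finally show "emeasure (uniform_disc r) A = emeasure ?D A"
      by (simp add: scaled)
  qed (simp add: uniform_disc_def)
qed

lemma prob_space_uniform_disc:
  assumes "0 < r" shows "prob_space (uniform_disc r)"
proof -
  interpret R: prob_space "radial_law r" by (rule prob_space_radial_law[OF assms])
  interpret A: prob_space angle_law by (rule prob_space_angle_law)
  interpret AR: pair_prob_space angle_law "radial_law r" ..
  show ?thesis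
    unfolding uniform_disc_polar[OF assms] by (rule AR.prob_space_distr) auto
qed

lemma sets_uniform_disc [simp, measurable_cong]: "sets (uniform_disc r) = sets borel"
  by (simp add: uniform_disc_def)

lemma space_uniform_disc [simp]: "space (uniform_disc r) = UNIV"
  by (simp add: uniform_disc_def)

lemma integral_uniform_disc_polar:
  fixes g :: "real^2 \<Rightarrow> real"
  assumes r: "0 < r" and g[measurable]: "g \<in> borel_measurable borel" and bd: "\<And>v. \<bar>g v\<bar> \<le> B"
  shows "(\<integral>v. g v \<partial>uniform_disc r) =
    (LBINT \<xi>:{0..2 * pi}. LBINT u. g (polar u \<xi>) * (radial_density r u / (2 * pi)))"
proof -
  interpret R: prob_space "radial_law r" by (rule prob_space_radial_law[OF r])
  interpret A: prob_space angle_law by (rule prob_space_angle_law)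
  interpret AR: pair_prob_space angle_law "radial_law r" ..
  have "(\<integral>v. g v \<partial>uniform_disc r) = (\<integral>p. g (polar (snd p) (fst p)) \<partial>(angle_law \<Otimes>\<^sub>M radial_law r))"
    unfolding uniform_disc_polar[OF r] by (subst integral_distr) (auto simp: case_prod_beta')
  also have "\<dots> = (\<integral>\<xi>. \<integral>u. g (polar u \<xi>) \<partial>radial_law r \<partial>angle_law)"
    by (subst AR.integral_fst'[symmetric]) (auto intro!: AR.integrable_const_bound[where B = B] simp: bd)
  also have "\<dots> = (\<integral>\<xi>. (LBINT u. radial_density r u * g (polar u \<xi>)) \<partial>angle_law)"
    unfolding radial_law_def by (subst integral_density) auto
  also have "\<dots> = (LBINT \<xi>. indicator {0..2 * pi} \<xi> / (2 * pi) * (LBINT u. radial_density r u * g (polar u \<xi>)))"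
    unfolding angle_law_def by (subst integral_density) auto
  also have "\<dots> = (LBINT \<xi>:{0..2 * pi}. LBINT u. g (polar u \<xi>) * (radial_density r u / (2 * pi)))"
    unfolding set_lebesgue_integral_def
  proof (intro Bochner_Integration.integral_cong refl)
    fix \<xi> :: real
    have "(LBINT u. g (polar u \<xi>) * (radial_density r u / (2 * pi)))
        = (1 / (2 * pi)) * (LBINT u. radial_density r u * g (polar u \<xi>))"
      by (subst integral_mult_right_zero[symmetric]) (intro Bochner_Integration.integral_cong, auto)
    then show "indicator {0..2 * pi} \<xi> / (2 * pi) * (LBINT u. radial_density r u * g (polar u \<xi>))
        = indicator {0..2 * pi} \<xi> *\<^sub>R (LBINT u. g (polar u \<xi>) * (radial_density r u / (2 * pi)))"
      by (simp only:) simp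
  qed
  finally show ?thesis .
qed

lemma integral_uniform_disc_norm:
  fixes g :: "real \<Rightarrow> real"
  assumes r: "0 < r" and g[measurable]: "g \<in> borel_measurable borel" and bd: "\<And>v. \<bar>g v\<bar> \<le> B"
  shows "(\<integral>v. g (norm v) \<partial>uniform_disc r) = (LBINT u. g u * radial_density r u)"
proof -
  have eq: "g \<bar>u\<bar> * (radial_density r u / (2 * pi)) = g u * (radial_density r u / (2 * pi))" for u
    by (simp add: radial_density_def)
  have "(\<integral>v. g (norm v) \<partial>uniform_disc r)
      = (LBINT \<xi>:{0..2 * pi}. LBINT u. g (norm (polar u \<xi>)) * (radial_density r u / (2 * pi)))"
    by (rule integral_uniform_disc_polar[OF r, of _ B]) (auto simp: bd)
  also have "\<dots> = (LBINT \<xi>:{0..2 * pi}. LBINT u. g u * (radial_density r u / (2 * pi)))"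
    unfolding norm_polar eq ..
  also have "\<dots> = (LBINT u. g u * radial_density r u)"
    by (simp add: set_lebesgue_integral_def)
  finally show ?thesis .
qed

text \<open>An orthogonal map preserves Lebesgue measure and maps the disc onto itself.\<close>

lemma distr_uniform_disc_orthogonal:
  fixes f :: "real^2 \<Rightarrow> real^2"
  assumes r: "0 < r" and f: "orthogonal_transformation f"
  shows "distr (uniform_disc r) borel f = uniform_disc r"
proof (rule measure_eqI)
  have fm[measurable]: "f \<in> borel_measurable borel"
    using f by (intro borel_measurable_continuous_onI linear_continuous_on)
      (auto simp: orthogonal_transformation_linear linear_conv_bounded_linear[symmetric])
  have nrm: "norm (f v) = norm v" for v
    using f orthogonal_transformation_norm by auto
  fix A assume "A \<in> sets (distr (uniform_disc r) borel f)"
  then have [measurable]: "A \<in> sets borel" by simp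
  let ?B = "cball 0 r \<inter> f -` A"
  have [measurable]: "f -` A \<in> sets borel"
    using measurable_sets[OF fm, of A] by simp
  have img: "f ` ?B = cball 0 r \<inter> A"
  proof
    show "f ` ?B \<subseteq> cball 0 r \<inter> A" by (auto simp: nrm)
    show "cball 0 r \<inter> A \<subseteq> f ` ?B"
    proof
      fix w assume w: "w \<in> cball 0 r \<inter> A"
      obtain v where "w = f v"
        using orthogonal_transformation_surj[OF f] by (metis surjD)
      with w show "w \<in> f ` ?B" by (auto simp: nrm)
    qed
  qed
  have lm: "?B \<in> lmeasurable" "cball 0 r \<inter> A \<in> lmeasurable"
    by (intro bounded_set_imp_lmeasurable bounded_subset[OF bounded_cball[of 0 r]]; force)+
  have "emeasure lebesgue (cball 0 r \<inter> A) = emeasure lebesgue ?B"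
    using measure_orthogonal_image[OF f lm(1)] lm by (simp add: img emeasure_eq_measure2)
  then have "emeasure lborel (cball 0 r \<inter> A) = emeasure lborel ?B"
    by (simp add: emeasure_completion)
  then show "emeasure (distr (uniform_disc r) borel f) A = emeasure (uniform_disc r) A"
    by (simp add: emeasure_distr uniform_disc_def)
qed simp

section \<open>Fading\<close>

text \<open>The substitution \<open>y = t / m\<close> reduces the total mass to Euler's integral for
  \<open>Gamma m\<close>. Its factor \<open>1 / m\<close> cancels the \<open>m\<close> that is left
  over from \<open>m powr m\<close> after \<open>m powr (m - 1)\<close> has been absorbed.\<close>

lemma prob_space_fading_law:
  assumes m: "0 < m" shows "prob_space (fading_law m)"
proof
  have [measurable]: "gamma_density m (1 / m) \<in> borel_measurable borel"
    unfolding gamma_density_def by measurable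
  have G: "0 < Gamma m" using m by (rule Gamma_real_pos)
  have scale: "gamma_density m (1 / m) (0 + 1 / m * t) = m / Gamma m * (indicator {0..} t * t powr (m - 1) / exp t)" for t
  proof (cases "t > 0")
    case True
    have "m powr m = m * m powr (m - 1)"
      using m by (simp add: powr_mult_base)
    with True m show ?thesis
      by (simp add: gamma_density_def powr_divide exp_minus divide_simps)
  next
    case False
    with m show ?thesis
      by (auto simp: gamma_density_def indicator_def zero_less_divide_iff)
  qed
  have "emeasure (fading_law m) (space (fading_law m)) = (\<integral>\<^sup>+ y. ennreal (gamma_density m (1 / m) y) \<partial>lborel)"
    by (simp add: fading_law_def emeasure_density)
  also have "\<dots> = ennreal (1 / m) * (\<integral>\<^sup>+ t. ennreal (gamma_density m (1 / m) (0 + 1 / m * t)) \<partial>lborel)"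
    using m by (subst nn_integral_real_affine[of _ "1 / m" 0]) auto
  also have "\<dots> = ennreal (1 / m) * (ennreal (m / Gamma m) * ennreal (Gamma m))"
    unfolding scale using m G
    by (subst Gamma_conv_nn_integral_real[OF m], subst nn_integral_cmult[symmetric])
       (auto simp: ennreal_mult'[symmetric])
  also have "\<dots> = 1"
    using m G[THEN less_imp_neq] by (simp add: ennreal_mult[symmetric])
  finally show "emeasure (fading_law m) (space (fading_law m)) = 1" .
qed

lemma sets_fading_law [simp, measurable_cong]: "sets (fading_law m) = sets borel"
  by (simp add: fading_law_def)

lemma space_fading_law [simp]: "space (fading_law m) = UNIV"
  by (simp add: fading_law_def)

lemma fading_law_nonpos: "measure (fading_law m) {..0} = 0"
proof -
  have [measurable]: "gamma_density m (1 / m) \<in> borel_measurable borel"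
    unfolding gamma_density_def by measurable
  have "emeasure (fading_law m) {..0} = (\<integral>\<^sup>+ y. ennreal (gamma_density m (1 / m) y) * indicator {..0} y \<partial>lborel)"
    by (simp add: fading_law_def emeasure_density)
  also have "\<dots> = (\<integral>\<^sup>+ y. 0 \<partial>(lborel :: real measure))"
    by (intro nn_integral_cong) (auto simp: gamma_density_def indicator_def)
  finally show ?thesis by (simp add: measure_def)
qed

text \<open>As a function of the threshold \<open>y\<close>, the tail is the measure of a section of
  the measurable set of pairs with \<open>y < h\<close>.\<close>

lemma borel_measurable_F_h [measurable]:
  assumes m: "0 < m" shows "(\<lambda>y. F_h y m) \<in> borel_measurable borel"
proof -
  interpret prob_space "fading_law m" by (rule prob_space_fading_law[OF m])
  have "{p \<in> space (borel \<Otimes>\<^sub>M fading_law m). fst p < ereal (snd p)} \<in> sets (borel \<Otimes>\<^sub>M fading_law m)"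
    by measurable
  then have "(\<lambda>y::ereal. enn2real (emeasure (fading_law m) (Pair y -` {p \<in> space (borel \<Otimes>\<^sub>M fading_law m). fst p < ereal (snd p)})))
     \<in> borel_measurable borel"
    by (intro borel_measurable_enn2real measurable_emeasure_Pair)
  moreover have "Pair y -` {p \<in> space (borel \<Otimes>\<^sub>M fading_law m). fst p < ereal (snd p)} = {h. y < ereal h}" for y
    by (auto simp: space_pair_measure)
  ultimately show ?thesis by (simp add: F_h_def measure_def)
qed

lemma F_h_bounds: "0 < m \<Longrightarrow> 0 \<le> F_h y m \<and> F_h y m \<le> 1"
  using prob_space.prob_le_1[OF prob_space_fading_law] by (simp add: F_h_def)

context
  fixes P :: net_params
  assumes P: "valid_params P"
begin

lemma params_pos:
  "0 < rad_s P" "rad_s P < rad P" "0 < pow_s P" "pow_s P < pow_m P" "0 < pow_m P" "0 < gain P" "0 < pl_const P"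
  "0 < noise P" "0 < bw P" "0 < los_range P" "0 < pl_exp P" "0 < fad_los P" "0 < fad_nlos P" "0 < W_a P"
  "0 \<le> W_b P" "1 \<le> n_usr P" "2 \<le> n_hot P"
  using P by (auto simp: valid_params_def W_a_def W_b_def)

lemma p_los_bounds: "0 \<le> r \<Longrightarrow> 0 \<le> p_los P r \<and> p_los P r \<le> 1"
  using params_pos by (simp add: p_los_def)

lemma link_ccdf_bounds:
  assumes "0 \<le> r" shows "0 \<le> link_ccdf P c r \<theta>" "link_ccdf P c r \<theta> \<le> 1"
proof -
  note p = p_los_bounds[OF assms]
    and F = F_h_bounds[OF params_pos(12)] F_h_bounds[OF params_pos(13)]
  show "0 \<le> link_ccdf P c r \<theta>"
    unfolding link_ccdf_def using p F by (intro add_nonneg_nonneg mult_nonneg_nonneg) auto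
  show "link_ccdf P c r \<theta> \<le> 1"
    unfolding link_ccdf_def using p F by (intro convex_bound_le) auto
qed

lemma borel_measurable_link_ccdf [measurable]:
  assumes [measurable]: "f \<in> borel_measurable M"
  shows "(\<lambda>x. link_ccdf P c (f x) \<theta>) \<in> borel_measurable M"
proof -
  note [measurable] = borel_measurable_F_h[OF params_pos(12)] borel_measurable_F_h[OF params_pos(13)]
  show ?thesis
    unfolding link_ccdf_def p_los_def by measurable
qed

subsection \<open>The association region\<close>

lemma k_p_bounds: "0 < k_p P" "k_p P < 1"
  using params_pos powr_less_mono2[of "1 / pl_exp P" "pow_s P / pow_m P" 1] by (auto simp: k_p_def)

text \<open>With this form of the power ratio, the association rule becomes a comparison of
  distances, \<open>u < k_p P * kappa x u \<xi>\<close>.\<close>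

lemma pow_s_eq: "pow_s P = pow_m P * k_p P powr pl_exp P"
  using params_pos by (simp add: k_p_def powr_powr)

text \<open>Law of cosines. The angle is measured from the direction pointing away from the ABS,
  hence the plus sign in \<open>kappa\<close>.\<close>

lemma norm_axis_polar: "norm (x *\<^sub>R axis 1 1 + polar u \<xi>) = kappa x u \<xi>"
proof -
  have "(x + u * cos \<xi>)\<^sup>2 + (u * sin \<xi>)\<^sup>2 = x\<^sup>2 + u\<^sup>2 * ((sin \<xi>)\<^sup>2 + (cos \<xi>)\<^sup>2) + 2 * x * u * cos \<xi>"
    by (simp add: power2_eq_square algebra_simps del: sin_cos_squared_add3)
  then show ?thesis
    by (simp add: norm_real2 polar_def kappa_def axis_def add_ac)
qed

text \<open>Away from the angle pi the cosine exceeds -1, so the squared distance exceeds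
  \<open>(x - u)\<^sup>2\<close>. At the angle pi the user may sit on the ABS, where
  \<open>0 powr a = 0\<close> would distort the association rule.\<close>

lemma kappa_pos:
  assumes "0 < x" "0 < u" "\<xi> \<in> {0..2 * pi}" "\<xi> \<noteq> pi"
  shows "0 < x\<^sup>2 + u\<^sup>2 + 2 * x * u * cos \<xi>" "0 < kappa x u \<xi>"
proof -
  have "cos \<xi> \<noteq> - 1"
  proof
    assume "cos \<xi> = - 1"
    then have "cos (\<xi> - pi) = 1" by (simp add: cos_diff)
    then obtain n :: int where "\<xi> - pi = real_of_int n * 2 * pi" unfolding cos_one_2pi_int by blast
    then have n: "\<xi> = (2 * real_of_int n + 1) * pi" by (simp add: algebra_simps)
    then have "0 * pi \<le> (2 * real_of_int n + 1) * pi" "(2 * real_of_int n + 1) * pi \<le> 2 * pi"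
      using assms by auto
    then have "0 \<le> 2 * real_of_int n + 1" "2 * real_of_int n + 1 \<le> 2"
      by (simp_all only: mult_le_cancel_right_pos[OF pi_gt_zero])
    then have "n = 0" by linarith
    with n assms show False by simp
  qed
  then have "- 1 < cos \<xi>" by (metis cos_ge_minus_one less_eq_real_def)
  then have "2 * x * u * (- 1) < 2 * x * u * cos \<xi>"
    using assms by (intro mult_strict_left_mono) auto
  moreover have "0 \<le> (x - u)\<^sup>2" by simp
  ultimately show "0 < x\<^sup>2 + u\<^sup>2 + 2 * x * u * cos \<xi>"
    unfolding power2_diff by linarith
  then show "0 < kappa x u \<xi>" by (simp add: kappa_def)
qed

text \<open>The association region is the inside of an Apollonius circle around the SBS,
  \<open>u < k * K\<close> with \<open>k < 1\<close>. Squaring gives a quadratic inequality in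
  \<open>u\<close> with leading coefficient \<open>D > 0\<close>, whose roots have opposite signs;
  the bound is the positive root.\<close>

lemma assoc_sbs_polar:
  assumes x: "0 < x" and u: "0 < u" and \<xi>: "\<xi> \<in> {0..2 * pi}" "\<xi> \<noteq> pi"
  shows "assoc_sbs P (x *\<^sub>R axis 1 1) (polar u \<xi>) \<longleftrightarrow>
    u < x * k_p P * ((sqrt (1 - (k_p P)\<^sup>2 * (sin \<xi>)\<^sup>2) + k_p P * cos \<xi>) / (1 - (k_p P)\<^sup>2))"
proof -
  define k where "k = k_p P"
  define c where "c = cos \<xi>"
  define s where "s = sqrt (1 - k\<^sup>2 * (sin \<xi>)\<^sup>2)"
  define D where "D = 1 - k\<^sup>2"
  define \<alpha> where "\<alpha> = pl_exp P"
  define K where "K = kappa x u \<xi>"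
  have k: "0 < k" "k < 1" using k_p_bounds by (auto simp: k_def)
  have k2: "k\<^sup>2 < 1" using k by (simp add: power_less_one_iff)
  have D: "0 < D" using k2 by (simp add: D_def)
  have "(sin \<xi>)\<^sup>2 \<le> 1"
    by (simp add: sin_squared_eq)
  then have "k\<^sup>2 * (sin \<xi>)\<^sup>2 \<le> 1 * 1"
    using k2 by (intro mult_mono) auto
  then have s2: "s\<^sup>2 = D + k\<^sup>2 * c\<^sup>2" and s0: "0 \<le> s"
    by (auto simp: s_def D_def c_def sin_squared_eq algebra_simps)
  have "(k * c)\<^sup>2 < s\<^sup>2" using s2 D by (simp add: power_mult_distrib)
  then have ks: "k * c < s" using s0 by (rule power2_less_imp_less)
  have K: "0 < K" "K\<^sup>2 = x\<^sup>2 + u\<^sup>2 + 2 * x * u * c"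
    using kappa_pos[OF x u \<xi>] by (auto simp: K_def kappa_def c_def)
  have "assoc_sbs P (x *\<^sub>R axis 1 1) (polar u \<xi>) \<longleftrightarrow> pow_m P * (k powr \<alpha> * u powr - \<alpha>) > pow_m P * K powr - \<alpha>"
    using u by (simp add: assoc_sbs_def norm_axis_polar K_def \<alpha>_def pow_s_eq k_def mult.assoc)
  also have "\<dots> \<longleftrightarrow> K powr - \<alpha> < k powr \<alpha> * u powr - \<alpha>"
    using params_pos by simp
  also have "\<dots> \<longleftrightarrow> u powr \<alpha> < (k * K) powr \<alpha>"
    using K(1) k u by (simp add: powr_minus powr_mult field_simps)
  also have "\<dots> \<longleftrightarrow> u < k * K"
    using K k u params_pos powr_less_mono2[of \<alpha> u "k * K"] powr_mono2[of \<alpha> "k * K" u]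
    by (force simp: \<alpha>_def)
  also have "\<dots> \<longleftrightarrow> u\<^sup>2 < (k * K)\<^sup>2"
    using K k u by (auto intro: power_strict_mono power2_less_imp_less)
  also have "\<dots> \<longleftrightarrow> D * u\<^sup>2 - 2 * x * u * c * k\<^sup>2 - k\<^sup>2 * x\<^sup>2 < 0"
    by (simp add: power_mult_distrib K(2) D_def algebra_simps)
  \<comment> \<open>Multiplying by \<open>D\<close> completes the square without fractions:
    \<open>D * u\<close> has the roots \<open>x * k * (k * c + s)\<close> and
    \<open>x * k * (k * c - s)\<close>, because
    \<open>s\<^sup>2 - k\<^sup>2 * c\<^sup>2 = D\<close>.\<close>
  also have "\<dots> \<longleftrightarrow> D * (D * u\<^sup>2 - 2 * x * u * c * k\<^sup>2 - k\<^sup>2 * x\<^sup>2) < 0"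
    using D by (simp add: mult_less_0_iff)
  also have "D * (D * u\<^sup>2 - 2 * x * u * c * k\<^sup>2 - k\<^sup>2 * x\<^sup>2)
      = (D * u - x * k * (s + k * c)) * (D * u + x * k * (s - k * c))"
  proof -
    have "(D * u - x * k * (s + k * c)) * (D * u + x * k * (s - k * c))
       = D * D * u\<^sup>2 - 2 * x * u * c * k\<^sup>2 * D - x\<^sup>2 * k\<^sup>2 * (s\<^sup>2 - k\<^sup>2 * c\<^sup>2)"
      by (simp add: power2_eq_square algebra_simps)
    then show ?thesis
      unfolding s2 by (simp add: algebra_simps)
  qed
  \<comment> \<open>The factor of the negative root is positive by \<open>k * c < s\<close>, so the
    sign is decided by the other one.\<close>
  also have "\<dots> < 0 \<longleftrightarrow> D * u - x * k * (s + k * c) < 0"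
  proof -
    have "0 < D * u + x * k * (s - k * c)"
      using D u x k ks by (intro add_pos_pos mult_pos_pos) auto
    then show ?thesis by (simp add: mult_less_0_iff)
  qed
  also have "\<dots> \<longleftrightarrow> u < x * k * ((s + k * c) / D)"
    using D by (simp add: field_simps)
  finally show ?thesis
    by (simp add: k_def s_def c_def D_def)
qed

section \<open>Coverage integrals as averages over a uniform offset\<close>

lemma f_X_eq: "f_X P = radial_density (rad P - rad_s P)"
  by (simp add: fun_eq_iff f_X_def radial_density_def)

lemma f_U_eq: "f_U P = radial_density (rad_s P)"
  by (simp add: fun_eq_iff f_U_def radial_density_def)

lemma borel_measurable_u_max [measurable]:
  assumes [measurable]: "f \<in> borel_measurable M"
  shows "(\<lambda>y. u_max P x (f y)) \<in> borel_measurable M"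
  unfolding u_max_def by measurable

lemma borel_measurable_kappa [measurable]:
  assumes [measurable]: "f \<in> borel_measurable M" "g \<in> borel_measurable M"
  shows "(\<lambda>y. kappa x (f y) (g y)) \<in> borel_measurable M"
  unfolding kappa_def by measurable

lemma measurable_assoc_sbs [measurable]:
  assumes [measurable]: "f \<in> borel_measurable M" "g \<in> borel_measurable M"
  shows "Measurable.pred M (\<lambda>x. assoc_sbs P (f x) (g x))"
  unfolding assoc_sbs_def by measurable

text \<open>Association is a strict inequality, but the integration interval of \<open>Pc_s\<close>
  is closed. Leaving out one boundary radius per angle reconciles them.\<close>

lemma assoc_sbs_iff_u_max:
  assumes "0 < x" "0 < u" "u \<le> rad_s P" "\<xi> \<in> {0..2 * pi}" "\<xi> \<noteq> pi"
    and "u \<noteq> x * k_p P * ((sqrt (1 - (k_p P)\<^sup>2 * (sin \<xi>)\<^sup>2) + k_p P * cos \<xi>) / (1 - (k_p P)\<^sup>2))"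
  shows "assoc_sbs P (x *\<^sub>R axis 1 1) (polar u \<xi>) \<longleftrightarrow> u \<le> u_max P x \<xi>"
  unfolding assoc_sbs_polar[OF assms(1,2,4,5)] u_max_def using assms by auto

text \<open>This form turns the polar double integral into an average over the offset of one user,
  which is what conditioning on the centre produces. The equality of integrands holds for all angles
  but pi and, for each of these, all radii but one.\<close>

lemma Pc_s_eq:
  assumes x: "0 < x"
  shows "Pc_s P \<theta>\<^sub>1 \<theta>\<^sub>2 x = (\<integral>v. (if assoc_sbs P (x *\<^sub>R axis 1 1) v
      then link_ccdf P (pow_m P * (gain P)\<^sup>2) x \<theta>\<^sub>1 * link_ccdf P (pow_s P * gain P) (norm v) \<theta>\<^sub>2 else 0)
    \<partial>uniform_disc (rad_s P))"
proof -
  let ?g = "\<lambda>v. if assoc_sbs P (x *\<^sub>R axis 1 1) v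
      then link_ccdf P (pow_m P * (gain P)\<^sup>2) x \<theta>\<^sub>1 * link_ccdf P (pow_s P * gain P) (norm v) \<theta>\<^sub>2 else 0"
  let ?h = "\<lambda>\<xi> u. indicator {0..u_max P x \<xi>} u *\<^sub>R (link_ccdf P (pow_m P * (gain P)\<^sup>2) x \<theta>\<^sub>1
      * link_ccdf P (pow_s P * gain P) u \<theta>\<^sub>2 * (f_U P u / (2 * pi)))"
  have [measurable]: "f_U P \<in> borel_measurable borel"
    unfolding f_U_eq by measurable
  have bd: "\<bar>?g v\<bar> \<le> 1" for v
    using link_ccdf_bounds[of x "pow_m P * (gain P)\<^sup>2" \<theta>\<^sub>1] x
      link_ccdf_bounds[of "norm v" "pow_s P * gain P" \<theta>\<^sub>2]
    by (auto intro: mult_le_one)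
  have "(\<integral>v. ?g v \<partial>uniform_disc (rad_s P)) =
      (LBINT \<xi>:{0..2 * pi}. LBINT u. ?g (polar u \<xi>) * (radial_density (rad_s P) u / (2 * pi)))"
    by (rule integral_uniform_disc_polar[OF params_pos(1) _ bd]) measurable
  also have "\<dots> = (LBINT \<xi>:{0..2 * pi}. LBINT u. ?h \<xi> u)"
    unfolding set_lebesgue_integral_def
  proof (rule integral_cong_AE)
    show "AE \<xi> in lborel. indicator {0..2 * pi} \<xi> *\<^sub>R (LBINT u. ?g (polar u \<xi>) * (radial_density (rad_s P) u / (2 * pi)))
        = indicator {0..2 * pi} \<xi> *\<^sub>R (LBINT u. ?h \<xi> u)"
      using AE_lborel_singleton[of pi]
    proof eventually_elim
      case (elim \<xi>)
      have "(LBINT u. ?g (polar u \<xi>) * (radial_density (rad_s P) u / (2 * pi))) = (LBINT u. ?h \<xi> u)"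
        if \<xi>: "\<xi> \<in> {0..2 * pi}"
      proof (rule integral_cong_AE)
        show "AE u in lborel. ?g (polar u \<xi>) * (radial_density (rad_s P) u / (2 * pi)) = ?h \<xi> u"
          using AE_lborel_singleton[of "x * k_p P * ((sqrt (1 - (k_p P)\<^sup>2 * (sin \<xi>)\<^sup>2) + k_p P * cos \<xi>) / (1 - (k_p P)\<^sup>2))"]
        proof eventually_elim
          case (elim u)
          show ?case
          proof (cases "0 < u \<and> u \<le> rad_s P")
            case True
            then show ?thesis
              using assoc_sbs_iff_u_max[OF x _ _ \<xi> \<open>\<xi> \<noteq> pi\<close> elim] by (auto simp: f_U_eq)
          qed (auto simp: f_U_eq radial_density_def)
        qed
      qed measurable
      then show ?case by (auto simp: indicator_def)
    qed
    \<comment> \<open>The end point of the inner interval moves with the angle, so its indicator has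
      to be measurable jointly in angle and radius.\<close>
    have [measurable]: "Measurable.pred (borel \<Otimes>\<^sub>M borel) (\<lambda>p. snd p \<in> {0..u_max P x (fst p)})"
      unfolding atLeastAtMost_iff by measurable
    have [measurable]: "(\<lambda>p. ?h (fst p) (snd p)) \<in> borel_measurable (borel \<Otimes>\<^sub>M borel)"
      by measurable
    show "(\<lambda>\<xi>. indicator {0..2 * pi} \<xi> *\<^sub>R (LBINT u. ?g (polar u \<xi>) * (radial_density (rad_s P) u / (2 * pi))))
        \<in> borel_measurable lborel"
      by measurable
    show "(\<lambda>\<xi>. indicator {0..2 * pi} \<xi> *\<^sub>R (LBINT u. ?h \<xi> u)) \<in> borel_measurable lborel"
      by measurable
  qed
  finally show ?thesis
    by (simp add: Pc_s_def set_lebesgue_integral_def)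
qed

lemma Pc_m_eq:
  assumes x: "0 < x"
  shows "Pc_m P \<theta> x = (\<integral>v. (if \<not> assoc_sbs P (x *\<^sub>R axis 1 1) v
      then link_ccdf P (pow_m P * gain P) (norm (x *\<^sub>R axis 1 1 + v)) \<theta> else 0)
    \<partial>uniform_disc (rad_s P))"
proof -
  let ?g = "\<lambda>v. if \<not> assoc_sbs P (x *\<^sub>R axis 1 1) v
      then link_ccdf P (pow_m P * gain P) (norm (x *\<^sub>R axis 1 1 + v)) \<theta> else 0"
  let ?h = "\<lambda>\<xi> u. indicator {u_max P x \<xi>..rad_s P} u *\<^sub>R
      (link_ccdf P (pow_m P * gain P) (kappa x u \<xi>) \<theta> * (f_U P u / (2 * pi)))"
  have [measurable]: "f_U P \<in> borel_measurable borel"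
    unfolding f_U_eq by measurable
  have bd: "\<bar>?g v\<bar> \<le> 1" for v
    using link_ccdf_bounds[of "norm (x *\<^sub>R axis 1 1 + v)" "pow_m P * gain P" \<theta>] by auto
  have "(\<integral>v. ?g v \<partial>uniform_disc (rad_s P)) =
      (LBINT \<xi>:{0..2 * pi}. LBINT u. ?g (polar u \<xi>) * (radial_density (rad_s P) u / (2 * pi)))"
    by (rule integral_uniform_disc_polar[OF params_pos(1) _ bd]) measurable
  also have "\<dots> = (LBINT \<xi>:{0..2 * pi}. LBINT u. ?h \<xi> u)"
    unfolding set_lebesgue_integral_def
  proof (rule integral_cong_AE)
    show "AE \<xi> in lborel. indicator {0..2 * pi} \<xi> *\<^sub>R (LBINT u. ?g (polar u \<xi>) * (radial_density (rad_s P) u / (2 * pi)))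
        = indicator {0..2 * pi} \<xi> *\<^sub>R (LBINT u. ?h \<xi> u)"
      using AE_lborel_singleton[of pi]
    proof eventually_elim
      case (elim \<xi>)
      let ?b = "x * k_p P * ((sqrt (1 - (k_p P)\<^sup>2 * (sin \<xi>)\<^sup>2) + k_p P * cos \<xi>) / (1 - (k_p P)\<^sup>2))"
      have "(LBINT u. ?g (polar u \<xi>) * (radial_density (rad_s P) u / (2 * pi))) = (LBINT u. ?h \<xi> u)"
        if \<xi>: "\<xi> \<in> {0..2 * pi}"
      proof (rule integral_cong_AE)
        \<comment> \<open>Besides the association boundary, the radius \<open>rad_s P\<close> is
          left out: when \<open>u_max\<close> is capped there, the closed interval from
          \<open>u_max\<close> to \<open>rad_s P\<close> is a single point rather than
          empty.\<close>
        show "AE u in lborel. ?g (polar u \<xi>) * (radial_density (rad_s P) u / (2 * pi)) = ?h \<xi> u"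
          using AE_lborel_singleton[of ?b] AE_lborel_singleton[of "rad_s P"]
        proof eventually_elim
          case (elim u)
          show ?case
          proof (cases "0 < u \<and> u \<le> rad_s P")
            case True
            then have "u \<noteq> u_max P x \<xi>" using elim by (auto simp: u_max_def min_def)
            then show ?thesis
              using assoc_sbs_iff_u_max[OF x _ _ \<xi> \<open>\<xi> \<noteq> pi\<close> elim(1)] True
              by (auto simp: f_U_eq norm_axis_polar)
          qed (auto simp: f_U_eq radial_density_def)
        qed
      qed measurable
      then show ?case by (auto simp: indicator_def)
    qed
    have [measurable]: "Measurable.pred (borel \<Otimes>\<^sub>M borel) (\<lambda>p. snd p \<in> {u_max P x (fst p)..rad_s P})"
      unfolding atLeastAtMost_iff by measurable
    have [measurable]: "(\<lambda>p. link_ccdf P (pow_m P * gain P) (kappa x (snd p) (fst p)) \<theta>)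
        \<in> borel_measurable (borel \<Otimes>\<^sub>M borel)"
      by measurable
    have [measurable]: "(\<lambda>p. ?h (fst p) (snd p)) \<in> borel_measurable (borel \<Otimes>\<^sub>M borel)"
      by measurable
    show "(\<lambda>\<xi>. indicator {0..2 * pi} \<xi> *\<^sub>R (LBINT u. ?g (polar u \<xi>) * (radial_density (rad_s P) u / (2 * pi))))
        \<in> borel_measurable lborel"
      by measurable
    show "(\<lambda>\<xi>. indicator {0..2 * pi} \<xi> *\<^sub>R (LBINT u. ?h \<xi> u)) \<in> borel_measurable lborel"
      by measurable
  qed
  finally show ?thesis
    by (simp add: Pc_m_def set_lebesgue_integral_def)
qed

end

section \<open>Counting successes in a product space\<close>

text \<open>Once \<open>i\<close> is removed, the other \<open>k - 1\<close> elements are chosen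
  freely. In the application \<open>i\<close> is the typical user, who always counts itself; this is
  the origin of the shifted binomial coefficient.\<close>

lemma card_subsets_containing:
  assumes "finite I" "i \<in> I" "1 \<le> k"
  shows "card {T. T \<subseteq> I \<and> i \<in> T \<and> card T = k} = (card I - 1) choose (k - 1)"
proof -
  have fin: "finite T" if "T \<subseteq> I" for T
    using that assms(1) by (rule finite_subset)
  have "{T. T \<subseteq> I \<and> i \<in> T \<and> card T = k} = insert i ` {T. T \<subseteq> I - {i} \<and> card T = k - 1}" (is "?L = ?R")
  proof
    show "?L \<subseteq> ?R"
    proof
      fix T assume T: "T \<in> ?L"
      then have "T = insert i (T - {i})" "T - {i} \<subseteq> I - {i}" "card (T - {i}) = k - 1"
        using fin[of T] by (auto simp: card_Diff_singleton)
      then show "T \<in> ?R" by blast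
    qed
    show "?R \<subseteq> ?L"
    proof
      fix T assume "T \<in> ?R"
      then obtain T' where T': "T = insert i T'" "T' \<subseteq> I - {i}" "card T' = k - 1" by auto
      then have "finite T'" "i \<notin> T'" using fin[of T'] by auto
      with T' assms show "T \<in> ?L" by auto
    qed
  qed
  moreover have "inj_on (insert i) {T. T \<subseteq> I - {i} \<and> card T = k - 1}"
    by (rule inj_onI) blast
  ultimately have "card {T. T \<subseteq> I \<and> i \<in> T \<and> card T = k} = card {T. T \<subseteq> I - {i} \<and> card T = k - 1}"
    by (simp add: card_image)
  also have "\<dots> = card (I - {i}) choose (k - 1)"
    using assms by (intro n_subsets) auto
  finally show ?thesis
    using assms by simp
qed

text \<open>Expanding over the set \<open>T\<close> of successful coordinates turns the integrand into a sum of products.\<close>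
lemma integral_PiM_count:
  fixes U :: "'b measure" and q :: "'b \<Rightarrow> real"
  assumes U: "prob_space U" and I: "finite I" "i \<in> I" and S[measurable]: "S \<in> sets U"
    and q[measurable]: "q \<in> borel_measurable U" and bd: "\<And>x. \<bar>q x\<bar> \<le> B"
    and q0: "\<And>x. x \<in> space U \<Longrightarrow> x \<notin> S \<Longrightarrow> q x = 0" and k: "1 \<le> k"
  shows "(\<integral>v. (if card {j \<in> I. v j \<in> S} = k then q (v i) else 0) \<partial>PiM I (\<lambda>_. U))
    = real ((card I - 1) choose (k - 1)) * measure U S ^ (k - 1) * (1 - measure U S) ^ (card I - k) * (\<integral>x. q x \<partial>U)"
proof -
  interpret U: prob_space U by (rule U)
  interpret product_sigma_finite "\<lambda>_. U" ..
  \<comment> \<open>Coordinate \<open>i\<close> carries \<open>q\<close> in place of an indicator.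
    As \<open>q\<close> vanishes off \<open>S\<close>, this factor also enforces that coordinate
    \<open>i\<close> is a success.\<close>
  define g where "g T j = (if j = i then q else indicator (if j \<in> T then S else space U - S))" for T j
  have gm[measurable]: "g T j \<in> borel_measurable U" for T j
    by (auto simp: g_def)
  have gi: "integrable U (g T j)" for T j
    by (rule U.integrable_const_bound[where B = "max 1 B"])
       (auto simp: g_def indicator_def intro!: AE_I2 le_max_iff_disj[THEN iffD2] bd)
  let ?TT = "{T. T \<subseteq> I \<and> i \<in> T \<and> card T = k}"
  have finTT: "finite ?TT" by (rule finite_subset[of _ "Pow I"]) (use I in auto)
  have "(if card {j \<in> I. v j \<in> S} = k then q (v i) else 0) = (\<Sum>T\<in>?TT. \<Prod>j\<in>I. g T j (v j))"
    if v: "v \<in> space (PiM I (\<lambda>_. U))" for v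
  proof -
    have vs: "v j \<in> space U" if "j \<in> I" for j
      using v that by (auto simp: space_PiM)
    show ?thesis
    proof (cases "v i \<in> S")
      case False
      then have "q (v i) = 0" using q0 vs I by auto
      then have "(\<Prod>j\<in>I. g T j (v j)) = 0" for T
        using I by (intro prod_zero) (auto simp: g_def intro!: bexI[of _ i])
      then show ?thesis using \<open>q (v i) = 0\<close> by simp
    next
      case True
      define T0 where "T0 = {j \<in> I. v j \<in> S}"
      have "(\<Prod>j\<in>I. g T j (v j)) = (if T = T0 then q (v i) else 0)" if T: "T \<in> ?TT" for T
      proof -
        have "(\<Prod>j\<in>I. g T j (v j)) = q (v i) * (\<Prod>j\<in>I - {i}. g T j (v j))"
          using I by (simp add: prod.remove g_def)
        also have "(\<Prod>j\<in>I - {i}. g T j (v j)) = (if T = T0 then 1 else 0)"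
        proof (cases "T = T0")
          case True
          then show ?thesis
            using vs by (auto intro!: prod.neutral simp: g_def T0_def)
        next
          case False
          \<comment> \<open>If \<open>T\<close> is not the actual set of successes, some coordinate
            is misclassified and contributes a factor 0. It differs from \<open>i\<close>, which
            belongs to both sets.\<close>
          then obtain j where "j \<in> I" "j \<in> T \<longleftrightarrow> v j \<notin> S"
            using T by (auto simp: T0_def)
          moreover from this have "j \<noteq> i" using True T by auto
          ultimately have "\<exists>j\<in>I - {i}. g T j (v j) = 0"
            by (intro bexI[of _ j]) (auto simp: g_def)
          then have "(\<Prod>j\<in>I - {i}. g T j (v j)) = 0"
            using I by (intro prod_zero) auto
          with False show ?thesis by simp
        qed
        finally show ?thesis by simp
      qed
      then have "(\<Sum>T\<in>?TT. \<Prod>j\<in>I. g T j (v j)) = (\<Sum>T\<in>?TT. if T = T0 then q (v i) else 0)"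
        by (intro sum.cong) auto
      also have "\<dots> = (if T0 \<in> ?TT then q (v i) else 0)"
        using finTT by simp
      also have "T0 \<in> ?TT \<longleftrightarrow> card {j \<in> I. v j \<in> S} = k"
        using True I by (auto simp: T0_def)
      finally show ?thesis by simp
    qed
  qed
  then have "(\<integral>v. (if card {j \<in> I. v j \<in> S} = k then q (v i) else 0) \<partial>PiM I (\<lambda>_. U))
      = (\<integral>v. (\<Sum>T\<in>?TT. \<Prod>j\<in>I. g T j (v j)) \<partial>PiM I (\<lambda>_. U))"
    by (intro Bochner_Integration.integral_cong) auto
  also have "\<dots> = (\<Sum>T\<in>?TT. \<integral>v. (\<Prod>j\<in>I. g T j (v j)) \<partial>PiM I (\<lambda>_. U))"
    by (intro Bochner_Integration.integral_sum product_integrable_prod I gi)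
  also have "\<dots> = (\<Sum>T\<in>?TT. \<Prod>j\<in>I. \<integral>x. g T j x \<partial>U)"
    by (intro sum.cong refl product_integral_prod I gi)
  also have "\<dots> = (\<Sum>T\<in>?TT. measure U S ^ (k - 1) * (1 - measure U S) ^ (card I - k) * (\<integral>x. q x \<partial>U))"
  proof (intro sum.cong refl)
    fix T assume T: "T \<in> ?TT"
    then have fT: "finite T" using I finite_subset by auto
    have gint: "(\<integral>x. g T j x \<partial>U) = (if j \<in> T then measure U S else 1 - measure U S)" if "j \<noteq> i" for j
      using that U.prob_compl[OF S] by (auto simp: g_def)
    have "(\<Prod>j\<in>I. \<integral>x. g T j x \<partial>U) = (\<integral>x. q x \<partial>U) * (\<Prod>j\<in>I - {i}. \<integral>x. g T j x \<partial>U)"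
      using I by (simp add: prod.remove g_def)
    also have "(\<Prod>j\<in>I - {i}. \<integral>x. g T j x \<partial>U) = (\<Prod>j\<in>I - {i}. if j \<in> T then measure U S else 1 - measure U S)"
      by (intro prod.cong) (auto simp: gint)
    \<comment> \<open>Without \<open>i\<close>, there remain \<open>k - 1\<close> prescribed
      successes and \<open>card I - k\<close> prescribed failures.\<close>
    also have "\<dots> = (\<Prod>j\<in>(T - {i}) \<union> (I - T). if j \<in> T then measure U S else 1 - measure U S)"
      using T by (intro prod.cong) auto
    also have "\<dots> = (\<Prod>j\<in>T - {i}. measure U S) * (\<Prod>j\<in>I - T. 1 - measure U S)"
      using I fT by (subst prod.union_disjoint) auto
    also have "\<dots> = measure U S ^ (k - 1) * (1 - measure U S) ^ (card I - k)"
      using T fT by (simp add: card_Diff_subset)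
    finally show "(\<Prod>j\<in>I. \<integral>x. g T j x \<partial>U) = measure U S ^ (k - 1) * (1 - measure U S) ^ (card I - k) * (\<integral>x. q x \<partial>U)"
      by simp
  qed
  also have "\<dots> = real (card ?TT) * measure U S ^ (k - 1) * (1 - measure U S) ^ (card I - k) * (\<integral>x. q x \<partial>U)"
    by simp
  finally show ?thesis
    unfolding card_subsets_containing[OF I k] .
qed

text \<open>Some orthogonal map carries \<open>y\<close> to the first axis. The integrand is
  unchanged when both arguments are moved, and the law of the offset is unchanged by moving it
  alone.\<close>

lemma integral_uniform_disc_rotate:
  fixes g :: "real^2 \<Rightarrow> real^2 \<Rightarrow> real"
  assumes r: "0 < r" and [measurable]: "\<And>y. g y \<in> borel_measurable borel"
    and inv: "\<And>f y v. orthogonal_transformation f \<Longrightarrow> g (f y) (f v) = g y v"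
  shows "(\<integral>v. g y v \<partial>uniform_disc r) = (\<integral>v. g (norm y *\<^sub>R axis 1 1) v \<partial>uniform_disc r)"
proof -
  have "norm y = norm (norm y *\<^sub>R axis 1 (1::real) :: real^2)"
    by (simp add: norm_axis_1)
  then obtain f :: "real^2 \<Rightarrow> real^2" where f: "orthogonal_transformation f" "f y = norm y *\<^sub>R axis 1 1"
    using orthogonal_transformation_exists by metis
  have fm[measurable]: "f \<in> borel_measurable borel"
    using f by (intro borel_measurable_continuous_onI linear_continuous_on)
      (auto simp: orthogonal_transformation_linear linear_conv_bounded_linear[symmetric])
  have "(\<integral>v. g (norm y *\<^sub>R axis 1 1) v \<partial>uniform_disc r)
      = (\<integral>v. g (f y) v \<partial>distr (uniform_disc r) borel f)"
    unfolding distr_uniform_disc_orthogonal[OF r f(1)] f(2) ..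
  also have "\<dots> = (\<integral>v. g (f y) (f v) \<partial>uniform_disc r)"
    by (subst integral_distr) auto
  finally show ?thesis by (simp add: inv[OF f(1)])
qed

section \<open>The representative hotspot\<close>

text \<open>The library notion \<open>indep_var\<close> is confined to random variables of the same type.\<close>
lemma (in prob_space) distr_Pair_indep:
  assumes X[measurable]: "X \<in> measurable M S" and Y[measurable]: "Y \<in> measurable M T"
    and fac: "\<And>A B. A \<in> sets S \<Longrightarrow> B \<in> sets T \<Longrightarrow>
      prob {\<omega> \<in> space M. X \<omega> \<in> A \<and> Y \<omega> \<in> B} = prob {\<omega> \<in> space M. X \<omega> \<in> A} * prob {\<omega> \<in> space M. Y \<omega> \<in> B}"
  shows "distr M (S \<Otimes>\<^sub>M T) (\<lambda>\<omega>. (X \<omega>, Y \<omega>)) = distr M S X \<Otimes>\<^sub>M distr M T Y"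
proof -
  interpret X: prob_space "distr M S X" by (rule prob_space_distr) fact
  interpret Y: prob_space "distr M T Y" by (rule prob_space_distr) fact
  have "emeasure (distr M S X) A * emeasure (distr M T Y) B
      = emeasure (distr M (S \<Otimes>\<^sub>M T) (\<lambda>\<omega>. (X \<omega>, Y \<omega>))) (A \<times> B)"
    if "A \<in> sets S" "B \<in> sets T" for A B
  proof -
    have "emeasure (distr M (S \<Otimes>\<^sub>M T) (\<lambda>\<omega>. (X \<omega>, Y \<omega>))) (A \<times> B) = prob {\<omega> \<in> space M. X \<omega> \<in> A \<and> Y \<omega> \<in> B}"
      using that by (subst emeasure_distr)
        (auto simp: emeasure_eq_measure intro!: arg_cong[where f = prob])
    also have "\<dots> = ennreal (prob {\<omega> \<in> space M. X \<omega> \<in> A}) * ennreal (prob {\<omega> \<in> space M. Y \<omega> \<in> B})"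
      unfolding fac[OF that] by (simp add: ennreal_mult)
    also have "\<dots> = emeasure (distr M S X) A * emeasure (distr M T Y) B"
      using that by (simp add: emeasure_distr emeasure_eq_measure vimage_def Int_def conj_commute)
    finally show ?thesis ..
  qed
  then show ?thesis
    by (intro pair_measure_eqI[symmetric] X.sigma_finite_measure_axioms Y.sigma_finite_measure_axioms)
      (auto cong: sets_pair_measure_cong)
qed

lemma UNIV_link: "UNIV = {Backhaul, Access_SBS, Access_ABS}"
  using link.exhaust by blast

lemma finite_UNIV_link [simp]: "finite (UNIV :: link set)"
  by (simp add: UNIV_link)

lemma prod_UNIV_link: "(\<Prod>l\<in>UNIV. f l) = f Backhaul * (f Access_SBS * f Access_ABS)"
  by (simp add: UNIV_link)

context cellular_network
begin

abbreviation "users \<equiv> {1..n_usr P}"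

abbreviation loc_space :: "((real^2) \<times> (nat \<Rightarrow> real^2)) measure" where
  "loc_space \<equiv> borel \<Otimes>\<^sub>M PiM users (\<lambda>_. borel)"

text \<open>The location component of \<open>rep_data\<close>, kept apart because the link law is
  conditional on the locations.\<close>

definition rep_loc :: "'a \<Rightarrow> (real^2) \<times> (nat \<Rightarrow> real^2)" where
  "rep_loc \<omega> = (rep_ctr P N \<omega>, \<lambda>j\<in>users. usr N (n_hot P) j \<omega>)"

lemmas pos = params_pos[OF params]

lemma n_hot_in: "n_hot P \<in> {1..n_hot P}"
  using pos by auto

lemma loc_measurable: "k \<in> loc_index P \<Longrightarrow> loc N k \<in> borel_measurable (prb N)"
  using loc_indep by (auto simp: indep_vars_def)

lemma loc_tuple_measurable:
  "(\<lambda>\<omega>. \<lambda>k\<in>loc_index P. loc N k \<omega>) \<in> measurable (loc_sigma P N) (PiM (loc_index P) (\<lambda>_. borel))"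
  unfolding loc_sigma_def by (rule measurable_vimage_algebra1) (auto simp: space_PiM)

lemma rep_ctr_loc: "rep_ctr P N = loc N (Inl (n_hot P))"
  by (simp add: rep_ctr_def loc_def)

lemma usr_loc: "usr N (n_hot P) j = loc N (Inr (n_hot P, j))"
  by (simp add: loc_def)

lemma rep_in_loc_index: "Inl (n_hot P) \<in> loc_index P" "j \<in> users \<Longrightarrow> Inr (n_hot P, j) \<in> loc_index P"
  using n_hot_in by (auto simp: loc_index_def)

text \<open>Measurability with respect to the conditioning sigma-algebra, beyond that of the sample
  space, makes events about the representative hotspot admissible when a conditional probability is
  integrated.\<close>

lemma rep_loc_measurable_loc_sigma: "rep_loc \<in> measurable (loc_sigma P N) loc_space"
proof -
  have "(\<lambda>f. (f (Inl (n_hot P)), \<lambda>j\<in>users. f (Inr (n_hot P, j))))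
      \<in> measurable (PiM (loc_index P) (\<lambda>_. borel)) loc_space"
    using rep_in_loc_index by (intro measurable_Pair measurable_restrict measurable_component_singleton) auto
  from measurable_compose[OF loc_tuple_measurable this]
  show ?thesis
    using rep_in_loc_index by (simp add: rep_loc_def[abs_def] rep_ctr_loc usr_loc cong: restrict_cong)
qed

lemma loc_subalgebra: "subalgebra (prb N) (loc_sigma P N)"
proof -
  have "(\<lambda>\<omega>. \<lambda>k\<in>loc_index P. loc N k \<omega>) \<in> measurable (prb N) (PiM (loc_index P) (\<lambda>_. borel))"
    using loc_measurable by (intro measurable_restrict) auto
  then show ?thesis
    unfolding subalgebra_def loc_sigma_def
    by (auto simp: sets_vimage_algebra2 space_PiM measurable_sets)
qed

lemma rep_loc_measurable [measurable]: "rep_loc \<in> measurable (prb N) loc_space"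
  by (rule measurable_from_subalg[OF loc_subalgebra rep_loc_measurable_loc_sigma])

text \<open>Independence is assumed for centres and offsets as a single family. Grouping its indices
  separates the representative centre from the offsets of its users; inside the second group,
  agreement on rectangles yields the product of uniform laws.\<close>

lemma distr_rep_loc:
  "distr (prb N) loc_space rep_loc
   = uniform_disc (rad P - rad_s P) \<Otimes>\<^sub>M PiM users (\<lambda>_. uniform_disc (rad_s P))"
proof -
  let ?A = "{Inl (n_hot P)}" and ?B = "(\<lambda>j. Inr (n_hot P, j)) ` users"
  have "indep_var (PiM ?A (\<lambda>_. borel)) (\<lambda>\<omega>. \<lambda>i\<in>?A. loc N i \<omega>) (PiM ?B (\<lambda>_. borel)) (\<lambda>\<omega>. \<lambda>i\<in>?B. loc N i \<omega>)"
    using rep_in_loc_index by (intro indep_var_restrict[OF loc_indep]) auto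
  then have fac: "prob ((\<lambda>\<omega>. (\<lambda>i\<in>?A. loc N i \<omega>, \<lambda>i\<in>?B. loc N i \<omega>)) -` (C \<times> D) \<inter> space (prb N))
      = prob ((\<lambda>\<omega>. \<lambda>i\<in>?A. loc N i \<omega>) -` C \<inter> space (prb N)) * prob ((\<lambda>\<omega>. \<lambda>i\<in>?B. loc N i \<omega>) -` D \<inter> space (prb N))"
    if "C \<in> sets (PiM ?A (\<lambda>_. borel))" "D \<in> sets (PiM ?B (\<lambda>_. borel))" for C D
    using that by (rule indep_varD)
  have "distr (prb N) loc_space rep_loc = distr (prb N) borel (rep_ctr P N)
      \<Otimes>\<^sub>M distr (prb N) (PiM users (\<lambda>_. borel)) (\<lambda>\<omega>. \<lambda>j\<in>users. usr N (n_hot P) j \<omega>)"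
    unfolding rep_loc_def[abs_def]
  proof (rule distr_Pair_indep)
    show "rep_ctr P N \<in> borel_measurable (prb N)"
      using loc_measurable rep_in_loc_index by (simp add: rep_ctr_loc)
    show "(\<lambda>\<omega>. \<lambda>j\<in>users. usr N (n_hot P) j \<omega>) \<in> measurable (prb N) (PiM users (\<lambda>_. borel))"
      using loc_measurable rep_in_loc_index by (intro measurable_restrict) (simp add: usr_loc)
  next
    fix C :: "(real^2) set" and D :: "(nat \<Rightarrow> real^2) set"
    assume C: "C \<in> sets borel" and D: "D \<in> sets (PiM users (\<lambda>_. borel))"
    \<comment> \<open>The grouped variables take values in function spaces over the index groups, so
      the test sets are pulled back to these spaces.\<close>
    let ?C = "(\<lambda>f. f (Inl (n_hot P))) -` C \<inter> space (PiM ?A (\<lambda>_. borel))"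
    let ?D = "(\<lambda>f. \<lambda>j\<in>users. f (Inr (n_hot P, j))) -` D \<inter> space (PiM ?B (\<lambda>_. borel))"
    have "?C \<in> sets (PiM ?A (\<lambda>_. borel))"
      using C by (intro measurable_sets[OF measurable_component_singleton]) auto
    moreover have "?D \<in> sets (PiM ?B (\<lambda>_. borel))"
      using D by (intro measurable_sets[OF measurable_restrict[OF measurable_component_singleton]]) auto
    moreover have "(\<lambda>\<omega>. (\<lambda>i\<in>?A. loc N i \<omega>, \<lambda>i\<in>?B. loc N i \<omega>)) -` (?C \<times> ?D) \<inter> space (prb N)
        = {\<omega> \<in> space (prb N). rep_ctr P N \<omega> \<in> C \<and> (\<lambda>j\<in>users. usr N (n_hot P) j \<omega>) \<in> D}"
      by (auto simp: space_PiM rep_ctr_loc usr_loc cong: restrict_cong)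
    moreover have "(\<lambda>\<omega>. \<lambda>i\<in>?A. loc N i \<omega>) -` ?C \<inter> space (prb N) = {\<omega> \<in> space (prb N). rep_ctr P N \<omega> \<in> C}"
      by (intro set_eqI) (simp add: space_PiM rep_ctr_loc conj_commute)
    moreover have "(\<lambda>\<omega>. \<lambda>i\<in>?B. loc N i \<omega>) -` ?D \<inter> space (prb N)
        = {\<omega> \<in> space (prb N). (\<lambda>j\<in>users. usr N (n_hot P) j \<omega>) \<in> D}"
      by (auto simp: space_PiM usr_loc cong: restrict_cong)
    ultimately show "prob {\<omega> \<in> space (prb N). rep_ctr P N \<omega> \<in> C \<and> (\<lambda>j\<in>users. usr N (n_hot P) j \<omega>) \<in> D}
        = prob {\<omega> \<in> space (prb N). rep_ctr P N \<omega> \<in> C}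
          * prob {\<omega> \<in> space (prb N). (\<lambda>j\<in>users. usr N (n_hot P) j \<omega>) \<in> D}"
      using fac[of ?C ?D] by (simp only:)
  qed
  moreover have "distr (prb N) borel (rep_ctr P N) = uniform_disc (rad P - rad_s P)"
    using ctr_law[OF n_hot_in] by (simp add: rep_ctr_def)
  moreover have "distr (prb N) (PiM users (\<lambda>_. borel)) (\<lambda>\<omega>. \<lambda>j\<in>users. usr N (n_hot P) j \<omega>)
      = PiM users (\<lambda>_. uniform_disc (rad_s P))"
  proof -
    have ind: "indep_vars (\<lambda>_. borel) (loc N) ?B"
      using rep_in_loc_index by (intro indep_vars_subset[OF loc_indep]) auto
    interpret U: prob_space "uniform_disc (rad_s P)" by (rule prob_space_uniform_disc[OF pos(1)])
    interpret product_sigma_finite "\<lambda>_. uniform_disc (rad_s P)" ..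
    have um: "usr N (n_hot P) j \<in> borel_measurable (prb N)" if "j \<in> users" for j
      using loc_measurable rep_in_loc_index that by (simp add: usr_loc)
    have tm: "(\<lambda>\<omega>. \<lambda>j\<in>users. usr N (n_hot P) j \<omega>) \<in> measurable (prb N) (PiM users (\<lambda>_. borel))"
      using um by (intro measurable_restrict) auto
    show ?thesis
    proof (rule PiM_eqI)
      show "sets (distr (prb N) (PiM users (\<lambda>_. borel)) (\<lambda>\<omega>. \<lambda>j\<in>users. usr N (n_hot P) j \<omega>))
          = sets (PiM users (\<lambda>_. uniform_disc (rad_s P)))"
        by (simp cong: sets_PiM_cong)
    next
      fix A :: "nat \<Rightarrow> (real^2) set" assume "\<And>j. j \<in> users \<Longrightarrow> A j \<in> sets (uniform_disc (rad_s P))"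
      then have A: "A j \<in> sets borel" if "j \<in> users" for j using that by simp
      have "emeasure (distr (prb N) (PiM users (\<lambda>_. borel)) (\<lambda>\<omega>. \<lambda>j\<in>users. usr N (n_hot P) j \<omega>)) (PiE users A)
          = prob ((\<lambda>\<omega>. \<lambda>j\<in>users. usr N (n_hot P) j \<omega>) -` PiE users A \<inter> space (prb N))"
        using A by (subst emeasure_distr[OF tm]) (auto intro!: sets_PiM_I_finite simp: emeasure_eq_measure)
      \<comment> \<open>There is at least one user, so the intersection runs over a nonempty family
        and stays inside the sample space.\<close>
      also have "(\<lambda>\<omega>. \<lambda>j\<in>users. usr N (n_hot P) j \<omega>) -` PiE users A \<inter> space (prb N)
          = (\<Inter>i\<in>?B. loc N i -` A (snd (projr i)) \<inter> space (prb N))"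
        using pos by (auto simp: usr_loc PiE_iff)
      also have "prob \<dots> = (\<Prod>i\<in>?B. prob (loc N i -` A (snd (projr i)) \<inter> space (prb N)))"
        using A pos by (intro indep_varsD_finite[OF ind]) auto
      also have "\<dots> = (\<Prod>j\<in>users. prob (loc N (Inr (n_hot P, j)) -` A j \<inter> space (prb N)))"
        by (subst prod.reindex) (auto intro!: inj_onI)
      also have "ennreal \<dots> = (\<Prod>j\<in>users. ennreal (prob (loc N (Inr (n_hot P, j)) -` A j \<inter> space (prb N))))"
        by (simp add: prod_ennreal)
      also have "\<dots> = (\<Prod>j\<in>users. emeasure (uniform_disc (rad_s P)) (A j))"
      proof (intro prod.cong refl)
        fix j assume j: "j \<in> users"
        show "ennreal (prob (loc N (Inr (n_hot P, j)) -` A j \<inter> space (prb N))) = emeasure (uniform_disc (rad_s P)) (A j)"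
          unfolding usr_law[OF n_hot_in j, symmetric]
          using um[OF j] A[OF j] by (simp add: emeasure_distr emeasure_eq_measure usr_loc)
      qed
      finally show "emeasure (distr (prb N) (PiM users (\<lambda>_. borel)) (\<lambda>\<omega>. \<lambda>j\<in>users. usr N (n_hot P) j \<omega>)) (PiE users A)
          = (\<Prod>j\<in>users. emeasure (uniform_disc (rad_s P)) (A j))" .
    qed simp
  qed
  ultimately show ?thesis by simp
qed

lemma typ_in_users: "typ_usr N \<in> users"
  by (rule typ_usr_range)

text \<open>A finite cardinality is a sum of indicators. The predicate is left general so that users
  of the SBS and users of the ABS are counted alike.\<close>

lemma pred_card_users:
  assumes "Measurable.pred (borel \<Otimes>\<^sub>M borel) (\<lambda>p. C (fst p) (snd p))"
  shows "Measurable.pred loc_space (\<lambda>p. card {j \<in> users. C (fst p) (snd p j)} = k)"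
proof -
  have card_eq: "real (card {j \<in> users. C y (v j)}) = (\<Sum>j\<in>users. if C y (v j) then 1 else 0)"
    for y :: "real^2" and v :: "nat \<Rightarrow> real^2"
    by (simp add: sum.If_cases Int_def)
  have "(\<lambda>p. \<Sum>j\<in>users. if C (fst p) (snd p j) then 1 else (0::real)) \<in> borel_measurable loc_space"
  proof (rule borel_measurable_sum)
    fix j assume "j \<in> users"
    then have j: "(\<lambda>p. snd p j) \<in> borel_measurable loc_space"
      by (intro measurable_compose[OF measurable_snd measurable_component_singleton])
    have "Measurable.pred loc_space (\<lambda>p. C (fst p) (snd p j))"
      using measurable_compose[OF measurable_Pair[OF measurable_fst j] assms] by (simp only: fst_conv snd_conv)
    then show "(\<lambda>p. if C (fst p) (snd p j) then 1 else (0::real)) \<in> borel_measurable loc_space"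
      by measurable
  qed
  then have "Measurable.pred loc_space (\<lambda>p. (\<Sum>j\<in>users. if C (fst p) (snd p j) then 1 else (0::real)) = real k)"
    by measurable
  then show ?thesis
    unfolding card_eq[symmetric] of_nat_eq_iff .
qed

text \<open>The association rule \<open>C\<close>, the conditional success probability \<open>q\<close> and their averages see the
  position of the centre only through its distance \<open>x\<close> from the origin.\<close>
lemma integral_rep_loc_count:
  fixes C :: "real^2 \<Rightarrow> real^2 \<Rightarrow> bool" and q :: "real^2 \<Rightarrow> real^2 \<Rightarrow> real"
  assumes [measurable]: "Measurable.pred (borel \<Otimes>\<^sub>M borel) (\<lambda>p. C (fst p) (snd p))"
    and [measurable]: "(\<lambda>p. q (fst p) (snd p)) \<in> borel_measurable (borel \<Otimes>\<^sub>M borel)"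
    and bd: "\<And>y v. \<bar>q y v\<bar> \<le> 1"
    and C: "\<And>f y v. orthogonal_transformation f \<Longrightarrow> C (f y) (f v) \<longleftrightarrow> C y v"
    and q: "\<And>f y v. orthogonal_transformation f \<Longrightarrow> q (f y) (f v) = q y v"
    and p: "\<And>x. p x = measure (uniform_disc (rad_s P)) {v. C (x *\<^sub>R axis 1 1) v}"
    and H: "\<And>x. 0 < x \<Longrightarrow> H x = (\<integral>v. (if C (x *\<^sub>R axis 1 1) v then q (x *\<^sub>R axis 1 1) v else 0) \<partial>uniform_disc (rad_s P))"
    and k: "1 \<le> k"
  shows "(\<integral>\<omega>. (if card {j \<in> users. C (rep_ctr P N \<omega>) (usr N (n_hot P) j \<omega>)} = k \<and> C (rep_ctr P N \<omega>) (typ_off P N \<omega>)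
        then q (rep_ctr P N \<omega>) (typ_off P N \<omega>) else 0) \<partial>prb N)
    = real ((n_usr P - 1) choose (k - 1)) *
      (LBINT x:{0..rad P - rad_s P}. H x * p x ^ (k - 1) * (1 - p x) ^ (n_usr P - k) * f_X P x)"
proof -
  let ?U = "uniform_disc (rad_s P)" and ?Y = "uniform_disc (rad P - rad_s P)"
  let ?PU = "PiM users (\<lambda>_. ?U)"
  have R: "0 < rad P - rad_s P" using pos by simp
  interpret U: prob_space ?U by (rule prob_space_uniform_disc[OF pos(1)])
  interpret Y: prob_space ?Y by (rule prob_space_uniform_disc[OF R])
  interpret PU: prob_space ?PU by (rule prob_space_PiM) (rule U.prob_space_axioms)
  interpret YPU: pair_prob_space ?Y ?PU ..
  define F where "F = (\<lambda>(y, v). if card {j \<in> users. C y (v j)} = k \<and> C y (v (typ_usr N)) then q y (v (typ_usr N)) else (0::real))"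
  define A where "A x = (\<integral>v. (if C (x *\<^sub>R axis 1 1) v then 1 else (0::real)) \<partial>?U)" for x
  \<comment> \<open>\<open>H\<close> is prescribed for positive distances only. Its extension
    \<open>h\<close> by the defining integral is measurable everywhere, and the two agree wherever
    the density \<open>f_X\<close> is nonzero.\<close>
  define h where "h x = (\<integral>v. (if C (x *\<^sub>R axis 1 1) v then q (x *\<^sub>R axis 1 1) v else 0) \<partial>?U)" for x
  have [measurable]: "(\<lambda>v. v j) \<in> measurable (PiM users (\<lambda>_. borel)) borel" if "j \<in> users" for j
    using that by (rule measurable_component_singleton)
  note [measurable] = this[OF typ_in_users]
  have ind: "(if C y v then 1 else (0::real)) = indicator {v. C y v} v" for y v
    by (simp add: indicator_def)
  have Cm[measurable]: "Measurable.pred M (\<lambda>x. C (f x) (g x))" if [measurable]: "f \<in> borel_measurable M" "g \<in> borel_measurable M" for f g and M :: "'c measure"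
    using measurable_compose[OF measurable_Pair[OF that] assms(1)] by simp
  have qm[measurable]: "(\<lambda>x. q (f x) (g x)) \<in> borel_measurable M" if [measurable]: "f \<in> borel_measurable M" "g \<in> borel_measurable M" for f g and M :: "'c measure"
    using measurable_compose[OF measurable_Pair[OF that] assms(2)] by simp
  note [measurable] = pred_card_users[OF assms(1), of k]
  have Fm[measurable]: "F \<in> borel_measurable loc_space"
    unfolding F_def case_prod_beta' by measurable
  have Fb: "\<bar>F x\<bar> \<le> 1" for x
    using bd by (auto simp: F_def split: prod.split)
  have sets_eq: "sets (?Y \<Otimes>\<^sub>M ?PU) = sets loc_space"
    by (intro sets_pair_measure_cong sets_PiM_cong) auto
  have Fm': "F \<in> borel_measurable (?Y \<Otimes>\<^sub>M ?PU)"
    using Fm by (simp add: measurable_cong_sets[OF sets_eq refl])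
  have "F (rep_loc \<omega>) = (if card {j \<in> users. C (rep_ctr P N \<omega>) (usr N (n_hot P) j \<omega>)} = k \<and> C (rep_ctr P N \<omega>) (typ_off P N \<omega>)
        then q (rep_ctr P N \<omega>) (typ_off P N \<omega>) else 0)" for \<omega>
    using typ_in_users by (simp add: F_def rep_loc_def typ_off_def cong: conj_cong)
  then have "(\<integral>\<omega>. (if card {j \<in> users. C (rep_ctr P N \<omega>) (usr N (n_hot P) j \<omega>)} = k \<and> C (rep_ctr P N \<omega>) (typ_off P N \<omega>)
        then q (rep_ctr P N \<omega>) (typ_off P N \<omega>) else 0) \<partial>prb N) = (\<integral>\<omega>. F (rep_loc \<omega>) \<partial>prb N)"
    by simp
  also have "\<dots> = (\<integral>x. F x \<partial>(?Y \<Otimes>\<^sub>M ?PU))"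
    unfolding distr_rep_loc[symmetric] by (rule integral_distr[OF rep_loc_measurable Fm, symmetric])
  also have "\<dots> = (\<integral>y. (\<integral>v. F (y, v) \<partial>?PU) \<partial>?Y)"
    by (rule YPU.integral_fst'[symmetric]) (rule YPU.integrable_const_bound[where B = 1]; use Fm' Fb in auto)
  also have "\<dots> = (\<integral>y. real ((n_usr P - 1) choose (k - 1)) * (h (norm y) * A (norm y) ^ (k - 1) * (1 - A (norm y)) ^ (n_usr P - k)) \<partial>?Y)"
  proof (intro Bochner_Integration.integral_cong refl)
    fix y :: "real^2"
    let ?q = "\<lambda>v. if C y v then q y v else 0"
    have "?q \<in> borel_measurable borel" by measurable
    then have qy: "?q \<in> borel_measurable ?U" by (simp add: measurable_cong_sets[OF sets_uniform_disc refl])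
    have "{v \<in> space borel. C y v} \<in> sets borel" by measurable
    then have Cy[measurable]: "{v. C y v} \<in> sets ?U" by simp
    have "(\<integral>v. F (y, v) \<partial>?PU) = (\<integral>v. (if card {j \<in> users. v j \<in> {v. C y v}} = k then ?q (v (typ_usr N)) else 0) \<partial>?PU)"
      by (intro Bochner_Integration.integral_cong) (auto simp: F_def)
    also have "\<dots> = real ((card users - 1) choose (k - 1)) * measure ?U {v. C y v} ^ (k - 1)
        * (1 - measure ?U {v. C y v}) ^ (card users - k) * (\<integral>v. ?q v \<partial>?U)"
      using typ_in_users bd k qy Cy
      by (intro integral_PiM_count[where B = 1] U.prob_space_axioms) auto
    also have "(\<integral>v. ?q v \<partial>?U) = h (norm y)"
      unfolding h_def by (rule integral_uniform_disc_rotate[OF pos(1)]) (auto simp: C q)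
    \<comment> \<open>Written as an integral, the success probability falls under the same rotation
      argument as the average of \<open>q\<close>.\<close>
    also have "measure ?U {v. C y v} = (\<integral>v. (if C y v then 1 else (0::real)) \<partial>?U)"
      unfolding ind by simp
    also have "\<dots> = A (norm y)"
      unfolding A_def by (rule integral_uniform_disc_rotate[OF pos(1)]) (auto simp: C)
    finally show "(\<integral>v. F (y, v) \<partial>?PU) = real ((n_usr P - 1) choose (k - 1)) * (h (norm y) * A (norm y) ^ (k - 1) * (1 - A (norm y)) ^ (n_usr P - k))"
      by (simp add: mult_ac)
  qed
  also have "\<dots> = real ((n_usr P - 1) choose (k - 1)) * (\<integral>y. h (norm y) * A (norm y) ^ (k - 1) * (1 - A (norm y)) ^ (n_usr P - k) \<partial>?Y)"
    by simp
  also have "(\<integral>y. h (norm y) * A (norm y) ^ (k - 1) * (1 - A (norm y)) ^ (n_usr P - k) \<partial>?Y)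
      = (LBINT x. h x * A x ^ (k - 1) * (1 - A x) ^ (n_usr P - k) * radial_density (rad P - rad_s P) x)"
  proof (rule integral_uniform_disc_norm[OF R])
    have [measurable]: "A \<in> borel_measurable borel" "h \<in> borel_measurable borel"
      unfolding A_def h_def by measurable
    show "(\<lambda>x. h x * A x ^ (k - 1) * (1 - A x) ^ (n_usr P - k)) \<in> borel_measurable borel"
      by measurable
    fix x
    note mU = measurable_cong_sets[OF sets_uniform_disc refl]
    have "(\<lambda>v. if C (x *\<^sub>R axis 1 1) v then 1 else (0::real)) \<in> borel_measurable borel"
      "(\<lambda>v. \<bar>if C (x *\<^sub>R axis 1 1) v then q (x *\<^sub>R axis 1 1) v else 0\<bar>) \<in> borel_measurable borel"
      by measurable
    note m = this[folded mU[of "rad_s P"]]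
    have A: "0 \<le> A x" "A x \<le> 1"
      unfolding A_def
      using m(1) by (auto intro!: U.integral_le_const U.integrable_const_bound[where B = 1])
    have "\<bar>h x\<bar> \<le> (\<integral>v. \<bar>if C (x *\<^sub>R axis 1 1) v then q (x *\<^sub>R axis 1 1) v else 0\<bar> \<partial>?U)"
      unfolding h_def by (rule integral_abs_bound)
    also have "\<dots> \<le> 1"
      using bd m(2) by (intro U.integral_le_const U.integrable_const_bound[where B = 1]) auto
    finally have h: "\<bar>h x\<bar> \<le> 1" .
    have "\<bar>h x\<bar> * \<bar>A x ^ (k - 1)\<bar> * \<bar>(1 - A x) ^ (n_usr P - k)\<bar> \<le> 1"
      using A h by (intro mult_le_one) (auto simp: power_abs power_le_one)
    then show "\<bar>h x * A x ^ (k - 1) * (1 - A x) ^ (n_usr P - k)\<bar> \<le> 1"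
      by (simp add: abs_mult)
  qed
  also have "\<dots> = (LBINT x:{0..rad P - rad_s P}. H x * p x ^ (k - 1) * (1 - p x) ^ (n_usr P - k) * f_X P x)"
    unfolding set_lebesgue_integral_def
  proof (intro Bochner_Integration.integral_cong refl)
    fix x
    have "p x = A x"
      unfolding p A_def ind by simp
    then show "h x * A x ^ (k - 1) * (1 - A x) ^ (n_usr P - k) * radial_density (rad P - rad_s P) x
      = indicator {0..rad P - rad_s P} x *\<^sub>R (H x * p x ^ (k - 1) * (1 - p x) ^ (n_usr P - k) * f_X P x)"
      using H[of x] by (auto simp: f_X_eq[OF params] h_def radial_density_def)
  qed
  finally show ?thesis .
qed

end

section \<open>Links given the locations\<close>

text \<open>An indicator density restricts a measure to an event while keeping its space and
  sigma-algebra.\<close>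

lemma emeasure_density_indicator:
  assumes "S \<in> sets M" "X \<in> sets M"
  shows "emeasure (density M (indicator S)) X = emeasure M (S \<inter> X)"
proof -
  have "emeasure (density M (indicator S)) X = (\<integral>\<^sup>+ x. indicator S x * indicator X x \<partial>M)"
    using assms by (intro emeasure_density) auto
  also have "\<dots> = (\<integral>\<^sup>+ x. indicator (S \<inter> X) x \<partial>M)"
    by (simp only: indicator_inter_arith)
  finally show ?thesis
    using assms by simp
qed

context cellular_network
begin

text \<open>Link lengths as functions on the space of locations, so that statements about them can
  be transferred along \<open>rep_loc\<close>.\<close>

fun len :: "link \<Rightarrow> (real^2) \<times> (nat \<Rightarrow> real^2) \<Rightarrow> real" where
  "len Backhaul p = norm (fst p)"
| "len Access_SBS p = norm (snd p (typ_usr N))"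
| "len Access_ABS p = norm (fst p + snd p (typ_usr N))"

lemma link_length_eq: "link_length P N l \<omega> = len l (rep_loc \<omega>)"
  using typ_in_users by (cases l) (auto simp: rep_loc_def typ_off_def)

lemma len_nonneg: "0 \<le> len l p"
  by (cases l) auto

lemma measurable_typ [measurable]: "(\<lambda>p. snd p (typ_usr N)) \<in> borel_measurable loc_space"
  using typ_in_users by (intro measurable_compose[OF measurable_snd measurable_component_singleton])

lemma borel_measurable_len [measurable]: "len l \<in> borel_measurable loc_space"
proof -
  have "(\<lambda>p. norm (fst p)) \<in> borel_measurable loc_space"
    "(\<lambda>p. norm (snd p (typ_usr N))) \<in> borel_measurable loc_space"
    "(\<lambda>p. norm (fst p + snd p (typ_usr N))) \<in> borel_measurable loc_space"
    by measurable
  then show ?thesis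
    by (cases l) (simp_all only: len.simps[abs_def])
qed

definition state_prob :: "bool \<Rightarrow> real \<Rightarrow> real" where
  "state_prob b r = (if b then p_los P r else 1 - p_los P r)"

definition fading :: "bool \<Rightarrow> real measure" where
  "fading b = fading_law (if b then fad_los P else fad_nlos P)"

lemma link_prob_eq: "link_prob P r b B = state_prob b r * measure (fading b) B"
  by (simp add: link_prob_def state_prob_def fading_def)

lemma state_prob_bounds: "0 \<le> r \<Longrightarrow> 0 \<le> state_prob b r \<and> state_prob b r \<le> 1"
  using p_los_bounds[OF params] by (auto simp: state_prob_def)

lemma borel_measurable_state_prob [measurable]: "state_prob b \<in> borel_measurable borel"
  unfolding state_prob_def p_los_def by (cases b) auto

lemma prob_space_fading: "prob_space (fading b)"
  using pos by (simp add: fading_def prob_space_fading_law)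

lemma sets_fading [simp, measurable_cong]: "sets (fading b) = sets borel"
  by (simp add: fading_def)

lemma link_state_measurable [measurable]: "Measurable.pred (prb N) (\<lambda>\<omega>. los N l \<omega> = b)"
  using los_measurable[of l] by measurable

lemmas fad_measurable [measurable]

lemma all_link: "(\<forall>l. Q l) \<longleftrightarrow> Q Backhaul \<and> Q Access_SBS \<and> Q Access_ABS"
  using link.exhaust by metis

text \<open>The conditional probability is integrated over a location event, by the defining
  property of conditional expectation. The sets \<open>B l\<close> are constants here, so thresholds
  that move with the locations are still out of reach.\<close>

lemma link_rectangle:
  assumes A: "A \<in> sets loc_space" and B: "\<And>l. B l \<in> sets borel"
  shows "prob {\<omega> \<in> space (prb N). rep_loc \<omega> \<in> A \<and> (\<forall>l. los N l \<omega> = s l \<and> fad N l \<omega> \<in> B l)}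
    = (\<integral>\<omega>. indicator A (rep_loc \<omega>) * (\<Prod>l\<in>UNIV. link_prob P (len l (rep_loc \<omega>)) (s l) (B l)) \<partial>prb N)"
proof -
  interpret F: finite_measure_subalgebra "prb N" "loc_sigma P N"
    by (standard) (rule loc_subalgebra)
  let ?E = "{\<omega> \<in> space (prb N). \<forall>l. los N l \<omega> = s l \<and> fad N l \<omega> \<in> B l}"
  let ?A = "rep_loc -` A \<inter> space (prb N)"
  have E[measurable]: "?E \<in> sets (prb N)"
    unfolding all_link using B by measurable
  have "space (loc_sigma P N) = space (prb N)"
    by (simp add: loc_sigma_def)
  then have AF: "?A \<in> sets (loc_sigma P N)"
    using measurable_sets[OF rep_loc_measurable_loc_sigma A] by simp
  then have AM[measurable]: "?A \<in> sets (prb N)"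
    using loc_subalgebra by (auto simp: subalgebra_def)
  have "prob {\<omega> \<in> space (prb N). rep_loc \<omega> \<in> A \<and> (\<forall>l. los N l \<omega> = s l \<and> fad N l \<omega> \<in> B l)}
      = prob (?A \<inter> ?E)"
    by (intro arg_cong[where f = prob]) auto
  also have "\<dots> = (\<integral>\<omega>. indicator (?A \<inter> ?E) \<omega> \<partial>prb N)"
    by simp
  also have "\<dots> = (\<integral>\<omega>\<in>?A. indicator ?E \<omega> \<partial>prb N)"
    unfolding set_lebesgue_integral_def by (intro Bochner_Integration.integral_cong) (auto simp: indicator_def)
  also have "\<dots> = (\<integral>\<omega>\<in>?A. real_cond_exp (prb N) (loc_sigma P N) (indicator ?E) \<omega> \<partial>prb N)"
    by (rule F.real_cond_exp_intA[OF integrable_real_indicator[OF E] AF]) (simp add: emeasure_eq_measure)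
  also have "\<dots> = (\<integral>\<omega>. indicator A (rep_loc \<omega>) * (\<Prod>l\<in>UNIV. link_prob P (len l (rep_loc \<omega>)) (s l) (B l)) \<partial>prb N)"
    unfolding set_lebesgue_integral_def
  proof (rule integral_cong_AE)
    show "AE \<omega> in prb N. indicator ?A \<omega> *\<^sub>R real_cond_exp (prb N) (loc_sigma P N) (indicator ?E) \<omega>
        = indicator A (rep_loc \<omega>) * (\<Prod>l\<in>UNIV. link_prob P (len l (rep_loc \<omega>)) (s l) (B l))"
      using link_law[of B s, OF B] AE_space
    proof eventually_elim
      case (elim \<omega>)
      then show ?case by (simp add: indicator_def link_length_eq UNIV_link)
    qed
    show "(\<lambda>\<omega>. indicator A (rep_loc \<omega>) * (\<Prod>l\<in>UNIV. link_prob P (len l (rep_loc \<omega>)) (s l) (B l))) \<in> borel_measurable (prb N)"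
      unfolding link_prob_eq using A by measurable
  qed measurable
  finally show ?thesis .
qed

section \<open>Joint measure of locations and gains for a fixed LOS configuration\<close>

definition state_weight :: "(link \<Rightarrow> bool) \<Rightarrow> (real^2) \<times> (nat \<Rightarrow> real^2) \<Rightarrow> real" where
  "state_weight s p = (\<Prod>l\<in>UNIV. state_prob (s l) (len l p))"

lemma borel_measurable_state_weight [measurable]: "state_weight s \<in> borel_measurable loc_space"
  unfolding state_weight_def[abs_def] by measurable

lemma state_weight_bounds: "0 \<le> state_weight s p \<and> state_weight s p \<le> 1"
proof -
  have "0 \<le> state_prob (s l) (len l p) \<and> state_prob (s l) (len l p) \<le> 1" for l
    by (rule state_prob_bounds[OF len_nonneg])
  then show ?thesis
    unfolding state_weight_def by (simp add: prod_nonneg prod_le_1)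
qed

text \<open>A sub-probability measure: the event of the LOS configuration \<open>s\<close> is
  imposed without normalisation, so that events can be summed over \<open>s\<close>
  afterwards.\<close>

definition link_joint :: "(link \<Rightarrow> bool) \<Rightarrow> (((real^2) \<times> (nat \<Rightarrow> real^2)) \<times> (link \<Rightarrow> real)) measure" where
  "link_joint s = distr (density (prb N) (indicator {\<omega> \<in> space (prb N). \<forall>l. los N l \<omega> = s l}))
     (loc_space \<Otimes>\<^sub>M PiM UNIV (\<lambda>_. borel)) (\<lambda>\<omega>. (rep_loc \<omega>, \<lambda>l. fad N l \<omega>))"

lemma fad_tuple_measurable [measurable]: "(\<lambda>\<omega> l. fad N l \<omega>) \<in> measurable (prb N) (PiM UNIV (\<lambda>_. borel))"
proof -
  have "(\<lambda>\<omega>. \<lambda>l\<in>UNIV. fad N l \<omega>) \<in> measurable (prb N) (PiM UNIV (\<lambda>_. borel))"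
    by (rule measurable_restrict) (rule fad_measurable)
  then show ?thesis by (simp add: restrict_UNIV)
qed

lemma los_event [measurable]: "{\<omega> \<in> space (prb N). \<forall>l. los N l \<omega> = s l} \<in> sets (prb N)"
  unfolding all_link by measurable

lemma emeasure_link_joint:
  assumes "C \<in> sets (loc_space \<Otimes>\<^sub>M PiM UNIV (\<lambda>_. borel))"
  shows "emeasure (link_joint s) C
    = prob {\<omega> \<in> space (prb N). (\<forall>l. los N l \<omega> = s l) \<and> (rep_loc \<omega>, \<lambda>l. fad N l \<omega>) \<in> C}"
proof -
  have m: "(\<lambda>\<omega>. (rep_loc \<omega>, \<lambda>l. fad N l \<omega>)) \<in> measurable (prb N) (loc_space \<Otimes>\<^sub>M PiM UNIV (\<lambda>_. borel))"
    by (rule measurable_Pair[OF rep_loc_measurable fad_tuple_measurable])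
  note C = measurable_sets[OF m assms]
  have "emeasure (link_joint s) C
      = emeasure (density (prb N) (indicator {\<omega> \<in> space (prb N). \<forall>l. los N l \<omega> = s l}))
          ((\<lambda>\<omega>. (rep_loc \<omega>, \<lambda>l. fad N l \<omega>)) -` C \<inter> space (prb N))"
    unfolding link_joint_def using m assms by (subst emeasure_distr) auto
  also have "\<dots> = emeasure (prb N) ({\<omega> \<in> space (prb N). \<forall>l. los N l \<omega> = s l}
      \<inter> ((\<lambda>\<omega>. (rep_loc \<omega>, \<lambda>l. fad N l \<omega>)) -` C \<inter> space (prb N)))"
    by (rule emeasure_density_indicator[OF los_event C])
  also have "\<dots> = prob {\<omega> \<in> space (prb N). (\<forall>l. los N l \<omega> = s l) \<and> (rep_loc \<omega>, \<lambda>l. fad N l \<omega>) \<in> C}"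
    unfolding emeasure_eq_measure by (intro arg_cong[where f = "\<lambda>S. ennreal (prob S)"]) auto
  finally show ?thesis .
qed

text \<open>Equality has to be tested on products of a location set with an arbitrary measurable set
  of gain vectors, but \<open>link_rectangle\<close> only covers boxes of gains. For a fixed
  location set, both sides are finite measures in the gain vector that agree on boxes, hence agree
  everywhere.\<close>

lemma link_joint_eq:
  "link_joint s = density (distr (prb N) loc_space rep_loc) (\<lambda>p. ennreal (state_weight s p))
     \<Otimes>\<^sub>M PiM UNIV (\<lambda>l. fading (s l))"
proof -
  let ?D = "density (distr (prb N) loc_space rep_loc) (\<lambda>p. ennreal (state_weight s p))"
  let ?F = "PiM UNIV (\<lambda>l. fading (s l))"
  let ?P = "PiM UNIV (\<lambda>_. borel) :: (link \<Rightarrow> real) measure"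
  interpret F: prob_space "fading b" for b by (rule prob_space_fading)
  interpret PP: product_prob_space "\<lambda>l. fading (s l)" UNIV ..
  have setsF: "sets ?F = sets ?P"
    by (intro sets_PiM_cong) auto
  have setsJ: "sets (link_joint s) = sets (loc_space \<Otimes>\<^sub>M ?P)"
    by (simp add: link_joint_def)
  have setsD: "sets ?D = sets loc_space"
    by simp
  have D: "emeasure ?D A = ennreal (\<integral>\<omega>. indicator A (rep_loc \<omega>) * state_weight s (rep_loc \<omega>) \<partial>prb N)"
    if A: "A \<in> sets loc_space" for A
  proof -
    note [measurable] = A
    have "emeasure ?D A = (\<integral>\<^sup>+ p. ennreal (state_weight s p) * indicator A p \<partial>distr (prb N) loc_space rep_loc)"
      by (subst emeasure_density) (use A in \<open>auto simp del: One_nat_def\<close>)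
    also have "\<dots> = (\<integral>\<^sup>+ \<omega>. ennreal (state_weight s (rep_loc \<omega>)) * indicator A (rep_loc \<omega>) \<partial>prb N)"
      by (rule nn_integral_distr) measurable
    also have "\<dots> = (\<integral>\<^sup>+ \<omega>. ennreal (indicator A (rep_loc \<omega>) * state_weight s (rep_loc \<omega>)) \<partial>prb N)"
      by (intro nn_integral_cong) (auto simp: indicator_def)
    also have "\<dots> = ennreal (\<integral>\<omega>. indicator A (rep_loc \<omega>) * state_weight s (rep_loc \<omega>) \<partial>prb N)"
    proof (rule nn_integral_eq_integral)
      show "integrable (prb N) (\<lambda>\<omega>. indicator A (rep_loc \<omega>) * state_weight s (rep_loc \<omega>))"
      proof (rule integrable_const_bound[where B = 1])
        show "(\<lambda>\<omega>. indicator A (rep_loc \<omega>) * state_weight s (rep_loc \<omega>)) \<in> borel_measurable (prb N)"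
          by measurable
      qed (use state_weight_bounds in \<open>auto simp: indicator_def\<close>)
    qed (use state_weight_bounds in \<open>auto simp: indicator_def\<close>)
    finally show ?thesis .
  qed
  have "emeasure ?D A * emeasure ?F B = emeasure (link_joint s) (A \<times> B)"
    if A: "A \<in> sets ?D" and B: "B \<in> sets ?F" for A B
  proof -
    have A': "A \<in> sets loc_space" using A by simp
    have B': "B \<in> sets ?P" using B setsF by simp
    have S: "A \<times> space ?P \<in> sets (link_joint s)"
      unfolding setsJ using A' by (intro pair_measureI) auto
    \<comment> \<open>The mass of \<open>A\<close> under the weighted location law, which is the
      predicted factor of the slice over \<open>A\<close>.\<close>
    define c where "c = (\<integral>\<omega>. indicator A (rep_loc \<omega>) * state_weight s (rep_loc \<omega>) \<partial>prb N)"
    have c0: "0 \<le> c"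
      unfolding c_def using state_weight_bounds by (intro Bochner_Integration.integral_nonneg) auto
    \<comment> \<open>The slice over \<open>A\<close>, as a measure in the gain vector alone: it
      sends \<open>Z\<close> to the joint measure of \<open>A \<times> Z\<close>.\<close>
    let ?Q = "distr (density (link_joint s) (indicator (A \<times> space ?P))) ?P snd"
    have Q: "emeasure ?Q Z = emeasure (link_joint s) (A \<times> Z)" if Z: "Z \<in> sets ?P" for Z
    proof -
      have sm: "snd \<in> measurable (density (link_joint s) (indicator (A \<times> space ?P))) ?P"
        using measurable_snd[of loc_space ?P] by (simp add: measurable_cong_sets[OF setsJ refl])
      have "emeasure ?Q Z = emeasure (density (link_joint s) (indicator (A \<times> space ?P))) (snd -` Z \<inter> space (link_joint s))"
        by (subst emeasure_distr[OF sm Z]) simp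
      also have "\<dots> = emeasure (link_joint s) ((A \<times> space ?P) \<inter> (snd -` Z \<inter> space (link_joint s)))"
        using measurable_sets[OF sm Z] by (intro emeasure_density_indicator[OF S]) simp
      also have "(A \<times> space ?P) \<inter> (snd -` Z \<inter> space (link_joint s)) = A \<times> Z"
        using sets.sets_into_space[OF A'] sets.sets_into_space[OF Z] sets_eq_imp_space_eq[OF setsJ]
        by (auto simp: space_pair_measure)
      finally show ?thesis .
    qed
    \<comment> \<open>Uniqueness on boxes requires an exhausting sequence of boxes of finite mass;
      the constant sequence of the whole space serves, since the total mass is
      \<open>c\<close>.\<close>
    have "scale_measure (ennreal c) ?F = ?Q"
    proof (rule measure_eqI_PiM_finite[where I = UNIV and M = "\<lambda>_. borel"])
      show "sets (scale_measure (ennreal c) ?F) = sets ?P" "sets ?Q = sets ?P"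
        using setsF by auto
      fix Z :: "link \<Rightarrow> real set" assume "\<And>l. l \<in> UNIV \<Longrightarrow> Z l \<in> sets borel"
      then have Z: "Z l \<in> sets borel" for l by simp
      have ZP: "PiE UNIV Z \<in> sets ?P"
        using Z by (intro sets_PiM_I_finite) auto
      have "emeasure ?Q (PiE UNIV Z) = ennreal (prob {\<omega> \<in> space (prb N). (\<forall>l. los N l \<omega> = s l)
          \<and> (rep_loc \<omega>, \<lambda>l. fad N l \<omega>) \<in> A \<times> PiE UNIV Z})"
        using A' ZP by (subst Q[OF ZP], subst emeasure_link_joint) auto
      also have "{\<omega> \<in> space (prb N). (\<forall>l. los N l \<omega> = s l) \<and> (rep_loc \<omega>, \<lambda>l. fad N l \<omega>) \<in> A \<times> PiE UNIV Z}
          = {\<omega> \<in> space (prb N). rep_loc \<omega> \<in> A \<and> (\<forall>l. los N l \<omega> = s l \<and> fad N l \<omega> \<in> Z l)}"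
        by auto
      also have "prob \<dots> = (\<integral>\<omega>. indicator A (rep_loc \<omega>) * (\<Prod>l\<in>UNIV. link_prob P (len l (rep_loc \<omega>)) (s l) (Z l)) \<partial>prb N)"
        by (rule link_rectangle[OF A' Z])
      also have "\<dots> = (\<integral>\<omega>. indicator A (rep_loc \<omega>) * state_weight s (rep_loc \<omega>) * (\<Prod>l\<in>UNIV. measure (fading (s l)) (Z l)) \<partial>prb N)"
        by (simp add: link_prob_eq state_weight_def prod.distrib mult_ac)
      also have "\<dots> = c * (\<Prod>l\<in>UNIV. measure (fading (s l)) (Z l))"
        by (simp add: c_def)
      also have "ennreal \<dots> = ennreal c * (\<Prod>l\<in>UNIV. emeasure (fading (s l)) (Z l))"
        using c0 by (simp add: ennreal_mult' F.emeasure_eq_measure prod_ennreal prod_nonneg)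
      also have "\<dots> = emeasure (scale_measure (ennreal c) ?F) (PiE UNIV Z)"
        using Z by (subst emeasure_scale_measure, subst PP.emeasure_PiM) auto
      finally show "emeasure (scale_measure (ennreal c) ?F) (PiE UNIV Z) = emeasure ?Q (PiE UNIV Z)" ..
    next
      show "range (\<lambda>_::nat. space ?P) \<subseteq> prod_algebra UNIV (\<lambda>_. borel)"
        using prod_algebraI_finite[of "UNIV :: link set" "\<lambda>_. UNIV" "\<lambda>_. borel :: real measure"] by (auto simp: space_PiM)
      show "(\<Union>i::nat. space ?P) = space ?P" by simp
      show "emeasure (scale_measure (ennreal c) ?F) (space ?P) \<noteq> \<infinity>"
        using PP.P.emeasure_space_1 sets_eq_imp_space_eq[OF setsF]
        by (simp add: emeasure_scale_measure)
    qed simp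
    then have "emeasure (link_joint s) (A \<times> B) = emeasure (scale_measure (ennreal c) ?F) B"
      using Q[OF B'] by simp
    then show ?thesis
      unfolding D[OF A'] by (simp add: emeasure_scale_measure c_def)
  qed
  moreover have "sets (?D \<Otimes>\<^sub>M ?F) = sets (link_joint s)"
    unfolding setsJ by (intro sets_pair_measure_cong setsF setsD)
  moreover have "sigma_finite_measure ?D"
  proof (intro finite_measure.axioms(1) finite_measureI)
    have "space ?D \<in> sets loc_space" using sets.top[of ?D] by simp
    from D[OF this] show "emeasure ?D (space ?D) \<noteq> \<infinity>" by simp
  qed
  ultimately show ?thesis
    by (intro pair_measure_eqI[symmetric] PP.P.sigma_finite_measure_axioms)
qed

section \<open>Thresholds that depend on the locations\<close>

lemma link_prob_bounds: "0 \<le> link_prob P (len l p) b B \<and> link_prob P (len l p) b B \<le> 1"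
proof -
  interpret F: prob_space "fading b" by (rule prob_space_fading)
  show ?thesis
    using state_prob_bounds[OF len_nonneg[of l p], of b] F.prob_le_1
    by (auto simp: link_prob_eq intro!: mult_le_one)
qed

lemma link_prob_prod_bounds:
  "0 \<le> (\<Prod>l\<in>UNIV. link_prob P (len l p) (s l) (B l))"
  "(\<Prod>l\<in>UNIV. link_prob P (len l p) (s l) (B l)) \<le> 1"
  using link_prob_bounds by (simp_all add: prod_nonneg prod_le_1)

lemma measurable_fading_exceeds:
  assumes [measurable]: "g \<in> borel_measurable M"
  shows "(\<lambda>p. measure (fading b) {h. g p < ereal h}) \<in> borel_measurable M"
  using measurable_compose[OF assms borel_measurable_F_h] pos by (simp add: F_h_def fading_def)

text \<open>By the product form of \<open>link_joint\<close>, the section of the event at a location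
  \<open>p\<close> is a box of half-lines with thresholds frozen at \<open>p\<close>. Its mass is
  the product of the three tails, and the state weight turns these into link probabilities.\<close>

lemma prob_link_state_thresholds:
  assumes A[measurable]: "A \<in> sets loc_space" and g[measurable]: "\<And>l. g l \<in> borel_measurable loc_space"
  shows "prob {\<omega> \<in> space (prb N). rep_loc \<omega> \<in> A \<and> (\<forall>l. los N l \<omega> = s l \<and> g l (rep_loc \<omega>) < ereal (fad N l \<omega>))}
    = (\<integral>\<omega>. indicator A (rep_loc \<omega>) *
        (\<Prod>l\<in>UNIV. link_prob P (len l (rep_loc \<omega>)) (s l) {h. g l (rep_loc \<omega>) < ereal h}) \<partial>prb N)"
proof -
  let ?D = "density (distr (prb N) loc_space rep_loc) (\<lambda>p. ennreal (state_weight s p))"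
  let ?F = "PiM UNIV (\<lambda>l. fading (s l))"
  let ?P = "PiM UNIV (\<lambda>_. borel) :: (link \<Rightarrow> real) measure"
  interpret F: prob_space "fading b" for b by (rule prob_space_fading)
  interpret PP: product_prob_space "\<lambda>l. fading (s l)" UNIV ..
  let ?C = "{z \<in> space (loc_space \<Otimes>\<^sub>M ?P). fst z \<in> A \<and> (\<forall>l. g l (fst z) < ereal (snd z l))}"
  let ?H = "\<lambda>p. ennreal (indicator A p * (\<Prod>l\<in>UNIV. link_prob P (len l p) (s l) {h. g l p < ereal h}))"
  have [measurable]: "(\<lambda>f. f l) \<in> measurable ?P borel" for l
    by (rule measurable_component_singleton) simp
  have C: "?C \<in> sets (loc_space \<Otimes>\<^sub>M ?P)"
    unfolding all_link by measurable
  have setsDF: "sets (?D \<Otimes>\<^sub>M ?F) = sets (loc_space \<Otimes>\<^sub>M ?P)"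
    by (intro sets_pair_measure_cong sets_PiM_cong) auto
  have meas: "(\<lambda>p. measure (fading b) {h. g l p < ereal h}) \<in> borel_measurable loc_space" for l b
    by (rule measurable_fading_exceeds[OF g])
  note [measurable] = meas
  have "ennreal (prob {\<omega> \<in> space (prb N). rep_loc \<omega> \<in> A \<and> (\<forall>l. los N l \<omega> = s l \<and> g l (rep_loc \<omega>) < ereal (fad N l \<omega>))})
      = ennreal (prob {\<omega> \<in> space (prb N). (\<forall>l. los N l \<omega> = s l) \<and> (rep_loc \<omega>, \<lambda>l. fad N l \<omega>) \<in> ?C})"
    using measurable_space[OF rep_loc_measurable]
    by (intro arg_cong[where f = "\<lambda>S. ennreal (prob S)"]) (auto simp: space_pair_measure space_PiM)
  also have "\<dots> = emeasure (link_joint s) ?C"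
    by (rule emeasure_link_joint[OF C, symmetric])
  also have "\<dots> = (\<integral>\<^sup>+ p. emeasure ?F (Pair p -` ?C) \<partial>?D)"
    unfolding link_joint_eq using C setsDF by (intro PP.P.emeasure_pair_measure_alt) auto
  also have "\<dots> = (\<integral>\<^sup>+ p. indicator A p * (\<Prod>l\<in>UNIV. ennreal (measure (fading (s l)) {h. g l p < ereal h})) \<partial>?D)"
  proof (rule nn_integral_cong)
    fix p assume "p \<in> space ?D"
    then have p: "p \<in> space loc_space" by simp
    have "Pair p -` ?C = (if p \<in> A then PiE UNIV (\<lambda>l. {h. g l p < ereal h}) else {})"
      using p by (auto simp: space_pair_measure space_PiM)
    moreover have "emeasure ?F (PiE UNIV (\<lambda>l. {h. g l p < ereal h})) = (\<Prod>l\<in>UNIV. emeasure (fading (s l)) {h. g l p < ereal h})"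
      by (rule PP.emeasure_PiM) auto
    ultimately show "emeasure ?F (Pair p -` ?C)
        = indicator A p * (\<Prod>l\<in>UNIV. ennreal (measure (fading (s l)) {h. g l p < ereal h}))"
      by (simp add: F.emeasure_eq_measure)
  qed
  also have "\<dots> = (\<integral>\<^sup>+ p. ennreal (state_weight s p) * (indicator A p * (\<Prod>l\<in>UNIV. ennreal (measure (fading (s l)) {h. g l p < ereal h})))
      \<partial>distr (prb N) loc_space rep_loc)"
  proof (rule nn_integral_density)
    show "(\<lambda>p. indicator A p * (\<Prod>l\<in>UNIV. ennreal (measure (fading (s l)) {h. g l p < ereal h})))
        \<in> borel_measurable (distr (prb N) loc_space rep_loc)"
      unfolding measurable_distr_eq1 by measurable
    show "(\<lambda>p. ennreal (state_weight s p)) \<in> borel_measurable (distr (prb N) loc_space rep_loc)"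
      unfolding measurable_distr_eq1 by measurable
  qed
  also have "\<dots> = (\<integral>\<^sup>+ p. ?H p \<partial>distr (prb N) loc_space rep_loc)"
    using state_weight_bounds
    by (intro nn_integral_cong)
       (auto simp: link_prob_eq state_weight_def prod.distrib ennreal_mult' prod_nonneg prod_ennreal indicator_def)
  also have "\<dots> = (\<integral>\<^sup>+ \<omega>. ?H (rep_loc \<omega>) \<partial>prb N)"
    unfolding link_prob_eq by (rule nn_integral_distr) measurable
  also have "\<dots> = ennreal (\<integral>\<omega>. indicator A (rep_loc \<omega>) *
        (\<Prod>l\<in>UNIV. link_prob P (len l (rep_loc \<omega>)) (s l) {h. g l (rep_loc \<omega>) < ereal h}) \<partial>prb N)"
  proof -
    have m: "(\<lambda>\<omega>. indicator A (rep_loc \<omega>) *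
        (\<Prod>l\<in>UNIV. link_prob P (len l (rep_loc \<omega>)) (s l) {h. g l (rep_loc \<omega>) < ereal h})) \<in> borel_measurable (prb N)"
      unfolding link_prob_eq by measurable
    show ?thesis
    proof (rule nn_integral_eq_integral)
      note pr = link_prob_prod_bounds
      show "integrable (prb N) (\<lambda>\<omega>. indicator A (rep_loc \<omega>) *
        (\<Prod>l\<in>UNIV. link_prob P (len l (rep_loc \<omega>)) (s l) {h. g l (rep_loc \<omega>) < ereal h}))"
        by (rule integrable_const_bound[where B = 1, OF _ m]) (use pr in \<open>auto simp: indicator_def\<close>)
    qed (use link_prob_prod_bounds in \<open>auto simp: indicator_def\<close>)
  qed
  finally show ?thesis
    by (subst (asm) ennreal_inj)
       (auto intro!: Bochner_Integration.integral_nonneg mult_nonneg_nonneg simp: link_prob_prod_bounds)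
qed

text \<open>The LOS vector splits the event into eight disjoint cases. Since each threshold depends
  on the state of its own link only, the sum of products over state vectors is a product of sums
  over states.\<close>

lemma prob_link_thresholds:
  assumes A[measurable]: "A \<in> sets loc_space" and g[measurable]: "\<And>l b. g l b \<in> borel_measurable loc_space"
  shows "prob {\<omega> \<in> space (prb N). rep_loc \<omega> \<in> A \<and> (\<forall>l. g l (los N l \<omega>) (rep_loc \<omega>) < ereal (fad N l \<omega>))}
    = (\<integral>\<omega>. indicator A (rep_loc \<omega>) *
        (\<Prod>l\<in>UNIV. \<Sum>b\<in>UNIV. link_prob P (len l (rep_loc \<omega>)) b {h. g l b (rep_loc \<omega>) < ereal h}) \<partial>prb N)"
proof -
  let ?E = "\<lambda>s. {\<omega> \<in> space (prb N). rep_loc \<omega> \<in> A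
    \<and> (\<forall>l. los N l \<omega> = s l \<and> g l (s l) (rep_loc \<omega>) < ereal (fad N l \<omega>))}"
  let ?h = "\<lambda>s \<omega>. indicator A (rep_loc \<omega>) *
        (\<Prod>l\<in>UNIV. link_prob P (len l (rep_loc \<omega>)) (s l) {h. g l (s l) (rep_loc \<omega>) < ereal h})"
  \<comment> \<open>The distributive law \<open>prod_sum_PiE\<close> ranges over extensional
    functions; on the full type of links these are all functions.\<close>
  have PiE_UNIV: "PiE (UNIV :: link set) (\<lambda>_. UNIV :: bool set) = UNIV"
    by auto
  have fin: "finite (UNIV :: (link \<Rightarrow> bool) set)"
    using finite_PiE[of "UNIV :: link set" "\<lambda>_. UNIV :: bool set"] by (simp add: PiE_UNIV)
  have E: "?E s \<in> events" for s
    unfolding all_link by measurable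
  have m: "?h s \<in> borel_measurable (prb N)" for s
  proof -
    note [measurable] = measurable_fading_exceeds[OF g]
    show ?thesis unfolding link_prob_eq by measurable
  qed
  have "prob {\<omega> \<in> space (prb N). rep_loc \<omega> \<in> A \<and> (\<forall>l. g l (los N l \<omega>) (rep_loc \<omega>) < ereal (fad N l \<omega>))}
      = prob (\<Union>s\<in>UNIV. ?E s)"
    by (intro arg_cong[where f = prob]) (auto simp: fun_eq_iff intro!: exI[of _ "\<lambda>l. los N l _"])
  also have "\<dots> = (\<Sum>s\<in>UNIV. prob (?E s))"
    using E by (intro finite_measure_finite_Union fin) (auto simp: disjoint_family_on_def fun_eq_iff)
  also have "\<dots> = (\<Sum>s\<in>UNIV. \<integral>\<omega>. ?h s \<omega> \<partial>prb N)"
    by (intro sum.cong refl prob_link_state_thresholds[OF A g])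
  also have "\<dots> = (\<integral>\<omega>. (\<Sum>s\<in>UNIV. ?h s \<omega>) \<partial>prb N)"
  proof (rule Bochner_Integration.integral_sum[symmetric])
    show "integrable (prb N) (?h s)" for s
      by (rule integrable_const_bound[where B = 1, OF _ m])
         (use link_prob_prod_bounds in \<open>auto simp: indicator_def\<close>)
  qed
  also have "\<dots> = (\<integral>\<omega>. indicator A (rep_loc \<omega>) *
        (\<Prod>l\<in>UNIV. \<Sum>b\<in>UNIV. link_prob P (len l (rep_loc \<omega>)) b {h. g l b (rep_loc \<omega>) < ereal h}) \<partial>prb N)"
    by (subst prod_sum_PiE) (auto simp: PiE_UNIV sum_distrib_left)
  finally show ?thesis .
qed

end

section \<open>Thresholds and loads\<close>

text \<open>For \<open>W > 0\<close> this is solving for \<open>h\<close>. For \<open>W = 0\<close>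
  the left side asks whether \<open>\<tau>\<close> is negative, and the threshold is infinite for
  positive \<open>\<tau>\<close> but \<open>- D / c\<close> for negative \<open>\<tau>\<close>,
  which every positive gain exceeds. At \<open>\<tau> = 0\<close> the two sides disagree:
  \<open>0 / 0 = 0\<close> gives the threshold 0, while \<open>0 < 0\<close> fails.\<close>

lemma rate_exceeds_iff:
  fixes W c D h \<tau> :: real
  assumes "0 < D" "0 < c" "0 < h" "0 \<le> W" "W = 0 \<Longrightarrow> \<tau> \<noteq> 0"
  shows "\<tau> < W * log 2 (1 + c * h / D) \<longleftrightarrow>
    ereal D * (exp2 (ereal \<tau> / ereal W) - 1) / ereal c < ereal h"
proof (cases "W = 0")
  case True
  then consider "0 < \<tau>" | "\<tau> < 0" using assms(5) by linarith
  then show ?thesis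
  proof cases
    case 1
    have "exp2 (ereal \<tau> / ereal W) - 1 = \<infinity>"
      using 1 True ereal_div_zero(1) by (simp add: exp2_def)
    then show ?thesis using 1 True assms by simp
  next
    case 2
    have "exp2 (ereal \<tau> / ereal W) - 1 = ereal (- 1)"
      using 2 True ereal_div_zero(2) by (simp add: exp2_def one_ereal_def zero_ereal_def)
    moreover have "- D / c < h"
      using assms by (smt (verit) divide_pos_pos minus_divide_left)
    ultimately show ?thesis using 2 True assms by simp
  qed
next
  case False
  then have W: "0 < W" using assms by simp
  have pos: "0 < 1 + c * h / D" using assms by (simp add: add_pos_pos)
  have "exp2 (ereal \<tau> / ereal W) - 1 = ereal (2 powr (\<tau> / W) - 1)"
    using W by (simp add: exp2_def one_ereal_def)
  then have "ereal D * (exp2 (ereal \<tau> / ereal W) - 1) / ereal c < ereal h \<longleftrightarrow> D * (2 powr (\<tau> / W) - 1) / c < h"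
    using assms by simp
  also have "\<dots> \<longleftrightarrow> 2 powr (\<tau> / W) < 1 + c * h / D"
    using assms by (simp add: field_simps)
  also have "\<dots> \<longleftrightarrow> \<tau> / W < log 2 (1 + c * h / D)"
    using pos by (simp add: less_log_iff)
  also have "\<dots> \<longleftrightarrow> \<tau> < W * log 2 (1 + c * h / D)"
    using W by (simp add: field_simps)
  finally show ?thesis ..
qed

context cellular_network
begin

lemma prob_load_mix:
  fixes L :: "'a \<Rightarrow> real"
  assumes law: "distributed (prb N) lborel L (normal_density \<mu> \<sigma>)"
    and indep: "indep_set (sets (vimage_algebra (space (prb N)) L borel))
          (sets (vimage_algebra (space (prb N)) Z S))"
    and Z[measurable]: "Z \<in> measurable (prb N) S"
    and Q[measurable]: "Measurable.pred (borel \<Otimes>\<^sub>M S) (\<lambda>z. Q (fst z) (snd z))"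
  shows "prob {\<omega> \<in> space (prb N). Q (L \<omega>) (Z \<omega>)}
      = (LBINT t. prob {\<omega> \<in> space (prb N). Q t (Z \<omega>)} * normal_density \<mu> \<sigma> t)"
    and "(\<lambda>t. prob {\<omega> \<in> space (prb N). Q t (Z \<omega>)}) \<in> borel_measurable borel"
proof -
  have L[measurable]: "L \<in> borel_measurable (prb N)"
    using distributed_measurable[OF law] by simp
  have dL: "distr (prb N) borel L = density lborel (\<lambda>t. ennreal (normal_density \<mu> \<sigma> t))"
    using distributed_distr_eq_density[OF law] by (simp add: distr_def cong: distr_cong)
  interpret DL: prob_space "distr (prb N) borel L" by (rule prob_space_distr) fact
  interpret DZ: prob_space "distr (prb N) S Z" by (rule prob_space_distr) fact
  interpret LZ: pair_prob_space "distr (prb N) borel L" "distr (prb N) S Z" ..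
  have pair: "distr (prb N) (borel \<Otimes>\<^sub>M S) (\<lambda>\<omega>. (L \<omega>, Z \<omega>)) = distr (prb N) borel L \<Otimes>\<^sub>M distr (prb N) S Z"
  proof (rule distr_Pair_indep[OF L Z])
    fix A :: "real set" and B assume "A \<in> sets borel" "B \<in> sets S"
    then have "prob ((L -` A \<inter> space (prb N)) \<inter> (Z -` B \<inter> space (prb N)))
        = prob (L -` A \<inter> space (prb N)) * prob (Z -` B \<inter> space (prb N))"
      by (intro indep_setD[OF indep] in_vimage_algebra)
    then show "prob {\<omega> \<in> space (prb N). L \<omega> \<in> A \<and> Z \<omega> \<in> B}
        = prob {\<omega> \<in> space (prb N). L \<omega> \<in> A} * prob {\<omega> \<in> space (prb N). Z \<omega> \<in> B}"
      by (simp add: vimage_def Int_def conj_ac cong: conj_cong)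
  qed
  have ind: "(\<integral>\<omega>. indicator {\<omega> \<in> space (prb N). R \<omega>} \<omega> \<partial>prb N) = prob {\<omega> \<in> space (prb N). R \<omega>}" for R
    by (simp, intro arg_cong[where f = prob]) auto
  let ?i = "\<lambda>z. indicator {z. Q (fst z) (snd z)} z :: real"
  have i[measurable]: "?i \<in> borel_measurable (borel \<Otimes>\<^sub>M S)"
  proof -
    have "(\<lambda>z. if Q (fst z) (snd z) then 1 else (0::real)) \<in> borel_measurable (borel \<Otimes>\<^sub>M S)"
      by measurable
    then show ?thesis by (simp add: indicator_def of_bool_def)
  qed
  have sec: "(\<integral>y. ?i (t, y) \<partial>distr (prb N) S Z) = prob {\<omega> \<in> space (prb N). Q t (Z \<omega>)}" for t
  proof -
    have "(\<integral>y. ?i (t, y) \<partial>distr (prb N) S Z) = (\<integral>\<omega>. ?i (t, Z \<omega>) \<partial>prb N)"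
      by (rule integral_distr[OF Z]) measurable
    also have "\<dots> = (\<integral>\<omega>. indicator {\<omega> \<in> space (prb N). Q t (Z \<omega>)} \<omega> \<partial>prb N)"
      by (intro Bochner_Integration.integral_cong) (auto simp: indicator_def)
    finally show ?thesis unfolding ind .
  qed
  have "(\<lambda>t. \<integral>y. ?i (t, y) \<partial>distr (prb N) S Z) \<in> borel_measurable borel"
    by (rule DZ.borel_measurable_lebesgue_integral) (simp add: split_beta')
  then show m: "(\<lambda>t. prob {\<omega> \<in> space (prb N). Q t (Z \<omega>)}) \<in> borel_measurable borel"
    unfolding sec .
  have "prob {\<omega> \<in> space (prb N). Q (L \<omega>) (Z \<omega>)} = (\<integral>\<omega>. indicator {\<omega> \<in> space (prb N). Q (L \<omega>) (Z \<omega>)} \<omega> \<partial>prb N)"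
    unfolding ind ..
  also have "\<dots> = (\<integral>\<omega>. ?i (L \<omega>, Z \<omega>) \<partial>prb N)"
    by (intro Bochner_Integration.integral_cong) (auto simp: indicator_def)
  also have "\<dots> = (\<integral>z. ?i z \<partial>(distr (prb N) borel L \<Otimes>\<^sub>M distr (prb N) S Z))"
    unfolding pair[symmetric] by (rule integral_distr[symmetric]) measurable
  also have "\<dots> = (\<integral>t. (\<integral>y. ?i (t, y) \<partial>distr (prb N) S Z) \<partial>distr (prb N) borel L)"
  proof (rule LZ.integral_fst'[symmetric], rule LZ.integrable_const_bound[where B = 1])
    have se: "sets (distr (prb N) borel L \<Otimes>\<^sub>M distr (prb N) S Z) = sets (borel \<Otimes>\<^sub>M S)"
      by (intro sets_pair_measure_cong) auto
    show "?i \<in> borel_measurable (distr (prb N) borel L \<Otimes>\<^sub>M distr (prb N) S Z)"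
      unfolding measurable_cong_sets[OF se refl] by (rule i)
  qed (auto simp: indicator_def)
  also have "\<dots> = (\<integral>t. prob {\<omega> \<in> space (prb N). Q t (Z \<omega>)} \<partial>density lborel (\<lambda>t. ennreal (normal_density \<mu> \<sigma> t)))"
    unfolding sec dL ..
  also have "\<dots> = (LBINT t. prob {\<omega> \<in> space (prb N). Q t (Z \<omega>)} * normal_density \<mu> \<sigma> t)"
    using m by (subst integral_density) (auto simp: mult.commute)
  finally show "prob {\<omega> \<in> space (prb N). Q (L \<omega>) (Z \<omega>)}
      = (LBINT t. prob {\<omega> \<in> space (prb N). Q t (Z \<omega>)} * normal_density \<mu> \<sigma> t)" .
qed

text \<open>With deviation 0 the function \<open>normal_density\<close> is identically 0, as
  division by 0 gives 0, and so it cannot be the density of a random variable. Nonnegativity comes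
  from the square root of nonnegative moments.\<close>

lemma sigma_m_pos: "0 < sigma_m P"
proof -
  have "sigma_m P \<noteq> 0"
  proof
    assume "sigma_m P = 0"
    then have "distr (prb N) lborel (load_m N) = density lborel (\<lambda>_. 0)"
      using distributed_distr_eq_density[OF load_m_law] by (simp add: normal_density_def)
    then have "emeasure (distr (prb N) lborel (load_m N)) UNIV = 0"
      by (simp add: emeasure_density)
    moreover have "prob_space (distr (prb N) lborel (load_m N))"
      using distributed_measurable[OF load_m_law] by (rule prob_space_distr)
    ultimately show False
      using prob_space.emeasure_space_1 by fastforce
  qed
  moreover have "0 \<le> A_s P x \<and> A_s P x \<le> 1" for x
    using prob_space.prob_le_1[OF prob_space_uniform_disc[OF pos(1)]] by (simp add: A_s_def)
  then have "0 \<le> sigma_m P"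
    unfolding sigma_m_def E_X_def Var_X_def
    by (intro real_sqrt_ge_zero mult_nonneg_nonneg add_nonneg_nonneg Bochner_Integration.integral_nonneg)
       (auto simp: A_m_def)
  ultimately show ?thesis by simp
qed

lemma AE_uniform_disc_neq: "AE v in uniform_disc r. v \<noteq> a"
  unfolding uniform_disc_def
  by (rule AE_uniform_measureI) (use AE_lborel_singleton[of a] in auto)

text \<open>The lengths vanish only if the centre is 0, the offset is 0, or the offset is the
  negative of the centre. Each is a single point once the centre is fixed. A link of length 0 would
  have path loss 0 and, by division by 0, an SNR of 0.\<close>

lemma AE_link_length_pos: "AE \<omega> in prb N. \<forall>l. 0 < len l (rep_loc \<omega>)"
proof -
  let ?U = "uniform_disc (rad_s P)" and ?Y = "uniform_disc (rad P - rad_s P)"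
  let ?PU = "PiM users (\<lambda>_. ?U)"
  have R: "0 < rad P - rad_s P" using pos by simp
  interpret U: prob_space ?U by (rule prob_space_uniform_disc[OF pos(1)])
  interpret Y: prob_space ?Y by (rule prob_space_uniform_disc[OF R])
  interpret PP: product_prob_space "\<lambda>_. ?U" users ..
  interpret YPU: pair_prob_space ?Y ?PU ..
  have "AE p in ?Y \<Otimes>\<^sub>M ?PU. \<forall>l. 0 < len l p"
  proof (rule YPU.AE_pair_measure)
    have sets_eq: "sets (?Y \<Otimes>\<^sub>M ?PU) = sets loc_space"
      by (intro sets_pair_measure_cong sets_PiM_cong) auto
    have "{p \<in> space loc_space. \<forall>l. 0 < len l p} \<in> sets loc_space"
      unfolding all_link by measurable
    then show "{p \<in> space (?Y \<Otimes>\<^sub>M ?PU). \<forall>l. 0 < len l p} \<in> sets (?Y \<Otimes>\<^sub>M ?PU)"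
      unfolding sets_eq sets_eq_imp_space_eq[OF sets_eq] .
    show "AE y in ?Y. AE v in ?PU. \<forall>l. 0 < len l (y, v)"
      using AE_uniform_disc_neq[of "0"]
    proof eventually_elim
      case (elim y)
      have "AE v in ?PU. v (typ_usr N) \<noteq> 0" "AE v in ?PU. v (typ_usr N) \<noteq> - y"
        by (rule PP.AE_component[OF typ_in_users AE_uniform_disc_neq])+
      then show ?case
      proof eventually_elim
        case (elim v)
        then show ?case
          using \<open>y \<noteq> 0\<close> by (auto simp: all_link eq_neg_iff_add_eq_0 add.commute)
      qed
    qed
  qed
  then have "AE p in distr (prb N) loc_space rep_loc. \<forall>l. 0 < len l p"
    unfolding distr_rep_loc .
  then show ?thesis
    by (rule AE_distrD[OF rep_loc_measurable])
qed

text \<open>Gamma gains are almost surely positive, so any threshold below all positive numbers is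
  exceeded. It serves both for threshold 0 and for the threshold minus infinity of links that a rate
  event does not constrain.\<close>

lemma sum_link_prob_trivial:
  assumes "\<And>h. 0 < h \<Longrightarrow> g < ereal h"
  shows "(\<Sum>b\<in>UNIV. link_prob P r b {h. g < ereal h}) = 1"
proof -
  have "measure (fading b) {h. g < ereal h} = 1" for b
  proof -
    interpret F: prob_space "fading b" by (rule prob_space_fading)
    have s[simp]: "space (fading b) = UNIV" by (simp add: fading_def)
    have "1 = measure (fading b) (space (fading b) - {..0})"
      using fading_law_nonpos by (subst F.prob_compl) (auto simp: fading_def)
    also have "\<dots> \<le> measure (fading b) {h. g < ereal h}"
      using assms by (intro F.finite_measure_mono) auto
    finally show ?thesis using F.prob_le_1 by (intro antisym) auto
  qed
  then show ?thesis
    by (simp add: link_prob_eq UNIV_bool state_prob_def)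
qed

text \<open>Only the conditional law of the gains is given, so positivity is read off the general
  threshold formula with all thresholds equal to 0.\<close>

lemma AE_fading_pos: "AE \<omega> in prb N. \<forall>l. 0 < fad N l \<omega>"
proof -
  have sp: "rep_loc \<omega> \<in> space loc_space" if "\<omega> \<in> space (prb N)" for \<omega>
    using measurable_space[OF rep_loc_measurable that] .
  have E[measurable]: "{\<omega> \<in> space (prb N). \<forall>l. 0 < fad N l \<omega>} \<in> events"
    unfolding all_link by measurable
  have "prob {\<omega> \<in> space (prb N). \<forall>l. 0 < fad N l \<omega>}
      = prob {\<omega> \<in> space (prb N). rep_loc \<omega> \<in> space loc_space \<and> (\<forall>l. (0::ereal) < ereal (fad N l \<omega>))}"
    using sp by (intro arg_cong[where f = prob]) auto
  also have "\<dots> = (\<integral>\<omega>. indicator (space loc_space) (rep_loc \<omega>) *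
        (\<Prod>l\<in>UNIV. \<Sum>b\<in>UNIV. link_prob P (len l (rep_loc \<omega>)) b {h. (0::ereal) < ereal h}) \<partial>prb N)"
    by (rule prob_link_thresholds) auto
  also have "\<dots> = (\<integral>\<omega>. 1 \<partial>prb N)"
    using sp by (intro Bochner_Integration.integral_cong refl) (subst sum_link_prob_trivial; simp)
  finally have "prob {\<omega> \<in> space (prb N). \<forall>l. 0 < fad N l \<omega>} = 1"
    by (simp add: prob_space)
  then show ?thesis
    unfolding prob_Collect_eq_1[OF E] .
qed

subsection \<open>Rate coverage\<close>

lemma usr_measurable: "j \<in> users \<Longrightarrow> usr N (n_hot P) j \<in> borel_measurable (prb N)"
  using loc_measurable rep_in_loc_index by (simp add: usr_loc)

lemma rep_ctr_measurable [measurable]: "rep_ctr P N \<in> borel_measurable (prb N)"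
  using loc_measurable rep_in_loc_index by (simp add: rep_ctr_loc)

lemma rep_data_measurable [measurable]: "rep_data P N \<in> measurable (prb N) (rep_space P)"
  unfolding rep_data_def[abs_def] rep_space_def
proof (intro measurable_Pair rep_ctr_measurable)
  show "(\<lambda>\<omega>. \<lambda>j\<in>users. usr N (n_hot P) j \<omega>) \<in> measurable (prb N) (PiM users (\<lambda>_. borel))"
    by (rule measurable_restrict) (rule usr_measurable)
  have "(\<lambda>\<omega>. \<lambda>l\<in>UNIV. (los N l \<omega>, fad N l \<omega>)) \<in> measurable (prb N) (PiM UNIV (\<lambda>_. count_space UNIV \<Otimes>\<^sub>M borel))"
    by (intro measurable_restrict measurable_Pair los_measurable fad_measurable)
  then show "(\<lambda>\<omega> l. (los N l \<omega>, fad N l \<omega>)) \<in> measurable (prb N) (PiM UNIV (\<lambda>_. count_space UNIV \<Otimes>\<^sub>M borel))"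
    by (simp add: restrict_UNIV)
qed

lemma pred_assoc [measurable]: "Measurable.pred (borel \<Otimes>\<^sub>M borel) (\<lambda>p. assoc_sbs P (fst p) (snd p))"
  by (rule measurable_assoc_sbs[OF params measurable_fst measurable_snd])

lemma N_sbs_eq: "N_sbs P N \<omega> = card {j \<in> users. assoc_sbs P (fst (rep_loc \<omega>)) (snd (rep_loc \<omega>) j)}"
  unfolding N_sbs_def rep_loc_def by (intro arg_cong[where f = card]) auto

lemma N_abs_eq: "N_abs P N \<omega> = card {j \<in> users. \<not> assoc_sbs P (fst (rep_loc \<omega>)) (snd (rep_loc \<omega>) j)}"
  unfolding N_abs_def rep_loc_def by (intro arg_cong[where f = card]) auto

lemma served_eq: "served_sbs P N \<omega> \<longleftrightarrow> assoc_sbs P (fst (rep_loc \<omega>)) (snd (rep_loc \<omega>) (typ_usr N))"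
  using typ_in_users by (simp add: served_sbs_def rep_loc_def typ_off_def)

text \<open>The index \<open>k\<close> counts the users of the hotspot served by the same station as
  the typical user, itself included.\<close>

definition served_set :: "bool \<Rightarrow> nat \<Rightarrow> ((real^2) \<times> (nat \<Rightarrow> real^2)) set" where
  "served_set b k = {p \<in> space loc_space. (assoc_sbs P (fst p) (snd p (typ_usr N)) \<longleftrightarrow> b)
     \<and> card {j \<in> users. assoc_sbs P (fst p) (snd p j) \<longleftrightarrow> b} = k}"

lemma served_set_sets: "served_set b k \<in> sets loc_space"
proof -
  have [measurable]: "Measurable.pred loc_space (\<lambda>p. card {j \<in> users. assoc_sbs P (fst p) (snd p j) \<longleftrightarrow> b} = k)"
    by (rule pred_card_users) measurable
  have [measurable]: "Measurable.pred loc_space (\<lambda>p. assoc_sbs P (fst p) (snd p (typ_usr N)))"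
    by (rule measurable_assoc_sbs[OF params measurable_fst measurable_typ])
  show ?thesis unfolding served_set_def by measurable
qed

lemma served_set_iff:
  assumes "\<omega> \<in> space (prb N)"
  shows "rep_loc \<omega> \<in> served_set True k \<longleftrightarrow> served_sbs P N \<omega> \<and> N_sbs P N \<omega> = k"
    "rep_loc \<omega> \<in> served_set False k \<longleftrightarrow> \<not> served_sbs P N \<omega> \<and> N_abs P N \<omega> = k"
  using measurable_space[OF rep_loc_measurable assms]
  by (simp_all add: served_set_def served_eq N_sbs_eq N_abs_eq)

text \<open>The argument of \<open>F_h\<close> inside \<open>link_ccdf\<close>, taken separately for
  each LOS state and as a function of the locations.\<close>

definition link_threshold :: "real \<Rightarrow> ereal \<Rightarrow> link \<Rightarrow> bool \<Rightarrow> (real^2) \<times> (nat \<Rightarrow> real^2) \<Rightarrow> ereal" where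
  "link_threshold c \<theta> l b p =
     ereal (len l p powr (if b then pl_los P else pl_nlos P) * pl_const P * noise P * bw P) * \<theta> / ereal c"

lemma link_threshold_measurable: "link_threshold c \<theta> l b \<in> borel_measurable loc_space"
  unfolding link_threshold_def[abs_def] by measurable

lemma sum_link_prob_threshold:
  "(\<Sum>b\<in>UNIV. link_prob P (len l p) b {h. link_threshold c \<theta> l b p < ereal h}) = link_ccdf P c (len l p) \<theta>"
  by (simp add: UNIV_bool link_prob_def link_ccdf_def F_h_def link_threshold_def add.commute)

lemma snr_exceeds_iff:
  assumes "0 < len l (rep_loc \<omega>)" "0 < fad N l \<omega>" "0 < c" "0 \<le> W" "W = 0 \<Longrightarrow> \<tau> \<noteq> 0"
  shows "\<tau> < W * log 2 (1 + c * fad N l \<omega> / (noise P * bw P * link_loss P N l \<omega>)) \<longleftrightarrow>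
    link_threshold c (exp2 (ereal \<tau> / ereal W) - 1) l (los N l \<omega>) (rep_loc \<omega>) < ereal (fad N l \<omega>)"
proof -
  let ?D = "len l (rep_loc \<omega>) powr (if los N l \<omega> then pl_los P else pl_nlos P) * pl_const P * noise P * bw P"
  have D: "0 < ?D" using assms(1) pos by simp
  have eq: "noise P * bw P * link_loss P N l \<omega> = ?D"
    by (simp add: link_loss_def path_loss_def link_length_eq mult_ac)
  show ?thesis
    unfolding link_threshold_def eq by (rule rate_exceeds_iff[OF D assms(3,2,4,5)])
qed

lemma SNR_link_measurable [measurable]:
  "(\<lambda>\<omega>. c * fad N l \<omega> / (noise P * bw P * link_loss P N l \<omega>)) \<in> borel_measurable (prb N)"
proof -
  have [measurable]: "Measurable.pred (prb N) (los N l)"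
    using los_measurable by simp
  show ?thesis
    unfolding link_loss_def path_loss_def link_length_eq by measurable
qed

lemma orthogonal_norm: "orthogonal_transformation f \<Longrightarrow> norm (f v) = norm (v :: real^2)"
  using orthogonal_transformation_norm by auto

lemma orthogonal_add: "orthogonal_transformation f \<Longrightarrow> f (y :: real^2) + f v = f (y + v)"
  by (simp add: linear_add orthogonal_transformation_linear)

lemma assoc_sbs_orthogonal:
  "orthogonal_transformation f \<Longrightarrow> assoc_sbs P (f y) (f v) \<longleftrightarrow> assoc_sbs P y v"
  by (simp add: assoc_sbs_def orthogonal_norm orthogonal_add)

text \<open>In this form \<open>A_m\<close> is itself the success probability of a trial, so the ABS
  case uses the same counting formula with the negated association rule.\<close>

lemma A_m_eq: "A_m P x = measure (uniform_disc (rad_s P)) {v. \<not> assoc_sbs P (x *\<^sub>R axis 1 1) v}"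
proof -
  interpret U: prob_space "uniform_disc (rad_s P)" by (rule prob_space_uniform_disc[OF pos(1)])
  have "{v. assoc_sbs P (x *\<^sub>R axis 1 1) v} \<in> sets (uniform_disc (rad_s P))"
    by simp
  from U.prob_compl[OF this] show ?thesis
    by (simp add: A_m_def A_s_def Collect_neg_eq Compl_eq_Diff_UNIV)
qed

lemma prob_cong_AE:
  assumes "AE \<omega> in prb N. Q \<omega> \<longleftrightarrow> R \<omega>"
    and [measurable]: "Measurable.pred (prb N) Q" "Measurable.pred (prb N) R"
  shows "prob {\<omega> \<in> space (prb N). Q \<omega>} = prob {\<omega> \<in> space (prb N). R \<omega>}"
  by (rule finite_measure_eq_AE) (use assms(1) in auto)

section \<open>Coverage for a deterministic load\<close>

lemma pred_link_exceeds:
  assumes [measurable]: "\<And>b. g b \<in> borel_measurable loc_space"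
  shows "Measurable.pred (prb N) (\<lambda>\<omega>. g (los N l \<omega>) (rep_loc \<omega>) < ereal (fad N l \<omega>))"
proof -
  have "Measurable.pred (prb N) (\<lambda>\<omega>. \<exists>b. los N l \<omega> = b \<and> g b (rep_loc \<omega>) < ereal (fad N l \<omega>))"
    unfolding ex_bool_eq by measurable
  then show ?thesis by simp
qed

text \<open>The target \<open>\<tau>\<close> is a constant, which stands for the load after it has
  been frozen. Success in the count means being served by the ABS, hence the power
  \<open>k - 1\<close> falls on \<open>A_m\<close>.\<close>

lemma prob_abs_served_exceeds:
  assumes k: "1 \<le> k"
  shows "prob {\<omega> \<in> space (prb N). \<not> served_sbs P N \<omega> \<and> N_abs P N \<omega> = k \<and> \<tau> < W_a P * log 2 (1 + SNR_a_abs P N \<omega>)}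
    = real ((n_usr P - 1) choose (k - 1)) * (LBINT x:{0..rad P - rad_s P}.
        Pc_m P (exp2 (ereal \<tau> / ereal (W_a P)) - 1) x * A_m P x ^ (k - 1) * A_s P x ^ (n_usr P - k) * f_X P x)"
proof -
  let ?c = "pow_m P * gain P" and ?\<theta> = "exp2 (ereal \<tau> / ereal (W_a P)) - 1"
  \<comment> \<open>Minus infinity leaves a link unconstrained; its factor in the product over links
    is then 1.\<close>
  define g where "g l = (if l = Access_ABS then link_threshold ?c ?\<theta> l else (\<lambda>_ _. - \<infinity>))" for l
  define C where "C y v \<longleftrightarrow> \<not> assoc_sbs P y v" for y v
  define q where "q y v = link_ccdf P ?c (norm (y + v)) ?\<theta>" for y v :: "real^2"
  have gm[measurable]: "g l b \<in> borel_measurable loc_space" for l b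
    using link_threshold_measurable by (simp add: g_def)
  note [measurable] = served_set_sets[of False k]
  have lm: "Measurable.pred (prb N) (\<lambda>\<omega>. g l (los N l \<omega>) (rep_loc \<omega>) < ereal (fad N l \<omega>))" for l
    by (rule pred_link_exceeds) (rule gm)
  have "prob {\<omega> \<in> space (prb N). \<not> served_sbs P N \<omega> \<and> N_abs P N \<omega> = k \<and> \<tau> < W_a P * log 2 (1 + SNR_a_abs P N \<omega>)}
      = prob {\<omega> \<in> space (prb N). rep_loc \<omega> \<in> served_set False k \<and> \<tau> < W_a P * log 2 (1 + SNR_a_abs P N \<omega>)}"
    by (intro arg_cong[where f = prob]) (auto simp: served_set_iff)
  also have "\<dots> = prob {\<omega> \<in> space (prb N). rep_loc \<omega> \<in> served_set False k
      \<and> (\<forall>l. g l (los N l \<omega>) (rep_loc \<omega>) < ereal (fad N l \<omega>))}"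
  proof (rule prob_cong_AE)
    show "AE \<omega> in prb N. (rep_loc \<omega> \<in> served_set False k \<and> \<tau> < W_a P * log 2 (1 + SNR_a_abs P N \<omega>)
        \<longleftrightarrow> rep_loc \<omega> \<in> served_set False k \<and> (\<forall>l. g l (los N l \<omega>) (rep_loc \<omega>) < ereal (fad N l \<omega>)))"
      using AE_link_length_pos AE_fading_pos
    proof eventually_elim
      case (elim \<omega>)
      have "\<tau> < W_a P * log 2 (1 + SNR_a_abs P N \<omega>) \<longleftrightarrow>
          link_threshold ?c ?\<theta> Access_ABS (los N Access_ABS \<omega>) (rep_loc \<omega>) < ereal (fad N Access_ABS \<omega>)"
        unfolding SNR_a_abs_def by (rule snr_exceeds_iff[OF elim(1)[rule_format] elim(2)[rule_format]]) (use pos in auto)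
      then show ?case by (simp add: all_link g_def)
    qed
    show "Measurable.pred (prb N) (\<lambda>\<omega>. rep_loc \<omega> \<in> served_set False k \<and> \<tau> < W_a P * log 2 (1 + SNR_a_abs P N \<omega>))"
      unfolding SNR_a_abs_def by measurable
    show "Measurable.pred (prb N) (\<lambda>\<omega>. rep_loc \<omega> \<in> served_set False k
        \<and> (\<forall>l. g l (los N l \<omega>) (rep_loc \<omega>) < ereal (fad N l \<omega>)))"
      unfolding all_link using lm by measurable
  qed
  also have "\<dots> = (\<integral>\<omega>. indicator (served_set False k) (rep_loc \<omega>) *
        (\<Prod>l\<in>UNIV. \<Sum>b\<in>UNIV. link_prob P (len l (rep_loc \<omega>)) b {h. g l b (rep_loc \<omega>) < ereal h}) \<partial>prb N)"
    by (rule prob_link_thresholds) (rule served_set_sets, rule gm)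
  also have "\<dots> = (\<integral>\<omega>. (if card {j \<in> users. C (rep_ctr P N \<omega>) (usr N (n_hot P) j \<omega>)} = k
      \<and> C (rep_ctr P N \<omega>) (typ_off P N \<omega>) then q (rep_ctr P N \<omega>) (typ_off P N \<omega>) else 0) \<partial>prb N)"
  proof (intro Bochner_Integration.integral_cong refl)
    fix \<omega> assume \<omega>: "\<omega> \<in> space (prb N)"
    have "(\<Sum>b\<in>UNIV. link_prob P (len l (rep_loc \<omega>)) b {h. g l b (rep_loc \<omega>) < ereal h}) = 1"
      if "l \<noteq> Access_ABS" for l
      using that sum_link_prob_trivial[of "- \<infinity>" "len l (rep_loc \<omega>)"] by (simp add: g_def)
    moreover have "(\<Sum>b\<in>UNIV. link_prob P (len Access_ABS (rep_loc \<omega>)) b {h. g Access_ABS b (rep_loc \<omega>) < ereal h})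
        = q (rep_ctr P N \<omega>) (typ_off P N \<omega>)"
      using sum_link_prob_threshold[of Access_ABS "rep_loc \<omega>" ?c ?\<theta>] link_length_eq[of Access_ABS \<omega>]
      by (simp only: g_def simp_thms if_True q_def link_length.simps)
    ultimately show "indicator (served_set False k) (rep_loc \<omega>) *
        (\<Prod>l\<in>UNIV. \<Sum>b\<in>UNIV. link_prob P (len l (rep_loc \<omega>)) b {h. g l b (rep_loc \<omega>) < ereal h})
      = (if card {j \<in> users. C (rep_ctr P N \<omega>) (usr N (n_hot P) j \<omega>)} = k
        \<and> C (rep_ctr P N \<omega>) (typ_off P N \<omega>) then q (rep_ctr P N \<omega>) (typ_off P N \<omega>) else 0)"
      using served_set_iff(2)[OF \<omega>, of k]
      by (auto simp: prod_UNIV_link indicator_def C_def N_abs_def served_sbs_def simp del: len.simps)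
  qed
  also have "\<dots> = real ((n_usr P - 1) choose (k - 1)) *
      (LBINT x:{0..rad P - rad_s P}. Pc_m P ?\<theta> x * A_m P x ^ (k - 1) * (1 - A_m P x) ^ (n_usr P - k) * f_X P x)"
  proof (rule integral_rep_loc_count[OF _ _ _ _ _ _ _ k])
    show "Measurable.pred (borel \<Otimes>\<^sub>M borel) (\<lambda>p. C (fst p) (snd p))"
      unfolding C_def by measurable
    show "(\<lambda>p. q (fst p) (snd p)) \<in> borel_measurable (borel \<Otimes>\<^sub>M borel)"
      unfolding q_def by (rule borel_measurable_link_ccdf[OF params]) measurable
    show "\<bar>q y v\<bar> \<le> 1" for y v
      using link_ccdf_bounds[OF params] by (simp add: q_def)
    show "A_m P x = measure (uniform_disc (rad_s P)) {v. C (x *\<^sub>R axis 1 1) v}" for x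
      by (simp add: C_def A_m_eq)
    show "Pc_m P ?\<theta> x = (\<integral>v. (if C (x *\<^sub>R axis 1 1) v then q (x *\<^sub>R axis 1 1) v else 0) \<partial>uniform_disc (rad_s P))"
      if "0 < x" for x
      unfolding C_def q_def by (rule Pc_m_eq[OF params that])
  qed (simp_all add: C_def q_def assoc_sbs_orthogonal orthogonal_add orthogonal_norm)
  finally show ?thesis by (simp add: A_m_def)
qed

text \<open>Backhaul and access link both carry a finite or infinite threshold, and their tails
  multiply because the links are conditionally independent. The condition on the backhaul target
  excludes the case in which the rate comparison and its threshold form disagree.\<close>

lemma prob_sbs_served_exceeds:
  assumes k: "1 \<le> k" and \<tau>\<^sub>1: "W_b P = 0 \<Longrightarrow> \<tau>\<^sub>1 \<noteq> 0"
  shows "prob {\<omega> \<in> space (prb N). served_sbs P N \<omega> \<and> N_sbs P N \<omega> = k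
      \<and> \<tau>\<^sub>2 < W_a P * log 2 (1 + SNR_a_sbs P N \<omega>) \<and> \<tau>\<^sub>1 < W_b P * log 2 (1 + SNR_b P N \<omega>)}
    = real ((n_usr P - 1) choose (k - 1)) * (LBINT x:{0..rad P - rad_s P}.
        Pc_s P (exp2 (ereal \<tau>\<^sub>1 / ereal (W_b P)) - 1) (exp2 (ereal \<tau>\<^sub>2 / ereal (W_a P)) - 1) x
        * A_s P x ^ (k - 1) * A_m P x ^ (n_usr P - k) * f_X P x)"
proof -
  let ?c1 = "pow_m P * (gain P)\<^sup>2" and ?\<theta>1 = "exp2 (ereal \<tau>\<^sub>1 / ereal (W_b P)) - 1"
  let ?c2 = "pow_s P * gain P" and ?\<theta>2 = "exp2 (ereal \<tau>\<^sub>2 / ereal (W_a P)) - 1"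
  define g where "g l = (case l of Backhaul \<Rightarrow> link_threshold ?c1 ?\<theta>1 l
    | Access_SBS \<Rightarrow> link_threshold ?c2 ?\<theta>2 l | Access_ABS \<Rightarrow> (\<lambda>_ _. - \<infinity>))" for l
  define q where "q y v = link_ccdf P ?c1 (norm y) ?\<theta>1 * link_ccdf P ?c2 (norm v) ?\<theta>2" for y v :: "real^2"
  have gm[measurable]: "g l b \<in> borel_measurable loc_space" for l b
    using link_threshold_measurable by (cases l) (simp_all add: g_def)
  note [measurable] = served_set_sets[of True k]
  have lm: "Measurable.pred (prb N) (\<lambda>\<omega>. g l (los N l \<omega>) (rep_loc \<omega>) < ereal (fad N l \<omega>))" for l
    by (rule pred_link_exceeds) (rule gm)
  let ?R = "\<lambda>\<omega>. \<tau>\<^sub>2 < W_a P * log 2 (1 + SNR_a_sbs P N \<omega>) \<and> \<tau>\<^sub>1 < W_b P * log 2 (1 + SNR_b P N \<omega>)"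
  have "prob {\<omega> \<in> space (prb N). served_sbs P N \<omega> \<and> N_sbs P N \<omega> = k \<and> ?R \<omega>}
      = prob {\<omega> \<in> space (prb N). rep_loc \<omega> \<in> served_set True k \<and> ?R \<omega>}"
    by (intro arg_cong[where f = prob]) (auto simp: served_set_iff)
  also have "\<dots> = prob {\<omega> \<in> space (prb N). rep_loc \<omega> \<in> served_set True k
      \<and> (\<forall>l. g l (los N l \<omega>) (rep_loc \<omega>) < ereal (fad N l \<omega>))}"
  proof (rule prob_cong_AE)
    show "AE \<omega> in prb N. (rep_loc \<omega> \<in> served_set True k \<and> ?R \<omega>
        \<longleftrightarrow> rep_loc \<omega> \<in> served_set True k \<and> (\<forall>l. g l (los N l \<omega>) (rep_loc \<omega>) < ereal (fad N l \<omega>)))"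
      using AE_link_length_pos AE_fading_pos
    proof eventually_elim
      case (elim \<omega>)
      have "\<tau>\<^sub>2 < W_a P * log 2 (1 + SNR_a_sbs P N \<omega>) \<longleftrightarrow>
          link_threshold ?c2 ?\<theta>2 Access_SBS (los N Access_SBS \<omega>) (rep_loc \<omega>) < ereal (fad N Access_SBS \<omega>)"
        unfolding SNR_a_sbs_def by (rule snr_exceeds_iff[OF elim(1)[rule_format] elim(2)[rule_format]]) (use pos in auto)
      moreover have "\<tau>\<^sub>1 < W_b P * log 2 (1 + SNR_b P N \<omega>) \<longleftrightarrow>
          link_threshold ?c1 ?\<theta>1 Backhaul (los N Backhaul \<omega>) (rep_loc \<omega>) < ereal (fad N Backhaul \<omega>)"
        unfolding SNR_b_def by (rule snr_exceeds_iff[OF elim(1)[rule_format] elim(2)[rule_format]]) (use pos \<tau>\<^sub>1 in auto)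
      ultimately show ?case by (auto simp: all_link g_def)
    qed
    show "Measurable.pred (prb N) (\<lambda>\<omega>. rep_loc \<omega> \<in> served_set True k \<and> ?R \<omega>)"
      unfolding SNR_a_sbs_def SNR_b_def by measurable
    show "Measurable.pred (prb N) (\<lambda>\<omega>. rep_loc \<omega> \<in> served_set True k
        \<and> (\<forall>l. g l (los N l \<omega>) (rep_loc \<omega>) < ereal (fad N l \<omega>)))"
      unfolding all_link using lm by measurable
  qed
  also have "\<dots> = (\<integral>\<omega>. indicator (served_set True k) (rep_loc \<omega>) *
        (\<Prod>l\<in>UNIV. \<Sum>b\<in>UNIV. link_prob P (len l (rep_loc \<omega>)) b {h. g l b (rep_loc \<omega>) < ereal h}) \<partial>prb N)"
    by (rule prob_link_thresholds) (rule served_set_sets, rule gm)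
  also have "\<dots> = (\<integral>\<omega>. (if card {j \<in> users. assoc_sbs P (rep_ctr P N \<omega>) (usr N (n_hot P) j \<omega>)} = k
      \<and> assoc_sbs P (rep_ctr P N \<omega>) (typ_off P N \<omega>) then q (rep_ctr P N \<omega>) (typ_off P N \<omega>) else 0) \<partial>prb N)"
  proof (intro Bochner_Integration.integral_cong refl)
    fix \<omega> assume \<omega>: "\<omega> \<in> space (prb N)"
    have "(\<Sum>b\<in>UNIV. link_prob P (len Access_ABS (rep_loc \<omega>)) b {h. g Access_ABS b (rep_loc \<omega>) < ereal h}) = 1"
      using sum_link_prob_trivial[of "- \<infinity>" "len Access_ABS (rep_loc \<omega>)"] by (simp add: g_def)
    moreover have "(\<Sum>b\<in>UNIV. link_prob P (len Backhaul (rep_loc \<omega>)) b {h. g Backhaul b (rep_loc \<omega>) < ereal h})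
        = link_ccdf P ?c1 (norm (rep_ctr P N \<omega>)) ?\<theta>1"
      using sum_link_prob_threshold[of Backhaul "rep_loc \<omega>" ?c1 ?\<theta>1] link_length_eq[of Backhaul \<omega>]
      by (simp only: g_def link.case link_length.simps)
    moreover have "(\<Sum>b\<in>UNIV. link_prob P (len Access_SBS (rep_loc \<omega>)) b {h. g Access_SBS b (rep_loc \<omega>) < ereal h})
        = link_ccdf P ?c2 (norm (typ_off P N \<omega>)) ?\<theta>2"
      using sum_link_prob_threshold[of Access_SBS "rep_loc \<omega>" ?c2 ?\<theta>2] link_length_eq[of Access_SBS \<omega>]
      by (simp only: g_def link.case link_length.simps)
    ultimately show "indicator (served_set True k) (rep_loc \<omega>) *
        (\<Prod>l\<in>UNIV. \<Sum>b\<in>UNIV. link_prob P (len l (rep_loc \<omega>)) b {h. g l b (rep_loc \<omega>) < ereal h})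
      = (if card {j \<in> users. assoc_sbs P (rep_ctr P N \<omega>) (usr N (n_hot P) j \<omega>)} = k
        \<and> assoc_sbs P (rep_ctr P N \<omega>) (typ_off P N \<omega>) then q (rep_ctr P N \<omega>) (typ_off P N \<omega>) else 0)"
      using served_set_iff(1)[OF \<omega>, of k]
      by (auto simp: prod_UNIV_link indicator_def N_sbs_def served_sbs_def q_def simp del: len.simps)
  qed
  also have "\<dots> = real ((n_usr P - 1) choose (k - 1)) *
      (LBINT x:{0..rad P - rad_s P}. Pc_s P ?\<theta>1 ?\<theta>2 x * A_s P x ^ (k - 1) * (1 - A_s P x) ^ (n_usr P - k) * f_X P x)"
  proof (rule integral_rep_loc_count[OF _ _ _ _ _ _ _ k])
    show "Measurable.pred (borel \<Otimes>\<^sub>M borel) (\<lambda>p. assoc_sbs P (fst p) (snd p))"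
      by measurable
    show "(\<lambda>p. q (fst p) (snd p)) \<in> borel_measurable (borel \<Otimes>\<^sub>M borel)"
      unfolding q_def by (intro borel_measurable_times borel_measurable_link_ccdf[OF params]) measurable
    show "\<bar>q y v\<bar> \<le> 1" for y v
      using link_ccdf_bounds[OF params, of "norm y"] link_ccdf_bounds[OF params, of "norm v"]
      by (simp add: q_def mult_le_one)
    show "Pc_s P ?\<theta>1 ?\<theta>2 x = (\<integral>v. (if assoc_sbs P (x *\<^sub>R axis 1 1) v then q (x *\<^sub>R axis 1 1) v else 0) \<partial>uniform_disc (rad_s P))"
      if "0 < x" for x
    proof -
      have nrm: "norm (x *\<^sub>R axis 1 1 :: real^2) = x" using that by (simp add: norm_axis_1)
      show ?thesis unfolding q_def nrm by (rule Pc_s_eq[OF params that])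
    qed
  qed (simp_all add: A_s_def q_def assoc_sbs_orthogonal orthogonal_norm)
  finally show ?thesis by (simp add: A_m_def)
qed

text \<open>Independence of the load is stated against \<open>rep_data\<close>. Rate events must
  therefore be predicates on the values of \<open>rep_data\<close>, and this map and
  \<open>snr_part\<close> recover locations and SNRs from such a value.\<close>

definition loc_part ::
    "(real^2) \<times> (nat \<Rightarrow> real^2) \<times> (link \<Rightarrow> bool \<times> real) \<Rightarrow> (real^2) \<times> (nat \<Rightarrow> real^2)" where
  "loc_part z = (fst z, fst (snd z))"

definition snr_part ::
    "real \<Rightarrow> link \<Rightarrow> (real^2) \<times> (nat \<Rightarrow> real^2) \<times> (link \<Rightarrow> bool \<times> real) \<Rightarrow> real" where
  "snr_part c l z = c * snd (snd (snd z) l) / (noise P * bw P * path_loss P (fst (snd (snd z) l)) (len l (loc_part z)))"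

lemma loc_part_rep_data: "loc_part (rep_data P N \<omega>) = rep_loc \<omega>"
  by (simp add: loc_part_def rep_data_def rep_loc_def)

lemma snr_part_rep_data:
  "snr_part c l (rep_data P N \<omega>) = c * fad N l \<omega> / (noise P * bw P * link_loss P N l \<omega>)"
  by (simp add: snr_part_def loc_part_rep_data link_loss_def link_length_eq) (simp add: rep_data_def)

lemma loc_part_measurable [measurable]: "loc_part \<in> measurable (rep_space P) loc_space"
  unfolding loc_part_def[abs_def] rep_space_def
  by (intro measurable_Pair measurable_fst measurable_compose[OF measurable_snd measurable_fst])

lemma snr_part_measurable [measurable]: "snr_part c l \<in> borel_measurable (rep_space P)"
proof -
  have l: "(\<lambda>z. snd (snd z) l) \<in> measurable (rep_space P) (count_space UNIV \<Otimes>\<^sub>M borel)"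
    unfolding rep_space_def
    by (intro measurable_compose[OF measurable_compose[OF measurable_snd measurable_snd]] measurable_component_singleton) simp
  have [measurable]: "Measurable.pred (rep_space P) (\<lambda>z. fst (snd (snd z) l))"
    "(\<lambda>z. snd (snd (snd z) l)) \<in> borel_measurable (rep_space P)"
    using measurable_compose[OF l measurable_fst] measurable_compose[OF l measurable_snd] by auto
  show ?thesis
    unfolding snr_part_def[abs_def] path_loss_def by measurable
qed

lemma normal_density_expand:
  "0 < \<sigma> \<Longrightarrow> normal_density \<mu> \<sigma> t = 1 / (\<sigma> * sqrt (2 * pi)) * exp (- ((t - \<mu>)\<^sup>2 / (2 * \<sigma>\<^sup>2)))"
  by (simp add: normal_density_def real_sqrt_mult mult.commute)

text \<open>The typical user counts itself, so the sum over the number of users starts at 1.\<close>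

lemma N_abs_range: "\<not> served_sbs P N \<omega> \<Longrightarrow> N_abs P N \<omega> \<in> {1..n_usr P}"
proof -
  assume "\<not> served_sbs P N \<omega>"
  then have "typ_usr N \<in> {j \<in> users. \<not> assoc_sbs P (rep_ctr P N \<omega>) (usr N (n_hot P) j \<omega>)}"
    using typ_in_users by (simp add: served_sbs_def typ_off_def)
  moreover have "card {j \<in> users. \<not> assoc_sbs P (rep_ctr P N \<omega>) (usr N (n_hot P) j \<omega>)} \<le> card users"
    by (intro card_mono) auto
  ultimately show ?thesis
    by (auto simp: N_abs_def Suc_le_eq card_gt_0_iff)
qed

lemma N_sbs_range: "served_sbs P N \<omega> \<Longrightarrow> N_sbs P N \<omega> \<in> {1..n_usr P}"
proof -
  assume "served_sbs P N \<omega>"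
  then have "typ_usr N \<in> {j \<in> users. assoc_sbs P (rep_ctr P N \<omega>) (usr N (n_hot P) j \<omega>)}"
    using typ_in_users by (simp add: served_sbs_def typ_off_def)
  moreover have "card {j \<in> users. assoc_sbs P (rep_ctr P N \<omega>) (usr N (n_hot P) j \<omega>)} \<le> card users"
    by (intro card_mono) auto
  ultimately show ?thesis
    by (auto simp: N_sbs_def Suc_le_eq card_gt_0_iff)
qed

lemma load_measurable [measurable]: "load_m N \<in> borel_measurable (prb N)" "load_s N \<in> borel_measurable (prb N)"
  using distributed_measurable[OF load_m_law] distributed_measurable[OF load_s_law] by simp_all

lemma served_count_measurable:
  "Measurable.pred (prb N) (\<lambda>\<omega>. \<not> served_sbs P N \<omega> \<and> N_abs P N \<omega> = k)"
  "Measurable.pred (prb N) (\<lambda>\<omega>. served_sbs P N \<omega> \<and> N_sbs P N \<omega> = k)"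
proof -
  note [measurable] = served_set_sets
  have "Measurable.pred (prb N) (\<lambda>\<omega>. rep_loc \<omega> \<in> served_set False k)"
    "Measurable.pred (prb N) (\<lambda>\<omega>. rep_loc \<omega> \<in> served_set True k)"
    by measurable
  then show "Measurable.pred (prb N) (\<lambda>\<omega>. \<not> served_sbs P N \<omega> \<and> N_abs P N \<omega> = k)"
    "Measurable.pred (prb N) (\<lambda>\<omega>. served_sbs P N \<omega> \<and> N_sbs P N \<omega> = k)"
    by (simp_all add: served_set_iff cong: measurable_cong)
qed

lemma abs_event_measurable:
  "{\<omega> \<in> space (prb N). \<not> served_sbs P N \<omega> \<and> N_abs P N \<omega> = k \<and> abs_rate_exceeds P N \<rho> \<omega>} \<in> events"
proof -
  note [measurable] = served_count_measurable(1)[of k]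
  have "Measurable.pred (prb N) (\<lambda>\<omega>. (\<not> served_sbs P N \<omega> \<and> N_abs P N \<omega> = k)
      \<and> \<rho> * (real k + load_m N \<omega>) < W_a P * log 2 (1 + SNR_a_abs P N \<omega>))"
    unfolding SNR_a_abs_def by measurable
  also have "(\<lambda>\<omega>. (\<not> served_sbs P N \<omega> \<and> N_abs P N \<omega> = k)
      \<and> \<rho> * (real k + load_m N \<omega>) < W_a P * log 2 (1 + SNR_a_abs P N \<omega>))
    = (\<lambda>\<omega>. \<not> served_sbs P N \<omega> \<and> N_abs P N \<omega> = k \<and> abs_rate_exceeds P N \<rho> \<omega>)"
    by (auto simp: abs_rate_exceeds_def)
  finally show ?thesis by measurable
qed

lemma sbs_event_measurable:
  "{\<omega> \<in> space (prb N). served_sbs P N \<omega> \<and> N_sbs P N \<omega> = k \<and> sbs_rate_exceeds s P N \<rho> \<omega>} \<in> events"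
proof -
  note [measurable] = served_count_measurable(2)[of k]
  \<comment> \<open>On the event that the count is \<open>k\<close>, the backhaul load only involves
    the constant \<open>k\<close>, which gives a measurable comparison.\<close>
  define D where "D \<omega> = (case s of Equal \<Rightarrow> real (n_hot P) * real k | Load_Based \<Rightarrow> real k + load_s N \<omega>)" for \<omega>
  have [measurable]: "D \<in> borel_measurable (prb N)"
    unfolding D_def[abs_def] by (cases s) simp_all
  have "Measurable.pred (prb N) (\<lambda>\<omega>. (served_sbs P N \<omega> \<and> N_sbs P N \<omega> = k)
      \<and> \<rho> * real k < W_a P * log 2 (1 + SNR_a_sbs P N \<omega>) \<and> \<rho> * D \<omega> < W_b P * log 2 (1 + SNR_b P N \<omega>))"
    unfolding SNR_a_sbs_def SNR_b_def by measurable
  also have "(\<lambda>\<omega>. (served_sbs P N \<omega> \<and> N_sbs P N \<omega> = k)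
      \<and> \<rho> * real k < W_a P * log 2 (1 + SNR_a_sbs P N \<omega>) \<and> \<rho> * D \<omega> < W_b P * log 2 (1 + SNR_b P N \<omega>))
    = (\<lambda>\<omega>. served_sbs P N \<omega> \<and> N_sbs P N \<omega> = k \<and> sbs_rate_exceeds s P N \<rho> \<omega>)"
    by (cases s) (auto simp: sbs_rate_exceeds_def D_def fun_eq_iff)
  finally show ?thesis by measurable
qed

section \<open>Summation over the number of users at the serving station\<close>

lemma Pr_m_sum:
  "Pr_m P N \<rho> = (\<Sum>k = 1..n_usr P.
     prob {\<omega> \<in> space (prb N). \<not> served_sbs P N \<omega> \<and> N_abs P N \<omega> = k \<and> abs_rate_exceeds P N \<rho> \<omega>})"
proof -
  have "{\<omega> \<in> space (prb N). \<not> served_sbs P N \<omega> \<and> abs_rate_exceeds P N \<rho> \<omega>}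
      = (\<Union>k\<in>{1..n_usr P}. {\<omega> \<in> space (prb N). \<not> served_sbs P N \<omega> \<and> N_abs P N \<omega> = k \<and> abs_rate_exceeds P N \<rho> \<omega>})"
    using N_abs_range by auto
  then show ?thesis
    unfolding Pr_m_def
    by (simp only:) (intro finite_measure_finite_Union, use abs_event_measurable in \<open>auto simp: disjoint_family_on_def\<close>)
qed

lemma Pr_s_sum:
  "Pr_s s P N \<rho> = (\<Sum>k = 1..n_usr P.
     prob {\<omega> \<in> space (prb N). served_sbs P N \<omega> \<and> N_sbs P N \<omega> = k \<and> sbs_rate_exceeds s P N \<rho> \<omega>})"
proof -
  have "{\<omega> \<in> space (prb N). served_sbs P N \<omega> \<and> sbs_rate_exceeds s P N \<rho> \<omega>}
      = (\<Union>k\<in>{1..n_usr P}. {\<omega> \<in> space (prb N). served_sbs P N \<omega> \<and> N_sbs P N \<omega> = k \<and> sbs_rate_exceeds s P N \<rho> \<omega>})"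
    using N_sbs_range by auto
  then show ?thesis
    unfolding Pr_s_def
    by (simp only:) (intro finite_measure_finite_Union, use sbs_event_measurable in \<open>auto simp: disjoint_family_on_def\<close>)
qed

lemma Pr_rate_eq: "Pr_rate s P N \<rho> = Pr_m P N \<rho> + Pr_s s P N \<rho>"
proof -
  let ?M = "{\<omega> \<in> space (prb N). \<not> served_sbs P N \<omega> \<and> abs_rate_exceeds P N \<rho> \<omega>}"
  let ?S = "{\<omega> \<in> space (prb N). served_sbs P N \<omega> \<and> sbs_rate_exceeds s P N \<rho> \<omega>}"
  have M: "?M = (\<Union>k\<in>{1..n_usr P}. {\<omega> \<in> space (prb N). \<not> served_sbs P N \<omega> \<and> N_abs P N \<omega> = k \<and> abs_rate_exceeds P N \<rho> \<omega>})"
    using N_abs_range by auto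
  have S: "?S = (\<Union>k\<in>{1..n_usr P}. {\<omega> \<in> space (prb N). served_sbs P N \<omega> \<and> N_sbs P N \<omega> = k \<and> sbs_rate_exceeds s P N \<rho> \<omega>})"
    using N_sbs_range by auto
  have "?M \<in> events" "?S \<in> events"
    unfolding M S by (intro sets.finite_UN; use abs_event_measurable sbs_event_measurable in simp)+
  then have "prob (?M \<union> ?S) = prob ?M + prob ?S"
    by (intro finite_measure_Union) auto
  moreover have "{\<omega> \<in> space (prb N). if served_sbs P N \<omega> then sbs_rate_exceeds s P N \<rho> \<omega> else abs_rate_exceeds P N \<rho> \<omega>}
      = ?M \<union> ?S"
    by auto
  ultimately show ?thesis
    by (simp add: Pr_rate_def Pr_m_def Pr_s_def)
qed

lemma Pr_m_formula:
  "Pr_m P N \<rho> =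
        (\<Sum>k = 1..n_usr P. real ((n_usr P - 1) choose (k - 1)) *
           (LBINT t.
              (LBINT x:{0..rad P - rad_s P}.
                 Pc_m P (exp2 (ereal (\<rho> * (t + real k)) / ereal (W_a P)) - 1) x
                 * A_m P x ^ (k - 1) * A_s P x ^ (n_usr P - k) * f_X P x)
              * (1 / (sigma_m P * sqrt (2 * pi))
                 * exp (- ((t - upsilon_m P)\<^sup>2 / (2 * (sigma_m P)\<^sup>2))))))"
  unfolding Pr_m_sum
proof (intro sum.cong refl)
  fix k assume "k \<in> {1..n_usr P}"
  then have k: "1 \<le> k" by simp
  note [measurable] = served_set_sets[of False k]
  \<comment> \<open>Membership in \<open>served_set\<close> fixes the count at \<open>k\<close>, so
    the load enters only through \<open>t\<close> and everything else is a function of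
    \<open>rep_data\<close>.\<close>
  define Q where "Q t z \<longleftrightarrow> loc_part z \<in> served_set False k
    \<and> \<rho> * (t + real k) < W_a P * log 2 (1 + snr_part (pow_m P * gain P) Access_ABS z)" for t z
  have Q: "Q t (rep_data P N \<omega>) \<longleftrightarrow> \<not> served_sbs P N \<omega> \<and> N_abs P N \<omega> = k
      \<and> \<rho> * (t + real k) < W_a P * log 2 (1 + SNR_a_abs P N \<omega>)" if "\<omega> \<in> space (prb N)" for t \<omega>
    using served_set_iff(2)[OF that] by (auto simp: Q_def loc_part_rep_data snr_part_rep_data SNR_a_abs_def)
  \<comment> \<open>This holds for every \<open>t\<close>, because \<open>W_a P\<close> is positive
    and the threshold stays finite for all loads.\<close>
  have sec: "prob {\<omega> \<in> space (prb N). Q t (rep_data P N \<omega>)} = real ((n_usr P - 1) choose (k - 1)) *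
      (LBINT x:{0..rad P - rad_s P}. Pc_m P (exp2 (ereal (\<rho> * (t + real k)) / ereal (W_a P)) - 1) x
        * A_m P x ^ (k - 1) * A_s P x ^ (n_usr P - k) * f_X P x)" for t
    unfolding prob_abs_served_exceeds[OF k, symmetric]
    by (intro arg_cong[where f = prob]) (auto simp: Q)
  have "prob {\<omega> \<in> space (prb N). \<not> served_sbs P N \<omega> \<and> N_abs P N \<omega> = k \<and> abs_rate_exceeds P N \<rho> \<omega>}
      = prob {\<omega> \<in> space (prb N). Q (load_m N \<omega>) (rep_data P N \<omega>)}"
    by (intro arg_cong[where f = prob]) (auto simp: Q abs_rate_exceeds_def add.commute)
  also have "\<dots> = (LBINT t. prob {\<omega> \<in> space (prb N). Q t (rep_data P N \<omega>)} * normal_density (upsilon_m P) (sigma_m P) t)"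
    by (rule prob_load_mix(1)[OF load_m_law load_m_indep rep_data_measurable]) (unfold Q_def, measurable)
  also have "\<dots> = (LBINT t. real ((n_usr P - 1) choose (k - 1)) *
      ((LBINT x:{0..rad P - rad_s P}. Pc_m P (exp2 (ereal (\<rho> * (t + real k)) / ereal (W_a P)) - 1) x
        * A_m P x ^ (k - 1) * A_s P x ^ (n_usr P - k) * f_X P x)
        * (1 / (sigma_m P * sqrt (2 * pi)) * exp (- ((t - upsilon_m P)\<^sup>2 / (2 * (sigma_m P)\<^sup>2))))))"
    unfolding sec normal_density_expand[OF sigma_m_pos] by (simp only: mult.assoc)
  finally show "prob {\<omega> \<in> space (prb N). \<not> served_sbs P N \<omega> \<and> N_abs P N \<omega> = k \<and> abs_rate_exceeds P N \<rho> \<omega>}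
      = real ((n_usr P - 1) choose (k - 1)) * (LBINT t. (LBINT x:{0..rad P - rad_s P}.
        Pc_m P (exp2 (ereal (\<rho> * (t + real k)) / ereal (W_a P)) - 1) x
        * A_m P x ^ (k - 1) * A_s P x ^ (n_usr P - k) * f_X P x)
        * (1 / (sigma_m P * sqrt (2 * pi)) * exp (- ((t - upsilon_m P)\<^sup>2 / (2 * (sigma_m P)\<^sup>2)))))"
    by (simp only: integral_mult_right_zero)
qed

lemma Pr_s_Equal_formula:
  assumes \<rho>: "0 < \<rho>"
  shows "Pr_s Equal P N \<rho> =
        (\<Sum>k = 1..n_usr P. real ((n_usr P - 1) choose (k - 1)) *
           (LBINT x:{0..rad P - rad_s P}.
              Pc_s P (exp2 (ereal (\<rho> * real (n_hot P) * real k) / ereal (W_b P)) - 1)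
                     (exp2 (ereal (\<rho> * real k) / ereal (W_a P)) - 1) x
              * A_s P x ^ (k - 1) * A_m P x ^ (n_usr P - k) * f_X P x))"
  unfolding Pr_s_sum
proof (intro sum.cong refl)
  fix k assume "k \<in> {1..n_usr P}"
  then have k: "1 \<le> k" by simp
  \<comment> \<open>The backhaul target is positive, so a vanishing \<open>W_b P\<close> gives the
    threshold infinity and the formula persists.\<close>
  have ne: "\<rho> * real (n_hot P) * real k \<noteq> 0" using \<rho> k pos by simp
  show "prob {\<omega> \<in> space (prb N). served_sbs P N \<omega> \<and> N_sbs P N \<omega> = k \<and> sbs_rate_exceeds Equal P N \<rho> \<omega>}
      = real ((n_usr P - 1) choose (k - 1)) * (LBINT x:{0..rad P - rad_s P}.
              Pc_s P (exp2 (ereal (\<rho> * real (n_hot P) * real k) / ereal (W_b P)) - 1)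
                     (exp2 (ereal (\<rho> * real k) / ereal (W_a P)) - 1) x
              * A_s P x ^ (k - 1) * A_m P x ^ (n_usr P - k) * f_X P x)"
    unfolding prob_sbs_served_exceeds[OF k ne, symmetric]
    by (intro arg_cong[where f = prob]) (auto simp: sbs_rate_exceeds_def mult.assoc)
qed

lemma Pr_s_Load_Based_formula:
  assumes \<rho>: "0 < \<rho>"
  shows "Pr_s Load_Based P N \<rho> =
        (\<Sum>k = 1..n_usr P. real ((n_usr P - 1) choose (k - 1)) *
           (LBINT t.
              (LBINT x:{0..rad P - rad_s P}.
                 Pc_s P (exp2 (ereal (\<rho> * (real k + t)) / ereal (W_b P)) - 1)
                        (exp2 (ereal (\<rho> * real k) / ereal (W_a P)) - 1) x
                 * A_s P x ^ (k - 1) * A_m P x ^ (n_usr P - k) * f_X P x)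
              * (1 / (sigma_s P * sqrt (2 * pi))
                 * exp (- ((t - upsilon_s P)\<^sup>2 / (2 * (sigma_s P)\<^sup>2))))))"
  unfolding Pr_s_sum
proof (intro sum.cong refl)
  fix k assume "k \<in> {1..n_usr P}"
  then have k: "1 \<le> k" by simp
  note [measurable] = served_set_sets[of True k]
  define Q where "Q t z \<longleftrightarrow> loc_part z \<in> served_set True k
    \<and> \<rho> * real k < W_a P * log 2 (1 + snr_part (pow_s P * gain P) Access_SBS z)
    \<and> \<rho> * (real k + t) < W_b P * log 2 (1 + snr_part (pow_m P * (gain P)\<^sup>2) Backhaul z)" for t z
  define J where "J t = (LBINT x:{0..rad P - rad_s P}.
        Pc_s P (exp2 (ereal (\<rho> * (real k + t)) / ereal (W_b P)) - 1) (exp2 (ereal (\<rho> * real k) / ereal (W_a P)) - 1) x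
        * A_s P x ^ (k - 1) * A_m P x ^ (n_usr P - k) * f_X P x)" for t
  let ?c = "real ((n_usr P - 1) choose (k - 1))"
  let ?nd = "\<lambda>t. 1 / (sigma_s P * sqrt (2 * pi)) * exp (- ((t - upsilon_s P)\<^sup>2 / (2 * (sigma_s P)\<^sup>2)))"
  let ?p = "\<lambda>t. prob {\<omega> \<in> space (prb N). Q t (rep_data P N \<omega>)}"
  have sigma: "0 < sigma_s P" using sigma_m_pos by (simp add: sigma_s_def)
  have Q: "Q t (rep_data P N \<omega>) \<longleftrightarrow> served_sbs P N \<omega> \<and> N_sbs P N \<omega> = k
      \<and> \<rho> * real k < W_a P * log 2 (1 + SNR_a_sbs P N \<omega>) \<and> \<rho> * (real k + t) < W_b P * log 2 (1 + SNR_b P N \<omega>)"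
    if "\<omega> \<in> space (prb N)" for t \<omega>
    using served_set_iff(1)[OF that] by (auto simp: Q_def loc_part_rep_data snr_part_rep_data SNR_a_sbs_def SNR_b_def)
  have sec: "?p t = ?c * J t" if "t \<noteq> - real k" for t
  proof -
    have ne: "\<rho> * (real k + t) \<noteq> 0" using \<rho> that by auto
    show ?thesis
      unfolding J_def prob_sbs_served_exceeds[OF k ne, symmetric]
      by (intro arg_cong[where f = prob]) (auto simp: Q)
  qed
  have Qm: "Measurable.pred (borel \<Otimes>\<^sub>M rep_space P) (\<lambda>z. Q (fst z) (snd z))"
    unfolding Q_def by measurable
  note mix = prob_load_mix[OF load_s_law load_s_indep rep_data_measurable Qm]
  have "prob {\<omega> \<in> space (prb N). served_sbs P N \<omega> \<and> N_sbs P N \<omega> = k \<and> sbs_rate_exceeds Load_Based P N \<rho> \<omega>}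
      = prob {\<omega> \<in> space (prb N). Q (load_s N \<omega>) (rep_data P N \<omega>)}"
    by (intro arg_cong[where f = prob]) (auto simp: Q sbs_rate_exceeds_def)
  also have "\<dots> = (LBINT t. ?p t * normal_density (upsilon_s P) (sigma_s P) t)"
    by (rule mix(1))
  also have "\<dots> = (LBINT t. ?c * (J t * ?nd t))"
  proof (rule integral_cong_AE)
    note [measurable] = mix(2)
    show "(\<lambda>t. ?p t * normal_density (upsilon_s P) (sigma_s P) t) \<in> borel_measurable lborel"
      by measurable
    have "(\<lambda>t. if t = - real k then ?c * (J t * ?nd t) else ?p t * ?nd t) = (\<lambda>t. ?c * (J t * ?nd t))"
      by (auto simp: fun_eq_iff sec)
    moreover have "(\<lambda>t. if t = - real k then ?c * (J (- real k) * ?nd (- real k)) else ?p t * ?nd t) \<in> borel_measurable lborel"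
      by measurable
    moreover have "(\<lambda>t. if t = - real k then ?c * (J t * ?nd t) else ?p t * ?nd t)
        = (\<lambda>t. if t = - real k then ?c * (J (- real k) * ?nd (- real k)) else ?p t * ?nd t)"
      by auto
    ultimately show "(\<lambda>t. ?c * (J t * ?nd t)) \<in> borel_measurable lborel"
      by (simp only:)
    show "AE t in lborel. ?p t * normal_density (upsilon_s P) (sigma_s P) t = ?c * (J t * ?nd t)"
      using AE_lborel_singleton[of "- real k"]
      by eventually_elim (simp add: sec normal_density_expand[OF sigma])
  qed
  finally show "prob {\<omega> \<in> space (prb N). served_sbs P N \<omega> \<and> N_sbs P N \<omega> = k \<and> sbs_rate_exceeds Load_Based P N \<rho> \<omega>}
      = ?c * (LBINT t. (LBINT x:{0..rad P - rad_s P}.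
        Pc_s P (exp2 (ereal (\<rho> * (real k + t)) / ereal (W_b P)) - 1) (exp2 (ereal (\<rho> * real k) / ereal (W_a P)) - 1) x
        * A_s P x ^ (k - 1) * A_m P x ^ (n_usr P - k) * f_X P x) * ?nd t)"
    by (simp only: integral_mult_right_zero J_def)
qed

end

theorem theorem2:
  fixes P :: net_params and N :: "'a network" and \<rho> :: real
  assumes "cellular_network N P"
    and "\<rho> > 0"
  shows "(\<forall>s. Pr_rate s P N \<rho> = Pr_m P N \<rho> + Pr_s s P N \<rho>)
    \<and> Pr_m P N \<rho> =
        (\<Sum>k = 1..n_usr P. real ((n_usr P - 1) choose (k - 1)) *
           (LBINT t.
              (LBINT x:{0..rad P - rad_s P}.
                 Pc_m P (exp2 (ereal (\<rho> * (t + real k)) / ereal (W_a P)) - 1) x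
                 * A_m P x ^ (k - 1) * A_s P x ^ (n_usr P - k) * f_X P x)
              * (1 / (sigma_m P * sqrt (2 * pi))
                 * exp (- ((t - upsilon_m P)\<^sup>2 / (2 * (sigma_m P)\<^sup>2))))))
    \<and> Pr_s Equal P N \<rho> =
        (\<Sum>k = 1..n_usr P. real ((n_usr P - 1) choose (k - 1)) *
           (LBINT x:{0..rad P - rad_s P}.
              Pc_s P (exp2 (ereal (\<rho> * real (n_hot P) * real k) / ereal (W_b P)) - 1)
                     (exp2 (ereal (\<rho> * real k) / ereal (W_a P)) - 1) x
              * A_s P x ^ (k - 1) * A_m P x ^ (n_usr P - k) * f_X P x))
    \<and> Pr_s Load_Based P N \<rho> =
        (\<Sum>k = 1..n_usr P. real ((n_usr P - 1) choose (k - 1)) *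
           (LBINT t.
              (LBINT x:{0..rad P - rad_s P}.
                 Pc_s P (exp2 (ereal (\<rho> * (real k + t)) / ereal (W_b P)) - 1)
                        (exp2 (ereal (\<rho> * real k) / ereal (W_a P)) - 1) x
                 * A_s P x ^ (k - 1) * A_m P x ^ (n_usr P - k) * f_X P x)
              * (1 / (sigma_s P * sqrt (2 * pi))
                 * exp (- ((t - upsilon_s P)\<^sup>2 / (2 * (sigma_s P)\<^sup>2))))))"
proof -
  interpret cellular_network N P by fact
  show ?thesis
    using Pr_rate_eq Pr_m_formula Pr_s_Equal_formula[OF assms(2)] Pr_s_Load_Based_formula[OF assms(2)]
    by (intro conjI allI)
qed

end
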